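(* Let $G$ be a group, let $\Gamma$ be a connected, locally finite, quasi-transitive $G$-graph, and let $\mathcal{H}$ be a thin, $G$-invariant peripheral system of $\Gamma$. Then the following are equivalent: (1) $\Gamma$ is accessible relative to $\mathcal{H}$; (2) $\mathcal{B}_{\mathcal{H}}(\Gamma)$ is finitely generated as a $G$-module.
   Context: Graphs are simple and undirected. A $G$-graph is a graph with an action of the group $G$ by automorphisms; it is quasi-transitive if there are finitely many $G$-orbits of vertices. For $b\subset V(\Gamma)$ write $b^*=V(\Gamma)\setminus b$, and let $\delta b$ be the set of edges with one endpoint in $b$ and the other in $b^*$. $\mathcal{B}(\Gamma)=\{b\subset V(\Gamma): |\delta b|<\infty\}$ is a Boolean ring (addition is symmetric difference, multiplication is intersection); its elements are called cuts. If $\Gamma$ is a $G$-graph, $G$ acts on $\mathcal{B}(\Gamma)$, and $\mathcal B(\Gamma)$ is viewed as a $G$-module by forgetting multiplication. A peripheral system is a collection $\mathcal{H}$ of subsets of $V(\Gamma)$. It is $G$-invariant if $gH\in\mathcal{H}$ for all $g\in G$, $H\in\mathcal{H}$, and thin if every vertex of $\Gamma$ lies in at most finitely many $H\in\mathcal{H}$. A cut $b\in\mathcal{B}(\Gamma)$ is $\mathcal{H}$-elliptic if for every $H\in\mathcal{H}$ either $b\cap H$ or $b^*\cap H$ is finite. $\mathcal{B}_{\mathcal{H}}(\Gamma)$ denotes the set of $\mathcal{H}$-elliptic cuts; it is a subring of $\mathcal{B}(\Gamma)$, and is $G$-invariant when $\mathcal{H}$ is. For $\Gamma$ connected and locally finite,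 $\Omega(\Gamma)$ is its set of ends, and for $b\subset V(\Gamma)$, $\Lambda(b)\subset\Omega(\Gamma)$ is the set of ends in the closure of $b$ in the Freudenthal (end) compactification. A cut $b$ separates ends $\omega_1,\omega_2$ if one of them lies in $\Lambda(b)$ and the other in $\Lambda(b^* )$. $\Gamma$ is accessible relative to $\mathcal{H}$ if there exists $k\ge 1$ such that for every pair of distinct ends $\omega_1,\omega_2$ of $\Gamma$, if some $\mathcal{H}$-elliptic cut separates $\omega_1$ and $\omega_2$, then some $\mathcal{H}$-elliptic cut $b'$ with $|\delta b'|\le k$ separates them. *)

theory Defs
  imports "HOL-Analysis.Analysis" "HOL-Algebra.Ring" "HOL-Algebra.Group_Action"
begin

section \<open>Simple graphs\<close>

record 'v ugraph =
  verts :: "'v set"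
  edges :: "'v set set"

definition simple_graph :: "'v ugraph \<Rightarrow> bool" where
  "simple_graph \<Gamma> \<longleftrightarrow> (\<forall>e \<in> edges \<Gamma>. e \<subseteq> verts \<Gamma> \<and> card e = 2)"

definition locally_finite_graph :: "'v ugraph \<Rightarrow> bool" where
  "locally_finite_graph \<Gamma> \<longleftrightarrow> (\<forall>v \<in> verts \<Gamma>. finite {e \<in> edges \<Gamma>. v \<in> e})"

definition adjacency :: "'v ugraph \<Rightarrow> ('v \<times> 'v) set" where
  "adjacency \<Gamma> = {(u, v). {u, v} \<in> edges \<Gamma>}"

definition connected_graph :: "'v ugraph \<Rightarrow> bool" where
  "connected_graph \<Gamma> \<longleftrightarrow> (\<forall>u \<in> verts \<Gamma>. \<forall>v \<in> verts \<Gamma>. (u, v) \<in> (adjacency \<Gamma>)\<^sup>*)"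

definition delete_verts :: "'v ugraph \<Rightarrow> 'v set \<Rightarrow> 'v ugraph" where
  "delete_verts \<Gamma> K = \<lparr>verts = verts \<Gamma> - K, edges = {e \<in> edges \<Gamma>. e \<inter> K = {}}\<rparr>"

definition graph_components :: "'v ugraph \<Rightarrow> 'v set set" where
  "graph_components \<Gamma> = (\<lambda>v. (adjacency \<Gamma>)\<^sup>* `` {v}) ` verts \<Gamma>"


section \<open>Group actions on graphs\<close>

text \<open>
  The library's \<^locale>\<open>group_action\<close> makes every \<open>\<phi> g\<close> a bijection of the vertex set;
  the second conjunct says that it is a graph automorphism.
\<close>

definition G_graph :: "('g, 'm) monoid_scheme \<Rightarrow> 'v ugraph \<Rightarrow> ('g \<Rightarrow> 'v \<Rightarrow> 'v) \<Rightarrow> bool" where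
  "G_graph G \<Gamma> \<phi> \<longleftrightarrow>
     simple_graph \<Gamma> \<and> group_action G (verts \<Gamma>) \<phi> \<and>
     (\<forall>g \<in> carrier G. \<forall>u \<in> verts \<Gamma>. \<forall>v \<in> verts \<Gamma>.
        {\<phi> g u, \<phi> g v} \<in> edges \<Gamma> \<longleftrightarrow> {u, v} \<in> edges \<Gamma>)"

definition quasi_transitive ::
    "('g, 'm) monoid_scheme \<Rightarrow> 'v ugraph \<Rightarrow> ('g \<Rightarrow> 'v \<Rightarrow> 'v) \<Rightarrow> bool" where
  "quasi_transitive G \<Gamma> \<phi> \<longleftrightarrow> finite (orbits G (verts \<Gamma>) \<phi>)"


section \<open>Cuts\<close>

definition coboundary :: "'v ugraph \<Rightarrow> 'v set \<Rightarrow> 'v set set" where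
  "coboundary \<Gamma> b = {e \<in> edges \<Gamma>. \<exists>u \<in> b. \<exists>v \<in> verts \<Gamma> - b. e = {u, v}}"

definition cuts :: "'v ugraph \<Rightarrow> 'v set set" where
  "cuts \<Gamma> = {b. b \<subseteq> verts \<Gamma> \<and> finite (coboundary \<Gamma> b)}"

definition cut_ring :: "'v ugraph \<Rightarrow> 'v set ring" where
  "cut_ring \<Gamma> = \<lparr>carrier = cuts \<Gamma>, mult = (\<inter>), one = verts \<Gamma>, zero = {}, add = sym_diff\<rparr>"


section \<open>Peripheral systems\<close>

definition peripheral_system :: "'v ugraph \<Rightarrow> 'v set set \<Rightarrow> bool" where
  "peripheral_system \<Gamma> \<H> \<longleftrightarrow> (\<forall>H \<in> \<H>. H \<subseteq> verts \<Gamma>)"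

definition G_invariant ::
    "('g, 'm) monoid_scheme \<Rightarrow> ('g \<Rightarrow> 'v \<Rightarrow> 'v) \<Rightarrow> 'v set set \<Rightarrow> bool" where
  "G_invariant G \<phi> \<H> \<longleftrightarrow> (\<forall>g \<in> carrier G. \<forall>H \<in> \<H>. \<phi> g ` H \<in> \<H>)"

definition thin :: "'v ugraph \<Rightarrow> 'v set set \<Rightarrow> bool" where
  "thin \<Gamma> \<H> \<longleftrightarrow> (\<forall>v \<in> verts \<Gamma>. finite {H \<in> \<H>. v \<in> H})"

definition elliptic_cuts :: "'v ugraph \<Rightarrow> 'v set set \<Rightarrow> 'v set set" where
  "elliptic_cuts \<Gamma> \<H> =
     {b \<in> cuts \<Gamma>. \<forall>H \<in> \<H>. finite (b \<inter> H) \<or> finite ((verts \<Gamma> - b) \<inter> H)}"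

definition elliptic_ring :: "'v ugraph \<Rightarrow> 'v set set \<Rightarrow> 'v set ring" where
  "elliptic_ring \<Gamma> \<H> = (cut_ring \<Gamma>)\<lparr>carrier := elliptic_cuts \<Gamma> \<H>\<rparr>"


section \<open>Finitely generated G-modules\<close>

text \<open>
  A \<open>G\<close>-module is an abelian group \<open>M\<close> (in multiplicative record notation) together with an
  action \<open>\<psi>\<close> of \<open>G\<close> on it by group automorphisms.
\<close>

definition G_submodule ::
    "('g, 'm) monoid_scheme \<Rightarrow> ('a, 'n) monoid_scheme \<Rightarrow> ('g \<Rightarrow> 'a \<Rightarrow> 'a) \<Rightarrow> 'a set \<Rightarrow> bool" where
  "G_submodule G M \<psi> N \<longleftrightarrow> subgroup N M \<and> (\<forall>g \<in> carrier G. \<forall>x \<in> N. \<psi> g x \<in> N)"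

definition G_span ::
    "('g, 'm) monoid_scheme \<Rightarrow> ('a, 'n) monoid_scheme \<Rightarrow> ('g \<Rightarrow> 'a \<Rightarrow> 'a) \<Rightarrow> 'a set \<Rightarrow> 'a set" where
  "G_span G M \<psi> S = \<Inter> {N. G_submodule G M \<psi> N \<and> S \<subseteq> N}"

definition fin_gen_G_module ::
    "('g, 'm) monoid_scheme \<Rightarrow> ('a, 'n) monoid_scheme \<Rightarrow> ('g \<Rightarrow> 'a \<Rightarrow> 'a) \<Rightarrow> bool" where
  "fin_gen_G_module G M \<psi> \<longleftrightarrow>
     (\<exists>S. finite S \<and> S \<subseteq> carrier M \<and> G_span G M \<psi> S = carrier M)"


section \<open>Ends and the end compactification\<close>

text \<open>
  The space of ends is the inverse limit, over the finite vertex sets \<open>K\<close>, of the sets of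
  components of \<open>\<Gamma> - K\<close>. In a connected locally finite graph the components chosen by an
  end are automatically infinite.
\<close>

definition finite_vsets :: "'v ugraph \<Rightarrow> 'v set set" where
  "finite_vsets \<Gamma> = {K. finite K \<and> K \<subseteq> verts \<Gamma>}"

definition ends :: "'v ugraph \<Rightarrow> ('v set \<Rightarrow> 'v set) set" where
  "ends \<Gamma> =
     {\<omega> \<in> (\<Pi>\<^sub>E K \<in> finite_vsets \<Gamma>. graph_components (delete_verts \<Gamma> K)).
        \<forall>K \<in> finite_vsets \<Gamma>. \<forall>L \<in> finite_vsets \<Gamma>. K \<subseteq> L \<longrightarrow> \<omega> L \<subseteq> \<omega> K}"

text \<open>
  The Freudenthal compactification, restricted to vertices (\<open>Inl\<close>) and ends (\<open>Inr\<close>): the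
  vertices are isolated, and each component \<open>C\<close> of \<open>\<Gamma> - K\<close> gives the open set consisting of
  \<open>C\<close> and all ends living in \<open>C\<close>. Leaving out the interior points of edges does not change
  which ends are in the closure of a set of vertices.
\<close>

definition freudenthal :: "'v ugraph \<Rightarrow> ('v + ('v set \<Rightarrow> 'v set)) topology" where
  "freudenthal \<Gamma> = topology_generated_by
     ((\<lambda>v. {Inl v}) ` verts \<Gamma> \<union>
      {Inl ` C \<union> Inr ` {\<omega> \<in> ends \<Gamma>. \<omega> K = C} | K C.
         K \<in> finite_vsets \<Gamma> \<and> C \<in> graph_components (delete_verts \<Gamma> K)})"

definition limit_ends :: "'v ugraph \<Rightarrow> 'v set \<Rightarrow> ('v set \<Rightarrow> 'v set) set" where
  "limit_ends \<Gamma> b = {\<omega> \<in> ends \<Gamma>. Inr \<omega> \<in> freudenthal \<Gamma> closure_of (Inl ` b)}"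

definition separates ::
    "'v ugraph \<Rightarrow> 'v set \<Rightarrow> ('v set \<Rightarrow> 'v set) \<Rightarrow> ('v set \<Rightarrow> 'v set) \<Rightarrow> bool" where
  "separates \<Gamma> b \<omega>\<^sub>1 \<omega>\<^sub>2 \<longleftrightarrow>
     \<omega>\<^sub>1 \<in> limit_ends \<Gamma> b \<and> \<omega>\<^sub>2 \<in> limit_ends \<Gamma> (verts \<Gamma> - b) \<or>
     \<omega>\<^sub>2 \<in> limit_ends \<Gamma> b \<and> \<omega>\<^sub>1 \<in> limit_ends \<Gamma> (verts \<Gamma> - b)"

definition accessible_relative :: "'v ugraph \<Rightarrow> 'v set set \<Rightarrow> bool" where
  "accessible_relative \<Gamma> \<H> \<longleftrightarrow>
     (\<exists>k \<ge> 1. \<forall>\<omega>\<^sub>1 \<in> ends \<Gamma>. \<forall>\<omega>\<^sub>2 \<in> ends \<Gamma>. \<omega>\<^sub>1 \<noteq> \<omega>\<^sub>2 \<longrightarrow>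
        (\<exists>b \<in> elliptic_cuts \<Gamma> \<H>. separates \<Gamma> b \<omega>\<^sub>1 \<omega>\<^sub>2) \<longrightarrow>
        (\<exists>b' \<in> elliptic_cuts \<Gamma> \<H>. card (coboundary \<Gamma> b') \<le> k \<and> separates \<Gamma> b' \<omega>\<^sub>1 \<omega>\<^sub>2))"

end

theory Submission
  imports Defs "HOL-Library.Multiset"
begin

text \<open>
  For a cut \<open>b\<close> and an end \<open>\<omega>\<close>, whether \<open>\<omega>\<close> lies in \<open>\<Lambda>(b)\<close> is additive in \<open>b\<close>. So if finitely
  many cuts with at most \<open>k\<close> boundary edges generate the module, then two ends separated by an
  elliptic cut are separated by a translate of a generator.

  Conversely let \<open>\<Gamma>\<close> be accessible relative to \<open>\<H>\<close>. Submodularity makes the span of the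
  elliptic cuts with at most \<open>k\<close> boundary edges a ring, and a compactness argument with
  ultrafilters shows that for large \<open>k\<close> it contains every elliptic cut. It remains to
  generate the elliptic cuts \<open>b\<close> with at most \<open>k\<close> boundary edges by elliptic cuts of bounded
  diameter. Write \<open>b\<close> as a sum of at most \<open>k + 1\<close> bonds, which have bounded diameter but need
  not be elliptic, and merge bonds that are close together. A piece \<open>p\<close> far from all other
  pieces can split some \<open>H \<in> \<H>\<close> into infinite parts. By thinness and ping-pong the stabiliser
  of \<open>H\<close> then contains an element \<open>g\<close> translating \<open>p\<close> along an axis. Since the other pieces have
  boundedly many edges, \<open>H\<close> must be two-ended along this axis, and up to equivalence
  boundedly many such \<open>H\<close> are split by \<open>p\<close>. Hence \<open>p\<close> is, modulo bounded elliptic cuts, a sum of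
  atoms, each of which splits only one class of \<open>H\<close>. In \<open>b\<close> the atoms of each class
  cancel in pairs: \<open>f + f'\<close> is the sum of \<open>f + g\<^sup>n f\<close>, which telescopes into translates of
  \<open>f + g f\<close>, and of \<open>g\<^sup>n f + f'\<close>, which is bounded for suitable \<open>n\<close>.
\<close>

section \<open>Symmetric differences of multisets of sets\<close>

text \<open>Bounded diameter is as good as finitely many generators: a ball has finitely many edges,
  a coboundary determines its cut up to complement, and there are finitely many orbits of centres.
  Bonds have bounded diameter because only finitely many of given size cross a given edge, which may
  fail for other cuts. The obstacle is a bond that splits peripheral sets and has no partner nearby.
  A dichotomy handles it. If some finite set meets every completion of the bond to an elliptic cut
  by few edges, that set gives a radius within which another piece must be found. Otherwise
  completions exist arbitrarily far away (\<open>far\<close>), and they serve as test cuts. In both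
  cases finitely many orbits make the radius uniform. The test cuts are exploited by one counting
  principle: a coboundary with at most \<open>k\<close> edges leaves one of \<open>k + 1\<close>
  disjoint regions free of its edges, and there the completion agrees with the bond. This yields
  two-endedness, the bound on the number of classes, and the gap in which an atom is cut
  off.\<close>

definition msum :: "'a set multiset \<Rightarrow> 'a set" where
  "msum M = {x. odd (size {#p \<in># M. x \<in> p#})}"

lemma msum_empty [simp]: "msum {#} = {}"
  by (simp add: msum_def)

lemma msum_add_mset [simp]: "msum (add_mset p M) = sym_diff p (msum M)"
  by (auto simp: msum_def)

lemma msum_union [simp]: "msum (M + N) = sym_diff (msum M) (msum N)"
  by (auto simp: msum_def)

lemma msum_image:
  assumes "inj_on f V" and "\<And>p. p \<in># M \<Longrightarrow> p \<subseteq> V"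
  shows "msum (image_mset ((`) f) M) = f ` msum M \<and> msum M \<subseteq> V"
  using assms(2)
proof (induction M)
  case (add p M)
  then have IH: "msum (image_mset ((`) f) M) = f ` msum M" "msum M \<subseteq> V" and p: "p \<subseteq> V"
    by auto
  have "f ` sym_diff p (msum M) = sym_diff (f ` p) (f ` msum M)"
    using IH(2) p assms(1) by (auto simp: inj_on_def)
  then show ?case
    using IH p by auto
qed auto

text \<open>Every element is its own inverse, so sums of multisets already form the additive span.
  Multisets are kept because the later inductions run over the number of summands.\<close>

definition sdspan :: "'a set set \<Rightarrow> 'a set set" where
  "sdspan X = {msum M | M. set_mset M \<subseteq> X}"

lemma sdspan_empty [simp]: "{} \<in> sdspan X"
  unfolding sdspan_def by (auto intro!: exI[of _ "{#}"])

lemma sdspan_base: "x \<in> X \<Longrightarrow> x \<in> sdspan X"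
  unfolding sdspan_def by (auto intro!: exI[of _ "{#x#}"])

lemma sdspan_add: "a \<in> sdspan X \<Longrightarrow> b \<in> sdspan X \<Longrightarrow> sym_diff a b \<in> sdspan X"
  unfolding sdspan_def by (clarsimp) (metis (no_types) msum_union set_mset_union Un_least)

lemma sdspan_induct [consumes 1, case_names empty add]:
  assumes "a \<in> sdspan X" and "P {}"
    and "\<And>x a. x \<in> X \<Longrightarrow> a \<in> sdspan X \<Longrightarrow> P a \<Longrightarrow> P (sym_diff x a)"
  shows "P a"
proof -
  obtain M where M: "set_mset M \<subseteq> X" "a = msum M"
    using assms(1) by (auto simp: sdspan_def)
  from M(1) have "P (msum M)"
  proof (induction M)
    case (add p M)
    then have "msum M \<in> sdspan X"
      by (auto simp: sdspan_def)
    with add show ?case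
      by (auto intro!: assms(3))
  qed (use assms in auto)
  with M show ?thesis by simp
qed

lemma sdspan_mono: "X \<subseteq> Y \<Longrightarrow> sdspan X \<subseteq> sdspan Y"
  unfolding sdspan_def by blast

lemma sdspan_subset_sdspan: "X \<subseteq> sdspan Y \<Longrightarrow> sdspan X \<subseteq> sdspan Y"
proof
  fix a assume "X \<subseteq> sdspan Y" "a \<in> sdspan X"
  from this(2,1) show "a \<in> sdspan Y"
    by (induction rule: sdspan_induct) (auto intro!: sdspan_add)
qed

text \<open>Intersection distributes over symmetric difference, so products need to be controlled on
  generators only.\<close>

lemma sdspan_Int:
  assumes "\<And>x y. x \<in> X \<Longrightarrow> y \<in> X \<Longrightarrow> x \<inter> y \<in> sdspan X"
    and "a \<in> sdspan X" "b \<in> sdspan X"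
  shows "a \<inter> b \<in> sdspan X"
  using assms(2)
proof (induction rule: sdspan_induct)
  case (add x a)
  have "x \<inter> b \<in> sdspan X"
    using assms(3)
  proof (induction rule: sdspan_induct)
    case (add y b)
    have "x \<inter> sym_diff y b = sym_diff (x \<inter> y) (x \<inter> b)" by blast
    then show ?case
      using sdspan_add[OF assms(1)[OF \<open>x \<in> X\<close> add(1)] add(3)] by simp
  qed simp
  moreover have "sym_diff x a \<inter> b = sym_diff (x \<inter> b) (a \<inter> b)" by blast
  ultimately show ?case
    using sdspan_add add by metis
qed simp


section \<open>Cuts, balls and bonds\<close>

locale graph =
  fixes \<Gamma> :: "'v ugraph"
  assumes simple: "simple_graph \<Gamma>"
    and connected: "connected_graph \<Gamma>"
    and loc_fin: "locally_finite_graph \<Gamma>"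
begin

abbreviation "V \<equiv> verts \<Gamma>"
abbreviation "E \<equiv> edges \<Gamma>"
abbreviation "D \<equiv> coboundary \<Gamma>"
abbreviation "Cuts \<equiv> cuts \<Gamma>"
abbreviation "\<Lambda> \<equiv> limit_ends \<Gamma>"

section \<open>The coboundary map over the field with two elements\<close>

lemma edge_obtain:
  assumes "e \<in> E"
  obtains u v where "e = {u, v}" "u \<in> V" "v \<in> V" "u \<noteq> v"
  using assms simple unfolding simple_graph_def by (metis card_2_iff insert_subset)

lemma edge_verts: "{u, v} \<in> E \<Longrightarrow> u \<in> V \<and> v \<in> V \<and> u \<noteq> v"
  using simple unfolding simple_graph_def by fastforce

lemma D_iff: "{u, v} \<in> E \<Longrightarrow> {u, v} \<in> D b \<longleftrightarrow> (u \<in> b) \<noteq> (v \<in> b)"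
  using edge_verts[of u v] unfolding coboundary_def by (auto simp: doubleton_eq_iff)

lemma D_subset: "D b \<subseteq> E"
  unfolding coboundary_def by auto

lemma D_obtain:
  assumes "e \<in> D b"
  obtains u v where "e = {u, v}" "{u, v} \<in> E" "u \<in> b" "v \<notin> b" "v \<in> V" "u \<in> V"
  using assms edge_verts unfolding coboundary_def by blast

lemma D_eqI:
  assumes "\<And>u v. {u, v} \<in> E \<Longrightarrow> ((u \<in> b) \<noteq> (v \<in> b)) = ({u, v} \<in> X)" "X \<subseteq> E"
  shows "D b = X"
proof -
  have "e \<in> D b \<longleftrightarrow> e \<in> X" if "e \<in> E" for e
  proof -
    obtain u v where "e = {u, v}"
      using \<open>e \<in> E\<close> edge_obtain by blast
    then show ?thesis
      using assms(1)[of u v] D_iff[of u v b] that by simp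
  qed
  then show ?thesis
    using assms(2) D_subset[of b] by blast
qed

lemma D_subsetI:
  "(\<And>u v. {u, v} \<in> E \<Longrightarrow> (u \<in> b) \<noteq> (v \<in> b) \<Longrightarrow> {u, v} \<in> X) \<Longrightarrow> D b \<subseteq> X"
  by (metis D_iff D_obtain subsetI)

lemma D_sym_diff: "D (sym_diff b c) = sym_diff (D b) (D c)"
proof (rule D_eqI)
  show "sym_diff (D b) (D c) \<subseteq> E"
    using D_subset by blast
qed (use D_iff in auto)

lemma D_compl [simp]: "D (V - b) = D b"
  by (rule D_eqI) (use D_iff D_subset edge_verts in auto)

lemma D_V [simp]: "D V = {}"
  by (rule D_eqI) (use edge_verts in auto)

lemma D_empty [simp]: "D {} = {}"
  by (rule D_eqI) auto

lemma D_Int: "D (b \<inter> c) \<subseteq> D b \<union> D c"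
  by (rule D_subsetI) (auto simp: D_iff)

lemma D_Un: "D (b \<union> c) \<subseteq> D b \<union> D c"
  by (rule D_subsetI) (auto simp: D_iff)

lemma D_Diff: "D (b - c) \<subseteq> D b \<union> D c"
  by (rule D_subsetI) (auto simp: D_iff)

lemma cuts_iff: "b \<in> Cuts \<longleftrightarrow> b \<subseteq> V \<and> finite (D b)"
  by (simp add: cuts_def)

lemma cut_subset: "b \<in> Cuts \<Longrightarrow> b \<subseteq> V"
  by (simp add: cuts_def)

lemma cut_empty [simp]: "{} \<in> Cuts" and cut_V [simp]: "V \<in> Cuts"
  by (simp_all add: cuts_iff)

lemma cut_compl: "b \<in> Cuts \<Longrightarrow> V - b \<in> Cuts"
  by (auto simp: cuts_iff)

lemma cut_sym_diff: "b \<in> Cuts \<Longrightarrow> c \<in> Cuts \<Longrightarrow> sym_diff b c \<in> Cuts"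
  unfolding cuts_iff D_sym_diff by auto

lemma cut_Int: "b \<in> Cuts \<Longrightarrow> c \<in> Cuts \<Longrightarrow> b \<inter> c \<in> Cuts"
  unfolding cuts_iff using D_Int[of b c] by (auto intro: finite_subset)

lemma cut_Un: "b \<in> Cuts \<Longrightarrow> c \<in> Cuts \<Longrightarrow> b \<union> c \<in> Cuts"
  unfolding cuts_iff using D_Un[of b c] by (auto intro: finite_subset)

lemma cut_msum: "(\<And>p. p \<in># M \<Longrightarrow> p \<in> Cuts) \<Longrightarrow> msum M \<in> Cuts"
  by (induction M) (auto simp del: Un_iff intro!: cut_sym_diff)

text \<open>An edge crossing both \<open>b \<inter> c\<close> and \<open>b \<union> c\<close> joins
  the intersection to the outside of the union, so it crosses \<open>b\<close> and \<open>c\<close>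
  and is counted twice on the right as well.\<close>

lemma D_submodular:
  assumes "finite (D b)" "finite (D c)"
  shows "card (D (b \<inter> c)) + card (D (b \<union> c)) \<le> card (D b) + card (D c)"
proof -
  have u: "D (b \<inter> c) \<union> D (b \<union> c) \<subseteq> D b \<union> D c"
    using D_Int D_Un by blast
  have i: "D (b \<inter> c) \<inter> D (b \<union> c) \<subseteq> D b \<inter> D c"
  proof
    fix e assume "e \<in> D (b \<inter> c) \<inter> D (b \<union> c)"
    then obtain u v where "e = {u, v}" "{u, v} \<in> E" "{u, v} \<in> D (b \<inter> c)" "{u, v} \<in> D (b \<union> c)"
      by (metis D_obtain IntD1 IntD2)
    then show "e \<in> D b \<inter> D c"
      by (simp add: D_iff) blast
  qed
  have fin: "finite (D (b \<inter> c))" "finite (D (b \<union> c))"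
    using u assms by (meson finite_Un finite_subset)+
  have "card (D (b \<inter> c)) + card (D (b \<union> c))
      = card (D (b \<inter> c) \<union> D (b \<union> c)) + card (D (b \<inter> c) \<inter> D (b \<union> c))"
    using fin by (rule card_Un_Int)
  also have "\<dots> \<le> card (D b \<union> D c) + card (D b \<inter> D c)"
    using u i assms by (intro add_mono card_mono) auto
  also have "\<dots> = card (D b) + card (D c)"
    using assms by (rule card_Un_Int[symmetric])
  finally show ?thesis .
qed

text \<open>Connectedness of the graph says that the kernel of the coboundary map consists of the
  two constant cochains. Hence a coboundary determines its cut up to complement.\<close>

lemma D_empty_cases:
  assumes "D b = {}" "b \<subseteq> V"
  shows "b = {} \<or> b = V"
proof (rule ccontr)
  assume "\<not> ?thesis"
  then obtain u v where uv: "u \<in> b" "v \<in> V" "v \<notin> b"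
    using assms(2) by blast
  then have "u \<in> V"
    using assms(2) by blast
  with uv have "(u, v) \<in> (adjacency \<Gamma>)\<^sup>*"
    using connected unfolding connected_graph_def by blast
  then have "v \<in> b"
  proof induction
    case (step x y)
    then have "{x, y} \<in> E" by (simp add: adjacency_def)
    with step(3) D_iff[of x y b] assms(1) show ?case by blast
  qed (use uv in auto)
  with uv show False by simp
qed

lemma D_eq_cases:
  assumes "D b = D c" "b \<subseteq> V" "c \<subseteq> V"
  shows "b = c \<or> b = V - c"
proof -
  have "D (sym_diff b c) = {}"
    using assms unfolding D_sym_diff by simp
  then have "sym_diff b c = {} \<or> sym_diff b c = V"
    using assms by (intro D_empty_cases) auto
  then show ?thesis
    using assms(2,3) by blast
qed

lemma finite_cuts_with_coboundary: "finite {b. b \<subseteq> V \<and> D b = F}"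
proof (cases "{b. b \<subseteq> V \<and> D b = F} = {}")
  case False
  then obtain c where "c \<subseteq> V" "D c = F" by blast
  then have "{b. b \<subseteq> V \<and> D b = F} \<subseteq> {c, V - c}"
    using D_eq_cases by blast
  then show ?thesis
    by (rule finite_subset) simp
qed (metis finite.emptyI)

lemma finite_cuts_coboundary_in:
  assumes "finite F"
  shows "finite {b. b \<subseteq> V \<and> D b \<subseteq> F}"
proof -
  have "{b. b \<subseteq> V \<and> D b \<subseteq> F} = (\<Union>X \<in> Pow F. {b. b \<subseteq> V \<and> D b = X})"
    by blast
  then show ?thesis
    using assms finite_cuts_with_coboundary by simp
qed


section \<open>Balls\<close>

primrec ball :: "nat \<Rightarrow> 'v \<Rightarrow> 'v set" where
  "ball 0 v = {v}"
| "ball (Suc r) v = ball r v \<union> {u. \<exists>w \<in> ball r v. {w, u} \<in> E}"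

lemma finite_nbrs: "finite {u. {w, u} \<in> E}"
proof (cases "w \<in> V")
  case True
  then have "finite {e \<in> E. w \<in> e}"
    using loc_fin unfolding locally_finite_graph_def by auto
  moreover have "(\<lambda>u. {w, u}) ` {u. {w, u} \<in> E} \<subseteq> {e \<in> E. w \<in> e}"
    by auto
  ultimately have "finite ((\<lambda>u. {w, u}) ` {u. {w, u} \<in> E})"
    using finite_subset by blast
  then show ?thesis
    by (rule finite_imageD) (auto simp: inj_on_def doubleton_eq_iff)
next
  case False
  then have "{u. {w, u} \<in> E} = {}"
    using edge_verts by blast
  then show ?thesis
    by simp
qed

lemma finite_ball: "finite (ball r v)"
proof (induction r)
  case (Suc r)
  have "{u. \<exists>w \<in> ball r v. {w, u} \<in> E} = (\<Union>w \<in> ball r v. {u. {w, u} \<in> E})"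
    by auto
  with Suc show ?case
    using finite_nbrs by simp
qed simp

lemma ball_subset_V: "v \<in> V \<Longrightarrow> ball r v \<subseteq> V"
  by (induction r) (auto dest: edge_verts)

lemma ball_center: "v \<in> ball r v"
  by (induction r) auto

lemma ball_mono: "r \<le> s \<Longrightarrow> ball r v \<subseteq> ball s v"
  by (rule lift_Suc_mono_le[of "\<lambda>r. ball r v"]) auto

lemma ball_trans: "u \<in> ball r v \<Longrightarrow> ball s u \<subseteq> ball (r + s) v"
  by (induction s) auto

lemma ball_sym: "u \<in> ball r v \<Longrightarrow> v \<in> ball r u"
proof (induction r arbitrary: u)
  case (Suc r)
  show ?case
  proof (cases "u \<in> ball r v")
    case True
    then show ?thesis
      using Suc.IH by auto
  next
    case False
    then obtain w where w: "w \<in> ball r v" "{w, u} \<in> E"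
      using Suc.prems by auto
    then have "w \<in> ball 1 u"
      by (auto simp: insert_commute)
    from subsetD[OF ball_trans[OF this, of r] Suc.IH[OF w(1)]] show ?thesis
      by simp
  qed
qed auto

lemma ball_trans': "u \<in> ball r v \<Longrightarrow> w \<in> ball s u \<Longrightarrow> r + s \<le> t \<Longrightarrow> w \<in> ball t v"
  using ball_trans[of u r v s] ball_mono[of "r + s" t v] by (meson subsetD)

lemma vertex_in_ball: "u \<in> V \<Longrightarrow> v \<in> V \<Longrightarrow> \<exists>r. u \<in> ball r v"
proof -
  assume "u \<in> V" "v \<in> V"
  then have "(v, u) \<in> (adjacency \<Gamma>)\<^sup>*"
    using connected unfolding connected_graph_def by blast
  then show ?thesis
  proof induction
    case base
    show ?case by (auto intro: ball_center)
  next
    case (step x y)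
    then obtain r where "x \<in> ball r v" by auto
    then have "y \<in> ball (Suc r) v"
      using step(2) by (auto simp: adjacency_def)
    then show ?case by blast
  qed
qed

lemma finite_in_ball:
  assumes "finite S" "S \<subseteq> V" "v \<in> V"
  shows "\<exists>r. S \<subseteq> ball r v"
  using assms
proof (induction S)
  case (insert x S)
  then obtain r s where "S \<subseteq> ball r v" "x \<in> ball s v"
    using vertex_in_ball by (metis insert_subset)
  then have "insert x S \<subseteq> ball (max r s) v"
    using ball_mono[of r "max r s" v] ball_mono[of s "max r s" v] by auto
  then show ?case by blast
qed auto

lemma finite_edges_in: "finite K \<Longrightarrow> finite {e \<in> E. e \<subseteq> K}"
  by (rule finite_subset[of _ "Pow K"]) auto

text \<open>The connected finite sets, in the form in which connectedness is used: a set of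
  vertices whose coboundary has no edge inside is constant there.\<close>

definition blob :: "'v set \<Rightarrow> bool" where
  "blob K \<longleftrightarrow> finite K \<and> K \<subseteq> V \<and> K \<noteq> {} \<and>
     (\<forall>c. (\<forall>e \<in> D c. \<not> e \<subseteq> K) \<longrightarrow> K \<subseteq> c \<or> K \<inter> c = {})"

lemma blob_ball:
  assumes "v \<in> V"
  shows "blob (ball r v)"
  unfolding blob_def
proof (intro conjI allI impI)
  fix c assume "\<forall>e \<in> D c. \<not> e \<subseteq> ball r v"
  then show "ball r v \<subseteq> c \<or> ball r v \<inter> c = {}"
  proof (induction r)
    case (Suc r)
    have "\<forall>e \<in> D c. \<not> e \<subseteq> ball r v"
      using Suc.prems by auto
    moreover have "u \<in> c \<longleftrightarrow> w \<in> c" if "w \<in> ball r v" "{w, u} \<in> E" for u w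
    proof -
      have "{w, u} \<subseteq> ball (Suc r) v"
        using that by auto
      then show ?thesis
        using Suc.prems D_iff[OF that(2)] by blast
    qed
    moreover from calculation(1) have "ball r v \<subseteq> c \<or> ball r v \<inter> c = {}"
      by (rule Suc.IH)
    ultimately show ?case
      by auto
  qed auto
next
  show "ball r v \<noteq> {}"
    using ball_center by blast
qed (use assms finite_ball ball_subset_V in auto)

lemma blob_const: "blob K \<Longrightarrow> (\<And>e. e \<in> D c \<Longrightarrow> \<not> e \<subseteq> K) \<Longrightarrow> K \<subseteq> c \<or> K \<inter> c = {}"
  unfolding blob_def by blast

lemma D_edge_nonempty: "e \<in> D c \<Longrightarrow> e \<noteq> {}"
  unfolding coboundary_def by auto

lemma blob_const_disjoint:
  assumes "blob K" "\<Union>(D c) \<inter> K = {}"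
  shows "K \<subseteq> c \<or> K \<inter> c = {}"
  using assms D_edge_nonempty by (intro blob_const) blast+

lemma blob_const_disjoint':
  assumes "blob K" "\<Union>(D c) \<subseteq> L" "K \<inter> L = {}"
  shows "K \<subseteq> c \<or> K \<inter> c = {}"
  using assms by (intro blob_const_disjoint) auto

text \<open>An edge leaving \<open>X \<inter> c\<close> either stays in \<open>X\<close>, and is
  then an edge of \<open>D c\<close> inside \<open>X\<close>, or leaves \<open>X\<close>, and then
  its endpoint in \<open>c\<close> lies in \<open>K\<close>. So there is none. This serves for
  regions \<open>X\<close> that may be disconnected.\<close>

lemma const_on:
  assumes "X \<subseteq> V" "\<Union>(D X) \<subseteq> K" "K \<inter> c = {}" "\<And>e. e \<in> D c \<Longrightarrow> \<not> e \<subseteq> X"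
  shows "X \<inter> c = {} \<or> X \<inter> c = V"
proof -
  have "D (X \<inter> c) = {}"
  proof (rule ccontr)
    assume "D (X \<inter> c) \<noteq> {}"
    then obtain u v where e: "{u, v} \<in> E" "u \<in> X" "u \<in> c" "v \<notin> X \<inter> c"
      by (blast elim: D_obtain)
    show False
    proof (cases "v \<in> X")
      case True
      then show False
        using assms(4)[of "{u, v}"] e D_iff[OF e(1), of c] by auto
    next
      case False
      then have "{u, v} \<in> D X"
        using D_iff[OF e(1)] e by auto
      then show False
        using assms(2,3) e by auto
    qed
  qed
  then show ?thesis
    using D_empty_cases assms(1) by blast
qed

lemma const_on':
  assumes "X \<subseteq> V" "\<Union>(D X) \<subseteq> K" "K \<inter> c = {}" "\<And>e. e \<in> D c \<Longrightarrow> \<not> e \<subseteq> X"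
    "K \<inter> V \<noteq> {}"
  shows "X \<inter> c = {}"
proof -
  have "X \<inter> c \<noteq> V"
    using assms(3,5) by auto
  then show ?thesis
    using const_on[OF assms(1-4)] by auto
qed


section \<open>Bonds: minimal nonempty coboundaries\<close>

definition bond :: "'v set \<Rightarrow> bool" where
  "bond b \<longleftrightarrow> b \<in> Cuts \<and> D b \<noteq> {} \<and>
     (\<forall>c \<subseteq> V. D c \<subseteq> D b \<longrightarrow> D c \<noteq> {} \<longrightarrow> D c = D b)"

lemma contains_bond:
  assumes "b \<in> Cuts" "D b \<noteq> {}"
  shows "\<exists>c. bond c \<and> D c \<subseteq> D b"
proof -
  define \<C> where "\<C> = {c. c \<subseteq> V \<and> D c \<subseteq> D b \<and> D c \<noteq> {}}"
  have "b \<in> \<C>"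
    using assms by (auto simp: \<C>_def cuts_iff)
  then obtain c where c: "c \<in> \<C>" "\<And>d. d \<in> \<C> \<Longrightarrow> card (D c) \<le> card (D d)"
    using arg_min_nat_lemma[of "\<lambda>c. c \<in> \<C>" b "\<lambda>c. card (D c)"] by blast
  have fin: "finite (D c)"
    using c(1) assms(1) finite_subset by (auto simp: \<C>_def cuts_iff)
  have "D d = D c" if "d \<subseteq> V" "D d \<subseteq> D c" "D d \<noteq> {}" for d
  proof -
    have "d \<in> \<C>" using that c(1) by (auto simp: \<C>_def)
    then show ?thesis
      using c(2) card_seteq[OF fin that(2)] by simp
  qed
  then have "bond c"
    using c(1) fin unfolding bond_def by (auto simp: \<C>_def cuts_iff)
  then show ?thesis
    using c(1) by (auto simp: \<C>_def)
qed

text \<open>Peeling off a bond removes its edges from the coboundary, so there are at most as many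
  bonds as edges. The extra summand is \<open>V\<close>, as the coboundary fixes the sum only up to
  complement.\<close>

lemma bond_decomposition:
  assumes "b \<in> Cuts"
  shows "\<exists>M. size M \<le> card (D b) + 1 \<and> msum M = b \<and>
    (\<forall>p \<in># M. p = V \<or> bond p \<and> D p \<subseteq> D b)"
  using assms
proof (induction "card (D b)" arbitrary: b rule: less_induct)
  case less
  have fin: "finite (D b)"
    using less.prems by (simp add: cuts_iff)
  show ?case
  proof (cases "D b = {}")
    case True
    then have "b = {} \<or> b = V"
      using D_empty_cases less.prems cut_subset by blast
    then show ?thesis
    proof
      assume "b = {}"
      then show ?thesis by (auto intro!: exI[of _ "{#}"])
    next
      assume "b = V"
      then show ?thesis by (auto intro!: exI[of _ "{#V#}"])
    qed
  next
    case False
    then obtain c where c: "bond c" "D c \<subseteq> D b"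
      using contains_bond less.prems by blast
    define d where "d = sym_diff c b"
    have Dd: "D d = D b - D c"
      using c(2) unfolding d_def D_sym_diff by auto
    have "D c \<noteq> {}"
      using c(1) by (simp add: bond_def)
    then have lt: "card (D d) < card (D b)"
      unfolding Dd using c(2) fin by (intro psubset_card_mono) auto
    have "d \<in> Cuts"
      using c less.prems unfolding d_def bond_def by (intro cut_sym_diff) auto
    then obtain M where M: "size M \<le> card (D d) + 1" "msum M = d"
      "\<forall>p \<in># M. p = V \<or> bond p \<and> D p \<subseteq> D d"
      using less.hyps[OF lt] by blast
    have "msum (add_mset c M) = b"
      using M(2) unfolding d_def by auto
    moreover have "\<forall>p \<in># add_mset c M. p = V \<or> bond p \<and> D p \<subseteq> D b"
      using M(3) c Dd by auto
    ultimately show ?thesis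
      using M(1) lt by (intro exI[of _ "add_mset c M"]) auto
  qed
qed

text \<open>The relation is adjacency in the double cover of the graph defined by \<open>F\<close>;
  the second coordinate is the parity of the crossings of \<open>F\<close>. For a cut agreeing with
  \<open>F\<close> on the edges \<open>W\<close> of the walk, this parity tells whether the ends lie
  on different sides.\<close>

lemma parity_walk:
  assumes "((v, x), (w, y)) \<in> {((v, x), (w, y)). {v, w} \<in> E \<and> (y = (x \<noteq> ({v, w} \<in> F)))}\<^sup>*"
  shows "\<exists>W. finite W \<and> W \<subseteq> E \<and> (\<forall>b. D b \<inter> W = F \<inter> W \<longrightarrow> ((v \<in> b) \<noteq> (w \<in> b)) = (x \<noteq> y))"
  using assms
proof (induction "(w, y)" arbitrary: w y rule: rtrancl_induct)
  case base
  show ?case by (auto intro!: exI[of _ "{}"])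
next
  case (step z w y)
  obtain u c where z: "z = (u, c)" by fastforce
  obtain W where W: "finite W" "W \<subseteq> E"
    "\<forall>b. D b \<inter> W = F \<inter> W \<longrightarrow> ((v \<in> b) \<noteq> (u \<in> b)) = (x \<noteq> c)"
    using step.hyps(3)[OF z] by (elim exE conjE) (rule that)
  have e: "{u, w} \<in> E" "y = (c \<noteq> ({u, w} \<in> F))"
    using step.hyps(2) z by auto
  have "((v \<in> b) \<noteq> (w \<in> b)) = (x \<noteq> y)" if b: "D b \<inter> insert {u, w} W = F \<inter> insert {u, w} W" for b
  proof -
    have "D b \<inter> W = F \<inter> W" "({u, w} \<in> D b) = ({u, w} \<in> F)"
      using b by blast+
    then show ?thesis
      using W(3) D_iff[OF e(1), of b] e(2) by blast
  qed
  then show ?case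
    using W e(1) by (intro exI[of _ "insert {u, w} W"]) auto
qed

text \<open>An edge set \<open>F\<close> is a coboundary unless some closed walk crosses it an odd number of
  times; every cut whose coboundary contains \<open>F\<close> has a further edge on such a walk.\<close>

lemma odd_walk:
  assumes "F \<subseteq> E" "\<not> (\<exists>c \<subseteq> V. D c = F)"
  shows "\<exists>W. finite W \<and> W \<subseteq> E \<and> (\<forall>b. D b \<inter> W \<noteq> F \<inter> W)"
proof -
  define R where "R = {((v, x), (w, y)). {v, w} \<in> E \<and> (y = (x \<noteq> ({v, w} \<in> F)))}"
  have "F \<noteq> {}"
    using assms(2) D_empty by blast
  then obtain v0 where v0: "v0 \<in> V"
    using assms(1) edge_obtain by blast
  \<comment> \<open>If \<open>F\<close> were a coboundary, the vertices reached from
    \<open>v0\<close> with odd parity would form one of its two cuts; so this candidate must fail at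
    some edge.\<close>
  define c where "c = {v \<in> V. ((v0, False), (v, True)) \<in> R\<^sup>*}"
  have "\<exists>u w. {u, w} \<in> E \<and> ((u \<in> c) \<noteq> (w \<in> c)) \<noteq> ({u, w} \<in> F)"
  proof (rule ccontr)
    assume "\<not> ?thesis"
    then have "D c = F"
      by (intro D_eqI assms(1)) simp
    then show False
      using assms(2) by (auto simp: c_def)
  qed
  then obtain u w where uw: "{u, w} \<in> E" "((u \<in> c) \<noteq> (w \<in> c)) \<noteq> ({u, w} \<in> F)"
    by (elim exE conjE) (rule that)
  have lift: "\<exists>y. ((v0, False), (v, y)) \<in> R\<^sup>*" if "v \<in> V" for v
  proof -
    have "(v0, v) \<in> (adjacency \<Gamma>)\<^sup>*"
      using connected that v0 unfolding connected_graph_def by blast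
    then show ?thesis
    proof induction
      case (step y z)
      then obtain b where "((v0, False), (y, b)) \<in> R\<^sup>*" by blast
      moreover have "((y, b), (z, b \<noteq> ({y, z} \<in> F))) \<in> R"
        using step(2) by (auto simp: R_def adjacency_def)
      ultimately show ?case
        by (meson rtrancl.rtrancl_into_rtrancl)
    qed (auto intro: exI[of _ False])
  qed
  \<comment> \<open>Otherwise every vertex is reached with one parity only, membership in
    \<open>c\<close> is that parity, and the edge from \<open>u\<close> to \<open>w\<close> could
    not be a failure.\<close>
  have both: "\<exists>v. \<forall>y. ((v0, False), (v, y)) \<in> R\<^sup>*"
  proof -
    have uV: "u \<in> V" "w \<in> V"
      using edge_verts uw(1) by auto
    obtain y where y: "((v0, False), (u, y)) \<in> R\<^sup>*"
      using lift uV by blast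
    obtain z where z: "((v0, False), (w, z)) \<in> R\<^sup>*"
      using lift uV by blast
    have "((u, y), (w, y \<noteq> ({u, w} \<in> F))) \<in> R"
      using uw(1) by (auto simp: R_def)
    then have y': "((v0, False), (w, y \<noteq> ({u, w} \<in> F))) \<in> R\<^sup>*"
      using y by (meson rtrancl.rtrancl_into_rtrancl)
    show ?thesis
    proof (rule ccontr)
      assume neg: "\<nexists>v. \<forall>y. ((v0, False), (v, y)) \<in> R\<^sup>*"
      have c_iff: "x \<in> c \<longleftrightarrow> a" if "((v0, False), (x, a)) \<in> R\<^sup>*" "x \<in> V" for x a
      proof -
        obtain b where "((v0, False), (x, b)) \<notin> R\<^sup>*"
          using neg by blast
        then have "((v0, False), (x, True)) \<in> R\<^sup>* \<longleftrightarrow> a"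
          using that(1) by (cases a; cases b) auto
        then show ?thesis
          using that(2) by (simp add: c_def)
      qed
      show False
        using c_iff[OF y uV(1)] c_iff[OF y' uV(2)] uw(2) by (cases y) auto
    qed
  qed
  then obtain v where v: "\<And>y. ((v0, False), (v, y)) \<in> R\<^sup>*" by blast
  obtain W1 where W1: "finite W1" "W1 \<subseteq> E"
    "\<forall>b. D b \<inter> W1 = F \<inter> W1 \<longrightarrow> ((v0 \<in> b) \<noteq> (v \<in> b)) = (False \<noteq> True)"
    using parity_walk[OF v[of True, unfolded R_def]] by (elim exE conjE) (rule that)
  obtain W2 where W2: "finite W2" "W2 \<subseteq> E"
    "\<forall>b. D b \<inter> W2 = F \<inter> W2 \<longrightarrow> ((v0 \<in> b) \<noteq> (v \<in> b)) = (False \<noteq> False)"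
    using parity_walk[OF v[of False, unfolded R_def]] by (elim exE conjE) (rule that)
  have "D b \<inter> (W1 \<union> W2) \<noteq> F \<inter> (W1 \<union> W2)" for b
  proof
    assume "D b \<inter> (W1 \<union> W2) = F \<inter> (W1 \<union> W2)"
    then have "D b \<inter> W1 = F \<inter> W1" "D b \<inter> W2 = F \<inter> W2" by blast+
    then show False
      using W1(3)[rule_format, of b] W2(3)[rule_format, of b] by simp
  qed
  then show ?thesis
    using W1 W2 by (intro exI[of _ "W1 \<union> W2"]) auto
qed

text \<open>Induction on the number \<open>j\<close> of edges still missing. If \<open>F\<close> is
  a coboundary, minimality of the bond gives \<open>D b = F\<close>. If not, \<open>odd_walk\<close>
  supplies a finite set of edges one of which lies in \<open>D b\<close> outside \<open>F\<close>,
  and adding it to \<open>F\<close> lowers \<open>j\<close>.\<close>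

lemma finite_bonds_containing:
  assumes "finite F" "F \<noteq> {}"
  shows "finite {b. bond b \<and> F \<subseteq> D b \<and> card (D b) \<le> card F + j}"
  using assms
proof (induction j arbitrary: F)
  case 0
  have "{b. bond b \<and> F \<subseteq> D b \<and> card (D b) \<le> card F + 0} \<subseteq> {b. b \<subseteq> V \<and> D b = F}"
  proof
    fix b assume b: "b \<in> {b. bond b \<and> F \<subseteq> D b \<and> card (D b) \<le> card F + 0}"
    then have "b \<subseteq> V" "finite (D b)"
      by (auto simp: bond_def cuts_iff)
    with b show "b \<in> {b. b \<subseteq> V \<and> D b = F}"
      using card_seteq[of "D b" F] by simp
  qed
  then show ?case
    using finite_cuts_with_coboundary finite_subset by blast
next
  case (Suc j)
  let ?B = "{b. bond b \<and> F \<subseteq> D b \<and> card (D b) \<le> card F + Suc j}"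
  show ?case
  proof (cases "\<exists>c \<subseteq> V. D c = F")
    case True
    then obtain c where c: "c \<subseteq> V" "D c = F"
      by (elim exE conjE) (rule that)
    have "?B \<subseteq> {b. b \<subseteq> V \<and> D b = F}"
    proof
      fix b assume b: "b \<in> ?B"
      then have "D c = D b"
        using c Suc.prems(2) unfolding bond_def by blast
      then show "b \<in> {b. b \<subseteq> V \<and> D b = F}"
        using b c by (simp add: bond_def cuts_iff)
    qed
    then show ?thesis
      using finite_cuts_with_coboundary finite_subset by blast
  next
    case False
    show ?thesis
    proof (cases "F \<subseteq> E")
      case True
      then obtain W where W: "finite W" "\<And>b. D b \<inter> W \<noteq> F \<inter> W"
        using odd_walk[OF _ False] by auto
      have "?B \<subseteq> (\<Union>e \<in> W - F. {b. bond b \<and> insert e F \<subseteq> D b \<and> card (D b) \<le> card (insert e F) + j})"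
      proof
        fix b assume b: "b \<in> ?B"
        then obtain e where "e \<in> W - F" "e \<in> D b"
          using W(2)[of b] by blast
        then show "b \<in> (\<Union>e \<in> W - F. {b. bond b \<and> insert e F \<subseteq> D b \<and> card (D b) \<le> card (insert e F) + j})"
          using b Suc.prems(1) by auto
      qed
      moreover have "finite (\<Union>e \<in> W - F. {b. bond b \<and> insert e F \<subseteq> D b \<and> card (D b) \<le> card (insert e F) + j})"
      proof (rule finite_UN_I)
        fix e assume "e \<in> W - F"
        show "finite {b. bond b \<and> insert e F \<subseteq> D b \<and> card (D b) \<le> card (insert e F) + j}"
          by (rule Suc.IH) (use Suc.prems in auto)
      qed (use W(1) in simp)
      ultimately show ?thesis
        using finite_subset by blast
    next
      case False
      then have "?B = {}" using D_subset by blast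
      then show ?thesis by (simp only: finite.emptyI)
    qed
  qed
qed

lemma finite_bonds_through: "finite {b. bond b \<and> e \<in> D b \<and> card (D b) \<le> k}"
  by (rule finite_subset[OF _ finite_bonds_containing[of "{e}" k]]) auto

end

section \<open>The action on cuts\<close>

locale peripheral_graph = graph \<Gamma> + group G
  for \<Gamma> :: "'v ugraph" and G :: "('g, 'm) monoid_scheme" (structure) +
  fixes \<phi> :: "'g \<Rightarrow> 'v \<Rightarrow> 'v" and \<H> :: "'v set set"
  assumes G_graph: "G_graph G \<Gamma> \<phi>"
    and quasi_trans: "quasi_transitive G \<Gamma> \<phi>"
    and peripheral: "peripheral_system \<Gamma> \<H>"
    and thin: "thin \<Gamma> \<H>"
    and H_invariant: "G_invariant G \<phi> \<H>"
begin

sublocale action: group_action G V \<phi>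
  using G_graph by (simp add: G_graph_def)

abbreviation act :: "'g \<Rightarrow> 'v set \<Rightarrow> 'v set" where
  "act g b \<equiv> \<phi> g ` b"

abbreviation "Ell \<equiv> elliptic_cuts \<Gamma> \<H>"

lemma act_bij: "g \<in> carrier G \<Longrightarrow> bij_betw (\<phi> g) V V"
  using action.bij_prop0 by (simp add: Bij_def)

lemma act_inj: "g \<in> carrier G \<Longrightarrow> inj_on (\<phi> g) V"
  using act_bij[of g] by (simp add: bij_betw_def)

lemma act_V [simp]: "g \<in> carrier G \<Longrightarrow> act g V = V"
  using act_bij[of g] by (simp add: bij_betw_def)

lemma act_in_V: "g \<in> carrier G \<Longrightarrow> v \<in> V \<Longrightarrow> \<phi> g v \<in> V"
  using act_V[of g] by blast

lemma act_subset_V: "g \<in> carrier G \<Longrightarrow> b \<subseteq> V \<Longrightarrow> act g b \<subseteq> V"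
  using act_V[of g] by blast

lemma act_mem: "g \<in> carrier G \<Longrightarrow> v \<in> V \<Longrightarrow> b \<subseteq> V \<Longrightarrow> \<phi> g v \<in> act g b \<longleftrightarrow> v \<in> b"
  using act_inj by (rule inj_on_image_mem_iff)

lemma act_mult:
  assumes "g \<in> carrier G" "h \<in> carrier G" "b \<subseteq> V"
  shows "act (g \<otimes> h) b = act g (act h b)"
  using assms action.composition_rule by (auto simp: image_image subset_iff intro!: image_cong)

lemma act_one: "b \<subseteq> V \<Longrightarrow> act \<one> b = b"
  using action.id_eq_one by (metis image_cong image_ident restrict_apply' subset_eq)

lemma act_inv [simp]:
  assumes "g \<in> carrier G" "b \<subseteq> V"
  shows "act (inv g) (act g b) = b" "act g (act (inv g) b) = b"
  using assms act_mult[symmetric] act_one by simp_all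

lemma act_diff: "g \<in> carrier G \<Longrightarrow> b \<subseteq> V \<Longrightarrow> c \<subseteq> V \<Longrightarrow> act g (b - c) = act g b - act g c"
  using act_inj[of g] inj_on_image_set_diff[of "\<phi> g" V b c] by blast

lemma act_Int: "g \<in> carrier G \<Longrightarrow> b \<subseteq> V \<Longrightarrow> c \<subseteq> V \<Longrightarrow> act g (b \<inter> c) = act g b \<inter> act g c"
  using act_inj[of g] inj_on_image_Int[of "\<phi> g" V b c] by blast

lemma act_compl: "g \<in> carrier G \<Longrightarrow> b \<subseteq> V \<Longrightarrow> act g (V - b) = V - act g b"
  by (simp add: act_diff)

lemma act_sym_diff: "g \<in> carrier G \<Longrightarrow> b \<subseteq> V \<Longrightarrow> c \<subseteq> V \<Longrightarrow>
    act g (sym_diff b c) = sym_diff (act g b) (act g c)"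
  by (simp add: act_diff image_Un)

lemma act_subset_iff: "g \<in> carrier G \<Longrightarrow> b \<subseteq> V \<Longrightarrow> c \<subseteq> V \<Longrightarrow> act g b \<subseteq> act g c \<longleftrightarrow> b \<subseteq> c"
  using act_inv(1)[of g] by (metis image_mono)

lemma act_disjoint_iff:
  "g \<in> carrier G \<Longrightarrow> b \<subseteq> V \<Longrightarrow> c \<subseteq> V \<Longrightarrow> act g b \<inter> act g c = {} \<longleftrightarrow> b \<inter> c = {}"
  using act_Int[of g b c] by (metis image_is_empty)

lemma finite_act_iff: "g \<in> carrier G \<Longrightarrow> b \<subseteq> V \<Longrightarrow> finite (act g b) \<longleftrightarrow> finite b"
  using act_inj by (meson finite_image_iff inj_on_subset)

lemma act_edge_iff:
  "g \<in> carrier G \<Longrightarrow> u \<in> V \<Longrightarrow> v \<in> V \<Longrightarrow> {\<phi> g u, \<phi> g v} \<in> E \<longleftrightarrow> {u, v} \<in> E"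
  using G_graph unfolding G_graph_def by blast


lemma edge_subset_V: "e \<in> E \<Longrightarrow> e \<subseteq> V"
  using simple unfolding simple_graph_def by blast

lemma D_act_subset:
  assumes g: "g \<in> carrier G" and b: "b \<subseteq> V"
  shows "act g ` D b \<subseteq> D (act g b)"
proof
  fix f assume "f \<in> act g ` D b"
  then obtain e where e: "e \<in> D b" "f = act g e" by blast
  from e(1) obtain u v where uv: "e = {u, v}" "{u, v} \<in> E" "u \<in> b" "v \<notin> b" "v \<in> V" "u \<in> V"
    by (rule D_obtain)
  have "{\<phi> g u, \<phi> g v} \<in> E"
    using uv g by (simp add: act_edge_iff)
  then show "f \<in> D (act g b)"
    using uv e(2) g b by (simp add: D_iff act_mem)
qed

lemma D_act:
  assumes "g \<in> carrier G" "b \<subseteq> V"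
  shows "D (act g b) = act g ` D b"
proof
  show "act g ` D b \<subseteq> D (act g b)"
    by (rule D_act_subset[OF assms])
  show "D (act g b) \<subseteq> act g ` D b"
  proof
    fix e assume e: "e \<in> D (act g b)"
    then have eV: "e \<subseteq> V"
      using D_subset edge_subset_V by blast
    have "act (inv g) e \<in> D (act (inv g) (act g b))"
      using D_act_subset[of "inv g" "act g b"] assms e act_subset_V by blast
    then have "act (inv g) e \<in> D b"
      using assms by simp
    moreover have "e = act g (act (inv g) e)"
      using assms eV by simp
    ultimately show "e \<in> act g ` D b" by blast
  qed
qed

lemma inj_on_act_edges: "g \<in> carrier G \<Longrightarrow> inj_on (act g) (D b)"
  using D_subset edge_subset_V by (intro inj_onI) (metis act_inv(1) subsetD)

lemma card_D_act: "g \<in> carrier G \<Longrightarrow> b \<subseteq> V \<Longrightarrow> card (D (act g b)) = card (D b)"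
  by (simp add: D_act card_image inj_on_act_edges)

lemma Union_D_subset: "\<Union>(D b) \<subseteq> V"
  using D_subset edge_subset_V by blast

lemma Union_D_act: "g \<in> carrier G \<Longrightarrow> b \<subseteq> V \<Longrightarrow> \<Union>(D (act g b)) = act g (\<Union>(D b))"
  by (auto simp: D_act)

lemma cut_act: "g \<in> carrier G \<Longrightarrow> b \<in> Cuts \<Longrightarrow> act g b \<in> Cuts"
  by (simp add: cuts_iff act_subset_V D_act)

lemma act_ball:
  assumes g: "g \<in> carrier G" and v: "v \<in> V"
  shows "act g (ball r v) = ball r (\<phi> g v)"
proof (induction r)
  case (Suc r)
  have "act g {u. \<exists>w \<in> ball r v. {w, u} \<in> E} = {u. \<exists>w \<in> act g (ball r v). {w, u} \<in> E}"
  proof (intro equalityI subsetI)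
    fix x assume "x \<in> act g {u. \<exists>w \<in> ball r v. {w, u} \<in> E}"
    then obtain u w where "x = \<phi> g u" "w \<in> ball r v" "{w, u} \<in> E" by blast
    then show "x \<in> {u. \<exists>w \<in> act g (ball r v). {w, u} \<in> E}"
      using act_edge_iff[OF g, of w u] edge_verts[of w u] by blast
  next
    fix x assume "x \<in> {u. \<exists>w \<in> act g (ball r v). {w, u} \<in> E}"
    then obtain w where w: "w \<in> ball r v" "{\<phi> g w, x} \<in> E" by blast
    then have "x \<in> V" "w \<in> V"
      using edge_verts ball_subset_V[OF v] by auto
    then obtain u where "u \<in> V" "x = \<phi> g u"
      using act_V[OF g] by blast
    then show "x \<in> act g {u. \<exists>w \<in> ball r v. {w, u} \<in> E}"
      using act_edge_iff[OF g \<open>w \<in> V\<close> \<open>u \<in> V\<close>] w by blast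
  qed
  with Suc show ?case
    by (simp add: image_Un)
qed simp

lemma blob_act:
  assumes g: "g \<in> carrier G" and K: "blob K"
  shows "blob (act g K)"
proof -
  have KV: "K \<subseteq> V" "finite K" "K \<noteq> {}"
    using K by (auto simp: blob_def)
  have "act g K \<subseteq> c \<or> act g K \<inter> c = {}" if c: "\<forall>e \<in> D c. \<not> e \<subseteq> act g K" for c
  proof -
    \<comment> \<open>A set tested by \<open>blob\<close> need not lie in \<open>V\<close>, where
      alone the action is known to be invertible; intersecting with \<open>V\<close> leaves the
      coboundary unchanged.\<close>
    define d where "d = act (inv g) (c \<inter> V)"
    have dV: "d \<subseteq> V" and cd: "act g d = c \<inter> V"
      using g by (auto simp: d_def act_in_V)
    have Dc: "D (c \<inter> V) = D c"
      by (rule D_eqI) (use edge_verts D_iff D_subset in auto)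
    have "\<not> e \<subseteq> K" if "e \<in> D d" for e
      using that c D_act[OF g dV] cd Dc by (metis image_eqI image_mono)
    then have "K \<subseteq> d \<or> K \<inter> d = {}"
      using K by (intro blob_const)
    then have "act g K \<subseteq> c \<inter> V \<or> act g K \<inter> (c \<inter> V) = {}"
      using act_subset_iff[OF g KV(1) dV] act_disjoint_iff[OF g KV(1) dV] cd by simp
    then show ?thesis
      using act_subset_V[OF g KV(1)] by blast
  qed
  then show ?thesis
    using KV act_subset_V[OF g] unfolding blob_def by auto
qed

lemma orbit_reps: "\<exists>F. finite F \<and> F \<subseteq> V \<and> (\<forall>v \<in> V. \<exists>g \<in> carrier G. \<exists>u \<in> F. v = \<phi> g u)"
proof -
  let ?Q = "orbits G V \<phi>"
  define F where "F = (\<lambda>Q. SOME u. u \<in> Q) ` ?Q"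
  have rep: "(SOME u. u \<in> Q) \<in> Q" if Q: "Q \<in> ?Q" for Q
  proof -
    obtain v where "v \<in> V" "Q = orbit G \<phi> v"
      using Q by (auto simp: orbits_def)
    then have "v \<in> Q"
      using action.orbit_refl by blast
    then show ?thesis by (rule someI)
  qed
  have orbV: "orbit G \<phi> v \<subseteq> V" if "v \<in> V" for v
    using that by (auto simp: orbit_def act_in_V)
  have "\<exists>g \<in> carrier G. \<exists>u \<in> F. v = \<phi> g u" if v: "v \<in> V" for v
  proof -
    have Q: "orbit G \<phi> v \<in> ?Q"
      using v by (auto simp: orbits_def)
    define u where "u = (SOME u. u \<in> orbit G \<phi> v)"
    have "u \<in> orbit G \<phi> v" "u \<in> F"
      using rep[OF Q] Q by (auto simp: u_def F_def)
    then obtain g where g: "g \<in> carrier G" "\<phi> g v = u"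
      by (auto simp: orbit_def)
    then have "\<phi> (inv g) u = v"
      using action.orbit_sym_aux v by blast
    then show ?thesis
      using g \<open>u \<in> F\<close> by (metis inv_closed)
  qed
  moreover have "F \<subseteq> V"
    using rep orbV by (fastforce simp: F_def orbits_def)
  moreover have "finite F"
    using quasi_trans by (simp add: F_def quasi_transitive_def)
  ultimately show ?thesis by blast
qed

definition reps :: "'v set" where
  "reps = (SOME F. finite F \<and> F \<subseteq> V \<and> (\<forall>v \<in> V. \<exists>g \<in> carrier G. \<exists>u \<in> F. v = \<phi> g u))"

lemma reps: "finite reps" "reps \<subseteq> V" "v \<in> V \<Longrightarrow> \<exists>g \<in> carrier G. \<exists>u \<in> reps. v = \<phi> g u"
  using someI_ex[OF orbit_reps, folded reps_def] by auto


section \<open>Splitting peripheral sets\<close>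

definition splits :: "'v set \<Rightarrow> 'v set \<Rightarrow> bool" where
  "splits c H \<longleftrightarrow> infinite (c \<inter> H) \<and> infinite ((V - c) \<inter> H)"

lemma H_subset: "H \<in> \<H> \<Longrightarrow> H \<subseteq> V"
  using peripheral by (simp add: peripheral_system_def)

lemma H_act: "g \<in> carrier G \<Longrightarrow> H \<in> \<H> \<Longrightarrow> act g H \<in> \<H>"
  using H_invariant by (simp add: G_invariant_def)

lemma elliptic_iff: "b \<in> Ell \<longleftrightarrow> b \<in> Cuts \<and> (\<forall>H \<in> \<H>. \<not> splits b H)"
  by (auto simp: elliptic_cuts_def splits_def)

lemma splits_compl: "c \<subseteq> V \<Longrightarrow> splits (V - c) H \<longleftrightarrow> splits c H"
  by (auto simp: splits_def double_diff)

lemma splits_act: "g \<in> carrier G \<Longrightarrow> c \<subseteq> V \<Longrightarrow> H \<subseteq> V \<Longrightarrow> splits (act g c) (act g H) \<longleftrightarrow> splits c H"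
  unfolding splits_def
  by (simp add: act_compl[symmetric] act_Int[symmetric] Int_assoc finite_act_iff le_infI2)

lemma not_splits_sym_diff:
  assumes "\<not> splits c H" "\<not> splits d H" "c \<subseteq> V" "d \<subseteq> V"
  shows "\<not> splits (sym_diff c d) H"
proof -
  have 1: "sym_diff c d \<inter> H \<subseteq> (c \<inter> H) \<union> (d \<inter> H)" by blast
  have 2: "(V - sym_diff c d) \<inter> H \<subseteq> ((V - c) \<inter> H) \<union> (d \<inter> H)" by blast
  have 3: "(V - sym_diff c d) \<inter> H \<subseteq> (c \<inter> H) \<union> ((V - d) \<inter> H)" by blast
  have 4: "sym_diff c d \<inter> H \<subseteq> ((V - c) \<inter> H) \<union> ((V - d) \<inter> H)"
    using assms(3,4) by blast
  show ?thesis
    using assms(1,2) 1 2 3 4 unfolding splits_def by (meson finite_Un finite_subset)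
qed

text \<open>The subsets of \<open>V\<close> that do not split \<open>H\<close> form a group under
  symmetric difference, so splitting depends only on the coset.\<close>

lemma splits_cong_sym_diff:
  assumes "\<not> splits d H" "c \<subseteq> V" "d \<subseteq> V"
  shows "splits (sym_diff c d) H \<longleftrightarrow> splits c H"
proof -
  have *: "sym_diff (sym_diff c d) d = c" by blast
  have "sym_diff c d \<subseteq> V"
    using assms(2,3) by blast
  then show ?thesis
    using not_splits_sym_diff[of "sym_diff c d" H d] not_splits_sym_diff[of c H d] assms
    unfolding * by (simp only: simp_thms) argo
qed

lemma elliptic_cut: "b \<in> Ell \<Longrightarrow> b \<in> Cuts"
  by (simp add: elliptic_iff)

lemma elliptic_subset: "b \<in> Ell \<Longrightarrow> b \<subseteq> V"
  by (simp add: elliptic_iff cut_subset)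

lemma elliptic_empty [simp]: "{} \<in> Ell"
  by (simp add: elliptic_iff splits_def)

lemma elliptic_sym_diff:
  "b \<in> Ell \<Longrightarrow> c \<in> Ell \<Longrightarrow> sym_diff b c \<in> Ell"
  unfolding elliptic_iff using not_splits_sym_diff cut_sym_diff cut_subset by simp

lemma elliptic_compl: "b \<in> Ell \<Longrightarrow> V - b \<in> Ell"
  unfolding elliptic_iff using splits_compl cut_compl cut_subset by simp

lemma elliptic_V [simp]: "V \<in> Ell"
  using elliptic_compl[OF elliptic_empty] by simp

lemma elliptic_Int:
  assumes "b \<in> Ell" "c \<in> Ell"
  shows "b \<inter> c \<in> Ell"
proof -
  have "\<not> splits (b \<inter> c) H" if "H \<in> \<H>" for H
  proof -
    have "b \<inter> c \<inter> H \<subseteq> b \<inter> H" "b \<inter> c \<inter> H \<subseteq> c \<inter> H"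
      "(V - b \<inter> c) \<inter> H \<subseteq> ((V - b) \<inter> H) \<union> ((V - c) \<inter> H)" by blast+
    then show ?thesis
      using assms that unfolding elliptic_iff splits_def by (meson finite_Un finite_subset)
  qed
  then show ?thesis
    using assms cut_Int by (simp add: elliptic_iff)
qed

lemma elliptic_act:
  assumes g: "g \<in> carrier G" and b: "b \<in> Ell"
  shows "act g b \<in> Ell"
proof -
  have "\<not> splits (act g b) H" if H: "H \<in> \<H>" for H
  proof -
    have "splits (act g b) (act g (act (inv g) H)) \<longleftrightarrow> splits b (act (inv g) H)"
      using g b H by (intro splits_act act_subset_V elliptic_subset H_subset) auto
    moreover have "\<not> splits b (act (inv g) H)"
      using g b H H_act by (simp add: elliptic_iff)
    ultimately show ?thesis
      using g H_subset[OF H] by simp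
  qed
  then show ?thesis
    using g b cut_act by (simp add: elliptic_iff)
qed

text \<open>Peripheral sets that no cut can tell apart have to be resolved by the same atom; what
  can be bounded is the number of these classes.\<close>

definition sim :: "'v set \<Rightarrow> 'v set \<Rightarrow> bool" where
  "sim H H' \<longleftrightarrow> (\<forall>c \<in> Cuts. splits c H \<longleftrightarrow> splits c H')"

lemma sim_refl [simp]: "sim H H"
  and sim_sym: "sim H H' \<Longrightarrow> sim H' H"
  and sim_trans: "sim H H' \<Longrightarrow> sim H' H'' \<Longrightarrow> sim H H''"
  by (auto simp: sim_def)

lemma sim_splits: "sim H H' \<Longrightarrow> c \<in> Cuts \<Longrightarrow> splits c H \<longleftrightarrow> splits c H'"
  by (simp add: sim_def)

lemma sim_act:
  assumes g: "g \<in> carrier G" and H: "H \<subseteq> V" "H' \<subseteq> V" and s: "sim H H'"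
  shows "sim (act g H) (act g H')"
  unfolding sim_def
proof
  fix c assume c: "c \<in> Cuts"
  have "splits c (act g X) \<longleftrightarrow> splits (act (inv g) c) X" if "X \<subseteq> V" for X
    using splits_act[of g "act (inv g) c" X] g c that act_subset_V[of "inv g" c] cut_subset[OF c]
    by simp
  then show "splits c (act g H) \<longleftrightarrow> splits c (act g H')"
    using s sim_splits cut_act c g H by simp
qed

text \<open>If a cut splits \<open>H\<close>, then the stabiliser of \<open>H\<close>, which by thinness acts on \<open>H\<close> with
  finitely many orbits, moves a given finite connected set far into the cut.\<close>

lemma push_into:
  assumes H: "H \<in> \<H>" and p: "p \<in> Cuts" and inf: "infinite (p \<inter> H)"
    and K: "finite K" "K \<subseteq> V" "\<Union>(D p) \<subseteq> K"
  shows "\<exists>h \<in> carrier G. act h H = H \<and> act h K \<subseteq> p \<and> act h K \<inter> K = {}"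
proof -
  have pV: "p \<subseteq> V"
    using p cut_subset by blast
  have HV: "H \<subseteq> V"
    using H H_subset by blast
  define S where "S = {H' \<in> \<H>. H' \<inter> reps \<noteq> {}}"
  have "S = (\<Union>v \<in> reps. {H' \<in> \<H>. v \<in> H'})"
    by (auto simp: S_def)
  then have finS: "finite S"
    using reps thin by (auto simp: thin_def)
  have "\<forall>x \<in> p \<inter> H. \<exists>g u. g \<in> carrier G \<and> u \<in> reps \<and> x = \<phi> g u"
    using reps(3) pV by blast
  then obtain g u where gu: "\<And>x. x \<in> p \<inter> H \<Longrightarrow> g x \<in> carrier G \<and> u x \<in> reps \<and> x = \<phi> (g x) (u x)"
    by metis
  \<comment> \<open>The label of \<open>x\<close> records its orbit representative and the translate
    of \<open>H\<close> through that representative. By thinness there are finitely many labels, and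
    points with equal labels differ by an element stabilising \<open>H\<close>.\<close>
  define f where "f x = (u x, act (inv (g x)) H)" for x
  have "f x \<in> reps \<times> S" if x: "x \<in> p \<inter> H" for x
  proof -
    have "\<phi> (inv (g x)) x = u x"
      using gu[OF x] reps(2) by (intro action.orbit_sym_aux) auto
    then have "u x \<in> act (inv (g x)) H"
      using x by (metis IntD2 image_eqI)
    then show ?thesis
      using gu[OF x] H H_act by (auto simp: f_def S_def)
  qed
  then have "f ` (p \<inter> H) \<subseteq> reps \<times> S" by blast
  then have "finite (f ` (p \<inter> H))"
    using finS reps(1) by (meson finite_SigmaI finite_subset)
  then obtain x0 where x0: "x0 \<in> p \<inter> H" "infinite {x \<in> p \<inter> H. f x = f x0}"
    using pigeonhole_infinite[OF inf] by blast
  define X where "X = {x \<in> p \<inter> H. f x = f x0}"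
  define h where "h x = g x \<otimes> inv (g x0)" for x
  have h: "h x \<in> carrier G" "act (h x) H = H" "\<phi> (h x) x0 = x" if "x \<in> X" for x
  proof -
    have x: "x \<in> p \<inter> H" "u x = u x0" "act (inv (g x)) H = act (inv (g x0)) H"
      using that by (auto simp: X_def f_def)
    show "h x \<in> carrier G"
      using gu x x0 by (simp add: h_def)
    have "act (h x) H = act (g x) (act (inv (g x)) H)"
      using gu[OF x(1)] gu[OF x0(1)] HV x(3) by (simp add: h_def act_mult)
    then show "act (h x) H = H"
      using gu[OF x(1)] HV by simp
    have "\<phi> (inv (g x0)) x0 = u x0"
      using gu[OF x0(1)] reps(2) by (intro action.orbit_sym_aux) auto
    then show "\<phi> (h x) x0 = x"
      using gu[OF x(1)] gu[OF x0(1)] x(2) x0(1) pV action.composition_rule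
      by (metis IntD1 h_def inv_closed subsetD)
  qed
  have x0V: "x0 \<in> V"
    using x0 pV by blast
  obtain s where s: "K \<subseteq> ball s x0"
    using finite_in_ball K(1,2) x0V by blast
  \<comment> \<open>Infinitely many points share a label, so one of them, \<open>x\<close>, has
    distance more than \<open>s\<close> from \<open>K\<close>. Its \<open>s\<close>-ball misses the
    coboundary of \<open>p\<close>, hence lies in \<open>p\<close> along with \<open>x\<close>, and
    it contains the translate of \<open>K\<close>.\<close>
  have "finite (\<Union>k \<in> K. ball s k)"
    using K(1) finite_ball by blast
  then have "\<not> X \<subseteq> (\<Union>k \<in> K. ball s k)"
    using x0(2) finite_subset X_def by blast
  then obtain x where x: "x \<in> X" "x \<notin> (\<Union>k \<in> K. ball s k)" by blast
  have hb: "act (h x) (ball s x0) = ball s x"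
    using act_ball h[OF x(1)] x0V by simp
  have disj: "ball s x \<inter> K = {}"
    using x(2) ball_sym by blast
  have xp: "x \<in> p" "x \<in> V"
    using x(1) pV by (auto simp: X_def)
  have "ball s x \<subseteq> p \<or> ball s x \<inter> p = {}"
    using blob_ball[OF xp(2)] K(3) disj by (intro blob_const_disjoint) auto
  then have "ball s x \<subseteq> p"
    using xp(1) ball_center by blast
  moreover have "act (h x) K \<subseteq> ball s x"
    using s hb by blast
  ultimately show ?thesis
    using h[OF x(1)] disj by blast
qed

text \<open>An edge leaving \<open>q - p\<close> crosses \<open>p\<close> from a vertex of
  \<open>q\<close>, against \<open>K \<inter> q = {}\<close>, or crosses \<open>q\<close> from a
  vertex outside \<open>p\<close>, against \<open>L \<subseteq> p\<close>. So \<open>q - p\<close>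
  is empty or everything, and the nonempty \<open>L\<close> inside \<open>p\<close> excludes the
  latter.\<close>

lemma nest:
  assumes p: "p \<subseteq> V" "\<Union>(D p) \<subseteq> K" and q: "q \<subseteq> V" "\<Union>(D q) \<subseteq> L"
    and LK: "L \<subseteq> p" "L \<noteq> {}" and Kq: "K \<inter> q = {}"
  shows "q \<subseteq> p"
proof -
  have "D (q - p) = {}"
  proof (rule ccontr)
    assume "D (q - p) \<noteq> {}"
    then obtain u v where e: "{u, v} \<in> E" "u \<in> q" "u \<notin> p" "v \<notin> q - p"
      by (metis D_obtain DiffE ex_in_conv)
    show False
    proof (cases "v \<in> q")
      case True
      then have "{u, v} \<in> D p"
        using e D_iff[OF e(1), of p] by blast
      then show False
        using p(2) Kq e(2) by blast
    next
      case False
      then have "{u, v} \<in> D q"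
        using e D_iff[OF e(1), of q] by blast
      then show False
        using q(2) LK(1) e(3) by blast
    qed
  qed
  then have "q - p = {} \<or> q - p = V"
    using q(1) by (intro D_empty_cases) auto
  moreover have "q - p \<noteq> V"
    using LK p(1) by blast
  ultimately show ?thesis by blast
qed

text \<open>The blob \<open>K\<close> thickens the coboundary of \<open>p\<close> to a connected
  set, so that each translate of \<open>K\<close> lies wholly on one side of every other translate
  of \<open>p\<close>.\<close>

definition axis :: "'v set \<Rightarrow> 'v set \<Rightarrow> 'g \<Rightarrow> bool" where
  "axis p K g \<longleftrightarrow> p \<in> Cuts \<and> blob K \<and> \<Union>(D p) \<subseteq> K \<and> g \<in> carrier G \<and>
     act g p \<subseteq> p \<and> act g K \<subseteq> p \<and> K \<inter> act g p = {} \<and> K \<inter> act g K = {}"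

text \<open>Passing to the complement and the inverse exchanges the two ends of the axis, so that
  arguments can be made at the positive end only.\<close>

lemma axis_reverse:
  assumes "axis p K g"
  shows "axis (V - p) K (inv g)"
proof -
  have p: "p \<in> Cuts" "p \<subseteq> V" and K: "blob K" "K \<subseteq> V" "\<Union>(D p) \<subseteq> K" and g: "g \<in> carrier G"
    and gp: "act g p \<subseteq> p" "act g K \<subseteq> p" "K \<inter> act g p = {}" "K \<inter> act g K = {}"
    using assms unfolding axis_def blob_def cuts_iff by auto
  have sub: "act g p \<subseteq> V" "act g K \<subseteq> V"
    using p K g act_subset_V by auto
  have "act (inv g) (act g p) \<subseteq> act (inv g) p"
    using gp(1) by blast
  then have "p \<subseteq> act (inv g) p"
    using p g by simp
  moreover have "act (inv g) K \<inter> act (inv g) (act g p) = {}"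
    using gp(3) act_disjoint_iff[of "inv g" K "act g p"] g K p sub by simp
  then have "act (inv g) K \<inter> p = {}"
    using g p by simp
  moreover have "act (inv g) (act g K) \<subseteq> act (inv g) p"
    using gp(2) by blast
  then have "K \<subseteq> act (inv g) p"
    using g K by simp
  moreover have "act (inv g) K \<inter> act (inv g) (act g K) = {}"
    using gp(4) act_disjoint_iff[of "inv g" K "act g K"] g K sub by simp
  then have "act (inv g) K \<inter> K = {}"
    using g K by simp
  moreover have "act (inv g) (V - p) = V - act (inv g) p"
    using g p by (simp add: act_compl)
  moreover have "act (inv g) K \<subseteq> V"
    using g K act_subset_V by simp
  ultimately show ?thesis
    unfolding axis_def using p K g cut_compl by auto
qed

text \<open>Ping-pong: pushing \<open>K\<close> into both sides of \<open>p\<close> by elements stabilising \<open>H\<close>, either one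
  of them or their product translates \<open>p\<close> along an axis.\<close>

lemma axis_exists:
  assumes H: "H \<in> \<H>" and p: "p \<in> Cuts" and sp: "splits p H"
    and K: "blob K" "\<Union>(D p) \<subseteq> K"
  shows "\<exists>g. axis p K g \<and> act g H = H"
proof -
  have pV: "p \<subseteq> V" and KV: "K \<subseteq> V" "finite K" "K \<noteq> {}"
    using p K by (auto simp: cuts_iff blob_def)
  \<comment> \<open>The moved cut is nested with \<open>q\<close> in one of two ways: in the first
    \<open>h\<close> is already a translation, in the second it reverses the sides.\<close>
  have side: "\<exists>h \<in> carrier G. act h H = H \<and> act h K \<inter> K = {} \<and> act h K \<subseteq> q \<and>
      (K \<inter> act h q = {} \<and> act h q \<subseteq> q \<or> K \<subseteq> act h q \<and> V - act h q \<subseteq> q)"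
    if q: "q \<in> Cuts" "infinite (q \<inter> H)" "\<Union>(D q) \<subseteq> K" for q
  proof -
    obtain h where h: "h \<in> carrier G" "act h H = H" "act h K \<subseteq> q" "act h K \<inter> K = {}"
      using push_into[OF H q(1,2) KV(2,1) q(3)] by blast
    have qV: "q \<subseteq> V" using q(1) cut_subset by blast
    have U: "\<Union>(D (act h q)) \<subseteq> act h K"
      using Union_D_act[OF h(1) qV] q(3) by blast
    have ne: "act h K \<noteq> {}" using KV by simp
    have hq: "act h q \<subseteq> V" using act_subset_V h qV by blast
    have "K \<subseteq> act h q \<or> K \<inter> act h q = {}"
      using K(1) U h(4) by (intro blob_const_disjoint'[of K "act h q" "act h K"]) auto
    then show ?thesis
    proof
      assume a: "K \<subseteq> act h q"
      have "V - act h q \<subseteq> q"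
        using nest[OF qV q(3) _ _ h(3) ne, of "V - act h q"] U a by auto
      with a h show ?thesis by blast
    next
      assume a: "K \<inter> act h q = {}"
      have "act h q \<subseteq> q"
        using nest[OF qV q(3) hq U h(3) ne a] .
      with a h show ?thesis by blast
    qed
  qed
  have inf: "infinite (p \<inter> H)" "infinite ((V - p) \<inter> H)"
    using sp by (auto simp: splits_def)
  obtain h where h: "h \<in> carrier G" "act h H = H" "act h K \<inter> K = {}" "act h K \<subseteq> p"
    "K \<inter> act h p = {} \<and> act h p \<subseteq> p \<or> K \<subseteq> act h p \<and> V - act h p \<subseteq> p"
    using side[OF p inf(1) K(2)] by (elim bexE conjE) (rule that)
  obtain k where k: "k \<in> carrier G" "act k H = H" "act k K \<inter> K = {}" "act k K \<subseteq> V - p"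
    "K \<inter> act k (V - p) = {} \<and> act k (V - p) \<subseteq> V - p \<or> K \<subseteq> act k (V - p) \<and> V - act k (V - p) \<subseteq> V - p"
    using side[OF cut_compl[OF p] inf(2)] K(2) by auto
  have HV: "H \<subseteq> V" using H H_subset by blast
  show ?thesis
  proof (cases "K \<inter> act h p = {} \<and> act h p \<subseteq> p")
    case True
    then have "axis p K h"
      using h p K unfolding axis_def by auto
    then show ?thesis using h by blast
  next
    case F1: False
    then have h': "K \<subseteq> act h p" "V - act h p \<subseteq> p" using h(5) by auto
    show ?thesis
    proof (cases "K \<inter> act k (V - p) = {} \<and> act k (V - p) \<subseteq> V - p")
      case True
      then have "axis (V - p) K k"
        using k p K cut_compl unfolding axis_def by auto
      then have "axis p K (inv k)"
        using axis_reverse[of "V - p" K k] pV by (simp add: double_diff)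
      moreover have "act (inv k) H = H"
        using k(1,2) HV act_inv(1) by metis
      ultimately show ?thesis by blast
    next
      case False
      then have k': "K \<subseteq> act k (V - p)" "V - act k (V - p) \<subseteq> V - p" using k(5) by auto
      \<comment> \<open>Two reversals compose to a translation: \<open>k\<close> maps
        \<open>p\<close> into its complement, and \<open>h\<close> maps the complement back into
        \<open>p\<close>.\<close>
      define g where "g = h \<otimes> k"
      have g: "g \<in> carrier G" using h k by (simp add: g_def)
      have kp: "act k p \<subseteq> V - p"
        using k'(2) act_subset_V[OF k(1) pV] unfolding act_compl[OF k(1) pV] by auto
      have gp: "act g p = act h (act k p)" "act g K = act h (act k K)" "act g H = H"
        using h k pV KV HV by (simp_all add: g_def act_mult)
      have hVp: "act h (V - p) = V - act h p"
        using h(1) pV by (rule act_compl)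
      have "act g p \<subseteq> V - act h p"
        using gp(1) kp hVp by blast
      moreover have "act g K \<subseteq> V - act h p"
        using gp(2) k(4) hVp by blast
      ultimately have "axis p K g"
        using p K g h' unfolding axis_def by auto
      then show ?thesis using gp(3) by blast
    qed
  qed
qed

end

section \<open>Translates along an axis\<close>

context peripheral_graph
begin

definition tr :: "'v set \<Rightarrow> 'g \<Rightarrow> int \<Rightarrow> 'v set" where
  "tr X g n = act (g [^] n) X"

lemma tr_0: "X \<subseteq> V \<Longrightarrow> tr X g 0 = X"
  by (simp add: tr_def act_one)

lemma tr_subset: "g \<in> carrier G \<Longrightarrow> X \<subseteq> V \<Longrightarrow> tr X g n \<subseteq> V"
  by (simp add: tr_def act_subset_V)

lemma act_tr: "g \<in> carrier G \<Longrightarrow> X \<subseteq> V \<Longrightarrow> act (g [^] m) (tr X g n) = tr X g (m + n)"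
  by (simp add: tr_def act_mult[symmetric] int_pow_mult)

lemma tr_Suc: "g \<in> carrier G \<Longrightarrow> X \<subseteq> V \<Longrightarrow> tr X g (n + 1) = tr (act g X) g n"
  by (simp add: tr_def act_mult[symmetric] int_pow_mult)

lemma tr_compl_inv:
  assumes "g \<in> carrier G" "X \<subseteq> V"
  shows "tr (V - X) (inv g) n = V - tr X g (- n)"
  using assms by (simp add: tr_def act_compl int_pow_inv int_pow_neg)

lemma tr_inv: "g \<in> carrier G \<Longrightarrow> tr X (inv g) n = tr X g (- n)"
  by (simp add: tr_def int_pow_inv int_pow_neg)

lemma act_pow_fixed:
  assumes "g \<in> carrier G" "H \<subseteq> V" "act g H = H"
  shows "act (g [^] (n::int)) H = H"
proof -
  have nat: "act (g [^] (int m)) H = H" for m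
  proof (induction m)
    case (Suc m)
    have "act (g [^] (int m + 1)) H = act (g [^] int m) (act g H)"
      using assms by (simp only: int_pow_mult int_pow_1 act_mult int_pow_closed)
    with Suc show ?case
      using assms(3) by (simp add: add.commute)
  qed (use assms act_one in simp)
  show ?thesis
  proof (cases "n \<ge> 0")
    case True
    then show ?thesis
      using nat[of "nat n"] by simp
  next
    case False
    then have "act (inv (g [^] n)) H = H"
      using nat[of "nat (- n)"] assms(1) by (simp add: int_pow_neg)
    then show ?thesis
      using act_inv(2)[of "g [^] n" H] assms by simp
  qed
qed

lemma finite_Union_D: "finite (D c) \<Longrightarrow> finite (\<Union>(D c))"
  using D_subset edge_obtain by (metis finite.emptyI finite.insertI finite_Union subsetD)

text \<open>An edge is nonempty and so lies in at most one of disjoint sets; by pigeonhole some set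
  contains none. This is how a bound on the size of a coboundary is exploited, and
  \<open>const_on'\<close> then makes the free set disjoint from \<open>q\<close>.\<close>

lemma missed_set:
  assumes "finite I" "finite (D q)" "card (D q) < card I"
    and disj: "\<And>i j. i \<in> I \<Longrightarrow> j \<in> I \<Longrightarrow> i \<noteq> j \<Longrightarrow> X i \<inter> X j = {}"
  shows "\<exists>i \<in> I. \<forall>e \<in> D q. \<not> e \<subseteq> X i"
proof (rule ccontr)
  assume "\<not> ?thesis"
  then have "\<forall>i \<in> I. \<exists>e. e \<in> D q \<and> e \<subseteq> X i" by blast
  then obtain e where e: "\<And>i. i \<in> I \<Longrightarrow> e i \<in> D q \<and> e i \<subseteq> X i" by metis
  have "inj_on e I"
  proof (rule inj_onI, rule ccontr)
    fix i j assume ij: "i \<in> I" "j \<in> I" "e i = e j" "i \<noteq> j"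
    then have "e i \<subseteq> X i \<inter> X j" "e i \<noteq> {}"
      using e[of i] e[of j] D_edge_nonempty[of "e i" q] by auto
    then show False
      using disj[OF ij(1,2,4)] by simp
  qed
  then have "card I \<le> card (D q)"
    using e assms(2) by (intro card_inj_on_le[of e]) auto
  then show False
    using assms(3) by simp
qed

text \<open>\<open>far k p\<close>: the cut \<open>p\<close> is completed to an elliptic cut by pieces with at most
  \<open>k\<close> edges arbitrarily far away.\<close>

definition far :: "nat \<Rightarrow> 'v set \<Rightarrow> bool" where
  "far k p \<longleftrightarrow> (\<forall>L. finite L \<longrightarrow> L \<subseteq> V \<longrightarrow>
     (\<exists>b \<in> Ell. card (D (sym_diff p b)) \<le> k \<and> sym_diff p b \<inter> L = {}))"

lemma sym_diff_compl: "p \<subseteq> V \<Longrightarrow> b \<subseteq> V \<Longrightarrow> sym_diff (V - p) (V - b) = sym_diff p b"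
  by blast

lemma far_compl:
  assumes "far k p" "p \<subseteq> V"
  shows "far k (V - p)"
  unfolding far_def
proof (intro allI impI)
  fix L assume "finite L" "L \<subseteq> V"
  then obtain b where b: "b \<in> Ell" "card (D (sym_diff p b)) \<le> k" "sym_diff p b \<inter> L = {}"
    using assms(1) unfolding far_def by blast
  then show "\<exists>b \<in> Ell. card (D (sym_diff (V - p) b)) \<le> k \<and> sym_diff (V - p) b \<inter> L = {}"
    using elliptic_compl[OF b(1)] sym_diff_compl[OF assms(2) elliptic_subset[OF b(1)]]
    by (intro bexI[of _ "V - b"]) simp_all
qed

text \<open>\<open>two_ended H\<close> says that the cuts induce at most one nontrivial partition of \<open>H\<close>
  up to finite sets.\<close>

definition two_ended :: "'v set \<Rightarrow> bool" where
  "two_ended H \<longleftrightarrow> (\<forall>c \<in> Cuts. \<forall>d \<in> Cuts. splits c H \<longrightarrow> splits d H \<longrightarrow> \<not> splits (sym_diff c d) H)"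

lemma two_ended_sim: "two_ended H \<Longrightarrow> sim H' H \<Longrightarrow> two_ended H'"
  unfolding two_ended_def by (simp add: sim_def cut_sym_diff)

end

locale axis_ctx = peripheral_graph \<Gamma> G \<phi> \<H>
  for \<Gamma> :: "'v ugraph" and G :: "('g, 'm) monoid_scheme" (structure)
    and \<phi> :: "'g \<Rightarrow> 'v \<Rightarrow> 'v" and \<H> :: "'v set set" +
  fixes p K :: "'v set" and g :: 'g
  assumes ax: "axis p K g"
begin

section \<open>Translates of the cut, their frontiers and the blocks between them\<close>

abbreviation "P n \<equiv> tr p g n"
abbreviation "Q n \<equiv> tr K g n"
abbreviation "A n \<equiv> P n - P (n + 1)"

lemma p: "p \<in> Cuts" "p \<subseteq> V" "finite (D p)"
  using ax by (auto simp: axis_def cuts_iff)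

lemma K: "blob K" "K \<subseteq> V" "finite K" "K \<noteq> {}" "\<Union>(D p) \<subseteq> K"
  using ax by (auto simp: axis_def blob_def)

lemma g: "g \<in> carrier G" "g [^] (n::int) \<in> carrier G"
  using ax by (auto simp: axis_def)

lemma axis_sets:
  "act g p \<subseteq> p" "act g K \<subseteq> p" "K \<inter> act g p = {}" "K \<inter> act g K = {}"
  using ax by (auto simp: axis_def)

lemma rev: "axis_ctx \<Gamma> G \<phi> \<H> (V - p) K (inv g)"
  by unfold_locales (rule axis_reverse[OF ax])

lemma P_subset: "P n \<subseteq> V" and Q_subset: "Q n \<subseteq> V"
  using tr_subset g p K by auto

lemma P_0: "P 0 = p" and Q_0: "Q 0 = K"
  using tr_0 p K by auto

lemma P_Suc: "P (n + 1) \<subseteq> P n"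
  using axis_sets(1) by (simp add: tr_Suc g p) (auto simp: tr_def)

lemma P_mono: "m \<le> n \<Longrightarrow> P n \<subseteq> P m"
proof (induction rule: int_ge_induct)
  case (step i)
  then show ?case using P_Suc[of i] by blast
qed simp

lemma cut_P: "P n \<in> Cuts"
  using cut_act p g by (simp add: tr_def)

lemma blob_Q: "blob (Q n)"
  using blob_act K g by (simp add: tr_def)

lemma Q_finite: "finite (Q n)" and Q_nonempty: "Q n \<noteq> {}"
  using blob_Q by (auto simp: blob_def)

lemma D_P: "\<Union>(D (P n)) \<subseteq> Q n"
  using Union_D_act[OF g(2) p(2)] K(5) by (auto simp: tr_def)

lemma Q_in:
  assumes "n < m"
  shows "Q m \<subseteq> P n"
proof -
  have "Q (m - 1 + 1) \<subseteq> P (m - 1)"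
    using axis_sets(2) by (simp only: tr_Suc g K) (auto simp: tr_def)
  then show ?thesis
    using P_mono[of n "m - 1"] assms by auto
qed

lemma Q_out:
  assumes "m < n"
  shows "Q m \<inter> P n = {}"
proof -
  have "act (g [^] m) K \<inter> act (g [^] m) (act g p) = {}"
    using axis_sets(3) act_disjoint_iff g K p act_subset_V by simp
  then have "Q m \<inter> P (m + 1) = {}"
    by (simp add: tr_Suc g p) (simp add: tr_def)
  then show ?thesis
    using P_mono[of "m + 1" n] assms by auto
qed

lemma Q_disjoint_less:
  assumes "m < n"
  shows "Q m \<inter> Q n = {}"
proof (cases "n = m + 1")
  case True
  have "act (g [^] m) K \<inter> act (g [^] m) (act g K) = {}"
    using axis_sets(4) act_disjoint_iff g K act_subset_V by simp
  then show ?thesis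
    unfolding True by (simp add: tr_Suc g K) (simp add: tr_def)
next
  case False
  then show ?thesis
    using Q_in[of "m + 1" n] Q_out[of m "m + 1"] assms by auto
qed

lemma Q_disjoint: "m \<noteq> n \<Longrightarrow> Q m \<inter> Q n = {}"
  using Q_disjoint_less[of m n] Q_disjoint_less[of n m] by (cases "m < n") auto

lemma block_disjoint: "m \<le> n \<Longrightarrow> (P l - P m) \<inter> (P n - P r) = {}"
  using P_mono[of m n] by blast

lemma A_disjoint: "m \<noteq> n \<Longrightarrow> A m \<inter> A n = {}"
  using block_disjoint[of "m + 1" n m "n + 1"] block_disjoint[of "n + 1" m n "m + 1"]
  by (cases "m < n") (auto simp: Int_commute)

lemma D_block: "\<Union>(D (P m - P n)) \<subseteq> Q m \<union> Q n"
  using D_Diff[of "P m" "P n"] D_P[of m] D_P[of n] by blast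

lemma block_missed:
  assumes "q \<inter> Q m = {}" "q \<inter> Q n = {}" "\<forall>e \<in> D q. \<not> e \<subseteq> P m - P n"
  shows "(P m - P n) \<inter> q = {}"
proof (rule const_on'[of _ "Q m \<union> Q n"])
  show "P m - P n \<subseteq> V"
    using P_subset[of m] by blast
  show "\<Union>(D (P m - P n)) \<subseteq> Q m \<union> Q n"
    by (rule D_block)
  show "(Q m \<union> Q n) \<inter> q = {}"
    using assms(1,2) by auto
  show "(Q m \<union> Q n) \<inter> V \<noteq> {}"
    using Q_nonempty[of m] Q_subset[of m] by auto
qed (use assms(3) in simp)

text \<open>A ball containing \<open>K\<close> and \<open>S\<close> is finite and the frontiers
  \<open>Q n\<close> are disjoint, so it meets only finitely many of them. For the other
  \<open>n\<close> the connected ball lies on one side of \<open>P n\<close>, namely on that of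
  \<open>K\<close>.\<close>

lemma exhaust:
  assumes "finite S" "S \<subseteq> V"
  shows "\<exists>N \<ge> 0. \<forall>n \<ge> N. S \<inter> P n = {} \<and> S \<subseteq> P (- n)"
proof -
  obtain v where v: "v \<in> K" "v \<in> V"
    using K by blast
  obtain s where s: "K \<union> S \<subseteq> ball s v"
    using finite_in_ball[of "K \<union> S" v] assms K v by auto
  define L where "L = ball s v"
  have L: "blob L" "finite L" "K \<subseteq> L" "S \<subseteq> L"
    using s blob_ball finite_ball v by (auto simp: L_def)
  define w where "w n = (SOME x. x \<in> L \<inter> Q n)" for n
  have w: "w n \<in> L \<inter> Q n" if "L \<inter> Q n \<noteq> {}" for n
    unfolding w_def using that by (rule some_in_eq[THEN iffD2])
  have "inj_on w {n. L \<inter> Q n \<noteq> {}}"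
  proof (rule inj_onI, rule ccontr)
    fix m n assume "m \<in> {n. L \<inter> Q n \<noteq> {}}" "n \<in> {n. L \<inter> Q n \<noteq> {}}" "w m = w n" "m \<noteq> n"
    then show False
      using w[of m] w[of n] Q_disjoint[of m n] by auto
  qed
  moreover have "w ` {n. L \<inter> Q n \<noteq> {}} \<subseteq> L"
    using w by blast
  ultimately have "finite {n. L \<inter> Q n \<noteq> {}}"
    using L(2) by (rule inj_on_finite)
  then have "finite (abs ` {n. L \<inter> Q n \<noteq> {}})" by simp
  then obtain N where N: "\<And>n. L \<inter> Q n \<noteq> {} \<Longrightarrow> \<bar>n\<bar> \<le> N"
    using Max_ge by blast
  have "S \<inter> P n = {} \<and> S \<subseteq> P (- n)" if n: "n \<ge> \<bar>N\<bar> + 1" for n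
  proof -
    have far: "L \<inter> Q n = {}" "L \<inter> Q (- n) = {}"
      using N[of n] N[of "- n"] n by force+
    have "L \<subseteq> P n \<or> L \<inter> P n = {}"
      by (rule blob_const_disjoint'[OF L(1) D_P far(1)])
    moreover have "K \<inter> P n = {}"
      using Q_out[of 0 n] Q_0 n by simp
    moreover have "L \<subseteq> P (- n) \<or> L \<inter> P (- n) = {}"
      by (rule blob_const_disjoint'[OF L(1) D_P far(2)])
    moreover have "K \<subseteq> P (- n)"
      using Q_in[of "- n" 0] Q_0 n by simp
    ultimately show ?thesis
      using L(3,4) K(4) by blast
  qed
  then show ?thesis
    by (intro exI[of _ "\<bar>N\<bar> + 1"]) simp
qed

text \<open>Far out, both \<open>P n\<close> and its connected frontier \<open>Q n\<close> miss the
  coboundary of \<open>c\<close>; the constant value of \<open>c\<close> on \<open>Q n\<close> then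
  spreads over \<open>P n\<close>, connected or not.\<close>

lemma tail_const_pos:
  assumes "c \<in> Cuts"
  shows "\<exists>N \<ge> 0. \<forall>n \<ge> N. P n \<subseteq> c \<or> P n \<inter> c = {}"
proof -
  have "finite (D c)" using assms by (simp add: cuts_iff)
  then have "finite (\<Union>(D c))"
    by (rule finite_Union_D)
  then obtain N where N: "N \<ge> 0" "\<forall>n \<ge> N. \<Union>(D c) \<inter> P n = {} \<and> \<Union>(D c) \<subseteq> P (- n)"
    using exhaust[OF _ Union_D_subset] by blast
  \<comment> \<open>One step beyond \<open>N\<close>, since the frontier \<open>Q n\<close> is only
    known to lie in \<open>P (n - 1)\<close>.\<close>
  have "P n \<subseteq> c \<or> P n \<inter> c = {}" if n: "n \<ge> N + 1" for n
  proof -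
    have o: "\<Union>(D c) \<inter> P n = {}" "\<Union>(D c) \<inter> Q n = {}"
      using N(2)[rule_format, of n] N(2)[rule_format, of "n - 1"] n Q_in[of "n - 1" n] by auto
    have ne: "\<not> e \<subseteq> P n" if "e \<in> D c" for e
      using o(1) that D_edge_nonempty[OF that] by blast
    have QV: "Q n \<inter> V \<noteq> {}"
      using Q_subset Q_nonempty by blast
    have "Q n \<subseteq> c \<or> Q n \<inter> c = {}"
      using o(2) by (rule blob_const_disjoint[OF blob_Q])
    then show ?thesis
    proof
      assume "Q n \<inter> c = {}"
      then show ?thesis
        using const_on'[OF P_subset D_P _ ne QV] by blast
    next
      assume "Q n \<subseteq> c"
      then have "P n \<inter> (V - c) = {}"
        by (intro const_on'[OF P_subset D_P _ _ QV]) (use ne in auto)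
      then show ?thesis
        using P_subset by blast
    qed
  qed
  then show ?thesis
    using N(1) by (intro exI[of _ "N + 1"]) auto
qed

lemma tail_const:
  assumes "c \<in> Cuts"
  shows "\<exists>N \<ge> 0. \<forall>n \<ge> N. (P n \<subseteq> c \<or> P n \<inter> c = {}) \<and> (V - P (- n) \<subseteq> c \<or> (V - P (- n)) \<inter> c = {})"
proof -
  interpret rev: axis_ctx \<Gamma> G \<phi> \<H> "V - p" K "inv g" by (rule rev)
  obtain N where N: "N \<ge> 0" "\<forall>n \<ge> N. P n \<subseteq> c \<or> P n \<inter> c = {}"
    using tail_const_pos[OF assms] by blast
  obtain M where M: "M \<ge> 0" "\<forall>n \<ge> M. tr (V - p) (inv g) n \<subseteq> c \<or> tr (V - p) (inv g) n \<inter> c = {}"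
    using rev.tail_const_pos[OF assms] by blast
  show ?thesis
    using N M by (intro exI[of _ "max N M"]) (simp add: tr_compl_inv g p)
qed

text \<open>\<open>H\<close> runs along the axis in both directions and is finite in between, so
  that cuts see nothing of it but the two ends of the axis.\<close>

definition axial :: "'v set \<Rightarrow> bool" where
  "axial H \<longleftrightarrow> (\<forall>n. finite (H \<inter> A n)) \<and> (\<forall>n. infinite (H \<inter> P n)) \<and> (\<forall>n. infinite (H \<inter> (V - P n)))"

lemma finite_block:
  assumes "\<And>n. finite (H \<inter> A n)"
  shows "finite (H \<inter> (P m - P n))"
proof (cases "m \<le> n")
  case True
  then show ?thesis
  proof (induction rule: int_ge_induct)
    case (step i)
    have "H \<inter> (P m - P (i + 1)) \<subseteq> (H \<inter> (P m - P i)) \<union> (H \<inter> A i)" by blast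
    then show ?case
      using step assms by (meson finite_Un finite_subset)
  qed simp
next
  case False
  then show ?thesis
    using P_mono[of n m] by (metis Diff_eq_empty_iff Int_empty_right finite.emptyI linear)
qed

text \<open>Between the two tails \<open>H\<close> is finite and in each tail it is infinite, so up
  to finite sets the trace of \<open>c\<close> on \<open>H\<close> is given by the two values of
  \<open>c\<close> at the ends.\<close>

lemma splits_axial:
  assumes H: "axial H" "H \<subseteq> V" and n: "n \<ge> 0"
    and t: "P n \<subseteq> c \<or> P n \<inter> c = {}" "V - P (- n) \<subseteq> c \<or> (V - P (- n)) \<inter> c = {}"
  shows "splits c H \<longleftrightarrow> (P n \<subseteq> c) \<noteq> (V - P (- n) \<subseteq> c)"
proof -
  have "finite (H \<inter> A i)" for i
    using H(1) unfolding axial_def by simp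
  then have fin: "finite (H \<inter> (P (- n) - P n))"
    by (rule finite_block)
  have inf: "infinite (H \<inter> P n)" "infinite (H \<inter> (V - P (- n)))"
    using H(1) by (auto simp: axial_def)
  have "P n \<noteq> {}" "V - P (- n) \<noteq> {}"
    using inf by (metis Int_empty_right finite.emptyI)+
  then have t': "P n \<inter> c = {} \<longleftrightarrow> \<not> P n \<subseteq> c" "(V - P (- n)) \<inter> c = {} \<longleftrightarrow> \<not> V - P (- n) \<subseteq> c"
    using t by auto
  have 1: "infinite (c \<inter> H)" if "X \<subseteq> c" "infinite (H \<inter> X)" for X
    using that by (metis Int_commute Int_mono finite_subset order_refl)
  have 2: "infinite ((V - c) \<inter> H)" if "X \<inter> c = {}" "infinite (H \<inter> X)" for X
  proof -
    have "H \<inter> X \<subseteq> (V - c) \<inter> H"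
      using that(1) H(2) by blast
    then show ?thesis
      using that(2) finite_subset by blast
  qed
  have 3: "finite (c \<inter> H)" if "P n \<inter> c = {}" "(V - P (- n)) \<inter> c = {}"
  proof -
    have "c \<inter> H \<subseteq> H \<inter> (P (- n) - P n)"
      using that H(2) by blast
    then show ?thesis
      using fin finite_subset by blast
  qed
  have 4: "finite ((V - c) \<inter> H)" if "P n \<subseteq> c" "V - P (- n) \<subseteq> c"
  proof -
    have "(V - c) \<inter> H \<subseteq> H \<inter> (P (- n) - P n)"
      using that by blast
    then show ?thesis
      using fin finite_subset by blast
  qed
  show ?thesis
  proof (cases "P n \<subseteq> c"; cases "V - P (- n) \<subseteq> c")
    assume "P n \<subseteq> c" "V - P (- n) \<subseteq> c"
    with 4 show ?thesis by (simp add: splits_def)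
  next
    assume a: "P n \<subseteq> c" "\<not> V - P (- n) \<subseteq> c"
    then have "infinite (c \<inter> H)" "infinite ((V - c) \<inter> H)"
      using 1[OF a(1) inf(1)] 2[OF _ inf(2)] t'(2) by auto
    with a show ?thesis by (simp add: splits_def)
  next
    assume a: "\<not> P n \<subseteq> c" "V - P (- n) \<subseteq> c"
    then have "infinite (c \<inter> H)" "infinite ((V - c) \<inter> H)"
      using 1[OF a(2) inf(2)] 2[OF _ inf(1)] t'(1) by auto
    with a show ?thesis by (simp add: splits_def)
  next
    assume a: "\<not> P n \<subseteq> c" "\<not> V - P (- n) \<subseteq> c"
    then have "finite (c \<inter> H)"
      using 3 t' by simp
    with a show ?thesis by (simp add: splits_def)
  qed
qed

text \<open>The criterion of \<open>splits_axial\<close> does not depend on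
  \<open>H\<close>.\<close>

lemma axial_sim:
  assumes "axial H" "H \<subseteq> V" "axial H'" "H' \<subseteq> V"
  shows "sim H H'"
  unfolding sim_def
proof
  fix c assume "c \<in> Cuts"
  then obtain N where "N \<ge> 0" "(P N \<subseteq> c \<or> P N \<inter> c = {}) \<and> (V - P (- N) \<subseteq> c \<or> (V - P (- N)) \<inter> c = {})"
    using tail_const[of c] by blast
  then show "splits c H \<longleftrightarrow> splits c H'"
    using splits_axial[of H N c] splits_axial[of H' N c] assms by simp
qed

lemma const_sym_diff:
  assumes "X \<noteq> {}" "X \<subseteq> c \<or> X \<inter> c = {}" "X \<subseteq> d \<or> X \<inter> d = {}"
  shows "X \<subseteq> sym_diff c d \<longleftrightarrow> (X \<subseteq> c) \<noteq> (X \<subseteq> d)"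
    "X \<subseteq> sym_diff c d \<or> X \<inter> sym_diff c d = {}"
  using assms by blast+

text \<open>Two cuts that both change their value between the ends have a sum with equal values
  there.\<close>

lemma axial_two_ended:
  assumes H: "axial H" "H \<subseteq> V"
  shows "two_ended H"
  unfolding two_ended_def
proof (intro ballI impI)
  fix c d assume cd: "c \<in> Cuts" "d \<in> Cuts" "splits c H" "splits d H"
  obtain N where N: "N \<ge> 0" "\<forall>n \<ge> N. (P n \<subseteq> c \<or> P n \<inter> c = {}) \<and> (V - P (- n) \<subseteq> c \<or> (V - P (- n)) \<inter> c = {})"
    using tail_const[OF cd(1)] by blast
  obtain M where M: "M \<ge> 0" "\<forall>n \<ge> M. (P n \<subseteq> d \<or> P n \<inter> d = {}) \<and> (V - P (- n) \<subseteq> d \<or> (V - P (- n)) \<inter> d = {})"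
    using tail_const[OF cd(2)] by blast
  define n where "n = max N M"
  have n: "n \<ge> 0" "n \<ge> N" "n \<ge> M"
    using N M by (auto simp: n_def)
  have "P n \<noteq> {}" "V - P (- n) \<noteq> {}"
    using H(1) unfolding axial_def by (metis Int_empty_right finite.emptyI)+
  moreover have c: "P n \<subseteq> c \<or> P n \<inter> c = {}" "V - P (- n) \<subseteq> c \<or> (V - P (- n)) \<inter> c = {}"
    using N(2) n(2) by blast+
  moreover have d: "P n \<subseteq> d \<or> P n \<inter> d = {}" "V - P (- n) \<subseteq> d \<or> (V - P (- n)) \<inter> d = {}"
    using M(2) n(3) by blast+
  moreover have "(P n \<subseteq> c) \<noteq> (V - P (- n) \<subseteq> c)" "(P n \<subseteq> d) \<noteq> (V - P (- n) \<subseteq> d)"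
    using splits_axial[OF H n(1) c] splits_axial[OF H n(1) d] cd by auto
  ultimately have vals: "P n \<subseteq> sym_diff c d \<longleftrightarrow> V - P (- n) \<subseteq> sym_diff c d"
    and t: "P n \<subseteq> sym_diff c d \<or> P n \<inter> sym_diff c d = {}"
      "V - P (- n) \<subseteq> sym_diff c d \<or> (V - P (- n)) \<inter> sym_diff c d = {}"
    using const_sym_diff[of "P n" c d] const_sym_diff[of "V - P (- n)" c d] by argo+
  show "\<not> splits (sym_diff c d) H"
    using splits_axial[OF H n(1) t] vals by simp
qed

text \<open>If \<open>H'\<close> accumulated both at the end of the axis and in \<open>A m\<close>, then so would its
  translates in \<open>A n\<close>. An elliptic cut completing \<open>p\<close> far away agrees with \<open>p\<close> on most
  \<open>A n\<close>, so it contains some of them with \<open>n \<ge> 0\<close> and misses some with \<open>n < 0\<close>; one of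
  the two contradicts its value at the end of the axis.\<close>

lemma accumulates_pos:
  assumes far: "far k p" and H: "H' \<in> \<H>" and inf: "\<And>n. infinite (H' \<inter> P n)"
  shows "finite (H' \<inter> A m)"
proof (rule ccontr)
  assume Am: "infinite (H' \<inter> A m)"
  \<comment> \<open>There are \<open>k + 1\<close> blocks on each side: those with index in
    \<open>{0..k}\<close> lie in \<open>p\<close>, those in \<open>{-(k+1)..-1}\<close> are disjoint
    from it. The last index is \<open>k + 1\<close> because the block \<open>A k\<close> ends at
    \<open>Q (k + 1)\<close>.\<close>
  define L where "L = (\<Union>n \<in> {-(int k + 1)..int k + 1}. Q n)"
  have "finite L" "L \<subseteq> V"
    using Q_finite Q_subset by (auto simp: L_def)
  then obtain b where b: "b \<in> Ell" "card (D (sym_diff p b)) \<le> k" "sym_diff p b \<inter> L = {}"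
    using far unfolding far_def by blast
  define q where "q = sym_diff p b"
  have q: "finite (D q)" "card (D q) \<le> k" "q \<inter> L = {}"
    using b cut_sym_diff[OF p(1) elliptic_cut[OF b(1)]] by (auto simp: q_def cuts_iff)
  have H'V: "H' \<subseteq> V" using H H_subset by blast
  have window: "\<exists>n \<in> I. A n \<inter> q = {}" if I: "I \<subseteq> {-(int k + 1)..int k}" "card I = k + 1" for I
  proof -
    have fI: "finite I" using I(2) by (metis Suc_eq_plus1 card.infinite nat.simps(3))
    obtain n where n: "n \<in> I" "\<forall>e \<in> D q. \<not> e \<subseteq> A n"
      using missed_set[OF fI q(1), of A] q(2) I(2) A_disjoint by auto
    have "q \<inter> Q n = {}" "q \<inter> Q (n + 1) = {}"
      using q(3) n(1) I(1) by (fastforce simp: L_def)+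
    then show ?thesis
      using block_missed[of q n "n + 1"] n by blast
  qed
  have tn: "infinite (act (g [^] (n - m)) H' \<inter> A n)" "infinite (act (g [^] (n - m)) H' \<inter> P j)" for n j
  proof -
    have a: "act (g [^] (n - m)) (H' \<inter> X) = act (g [^] (n - m)) H' \<inter> act (g [^] (n - m)) X" if "X \<subseteq> V" for X
      using act_Int g H'V that by blast
    have "act (g [^] (n - m)) (A m) = A n"
      using act_diff[OF g(2) P_subset P_subset] by (simp add: act_tr g p)
    then show "infinite (act (g [^] (n - m)) H' \<inter> A n)"
      using Am a[of "A m"] P_subset[of m] finite_act_iff[OF g(2), of "H' \<inter> A m" "n - m"] H'V
      by (simp add: le_infI1 subset_iff)
    have "act (g [^] (n - m)) (P (j - n + m)) = P j"
      by (simp add: act_tr g p)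
    then show "infinite (act (g [^] (n - m)) H' \<inter> P j)"
      using inf[of "j - n + m"] a[OF P_subset] finite_act_iff[OF g(2), of "H' \<inter> P (j - n + m)" "n - m"] H'V
      by (simp add: le_infI1)
  qed
  have el: "\<not> splits b (act (g [^] (n - m)) H')" for n
    using b(1) H H_act g by (simp add: elliptic_iff)
  have HnV: "act (g [^] (n - m)) H' \<subseteq> V" for n
    using act_subset_V g H'V by simp
  have "b \<in> Cuts" using b elliptic_cut by blast
  then obtain N where N: "P N \<subseteq> b \<or> P N \<inter> b = {}"
    using tail_const_pos[of b] by blast
  from N show False
  proof
    assume c: "P N \<inter> b = {}"
    obtain n where n: "n \<in> {0..int k}" "A n \<inter> q = {}"
      using window[of "{0..int k}"] by (auto simp: nat_add_distrib)
    have "A n \<subseteq> p"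
      using P_mono[of 0 n] P_0 n(1) by auto
    then have "A n \<subseteq> b"
      using n(2) by (auto simp: q_def)
    then have "infinite (b \<inter> act (g [^] (n - m)) H')"
      using tn(1)[of n] by (metis Int_commute Int_mono finite_subset order_refl)
    moreover have "act (g [^] (n - m)) H' \<inter> P N \<subseteq> (V - b) \<inter> act (g [^] (n - m)) H'"
      using c HnV by blast
    then have "infinite ((V - b) \<inter> act (g [^] (n - m)) H')"
      using tn(2)[of n N] finite_subset by blast
    ultimately show False
      using el[of n] by (simp add: splits_def)
  next
    assume c: "P N \<subseteq> b"
    obtain n where n: "n \<in> {-(int k + 1)..-1}" "A n \<inter> q = {}"
      using window[of "{-(int k + 1)..-1}"] by (auto simp: nat_add_distrib)
    have "A n \<inter> p = {}"
      using P_mono[of "n + 1" 0] P_0 n(1) by auto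
    then have "A n \<inter> b = {}"
      using n(2) by (auto simp: q_def)
    then have "act (g [^] (n - m)) H' \<inter> A n \<subseteq> (V - b) \<inter> act (g [^] (n - m)) H'"
      using HnV by blast
    then have "infinite ((V - b) \<inter> act (g [^] (n - m)) H')"
      using tn(1)[of n] finite_subset by blast
    moreover have "infinite (b \<inter> act (g [^] (n - m)) H')"
      using tn(2)[of n N] c by (metis Int_commute Int_mono finite_subset order_refl)
    ultimately show False
      using el[of n] by (simp add: splits_def)
  qed
qed

lemma accumulates_neg:
  assumes far: "far k p" and H: "H' \<in> \<H>" and inf: "\<And>n. infinite (H' \<inter> (V - P n))"
  shows "finite (H' \<inter> A m)"
proof -
  interpret rev: axis_ctx \<Gamma> G \<phi> \<H> "V - p" K "inv g" by (rule rev)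
  \<comment> \<open>Reversal turns \<open>P n\<close> into \<open>V - P (- n)\<close>, so the block
    \<open>A m\<close> reappears with index \<open>- m - 1\<close>.\<close>
  have "finite (H' \<inter> (tr (V - p) (inv g) (- m - 1) - tr (V - p) (inv g) (- m - 1 + 1)))"
    using far_compl[OF far p(2)] H inf by (intro rev.accumulates_pos) (auto simp: tr_compl_inv g p)
  moreover have "tr (V - p) (inv g) (- m - 1) - tr (V - p) (inv g) (- m - 1 + 1) = A m"
    using P_subset by (auto simp: tr_compl_inv g p algebra_simps)
  ultimately show ?thesis by simp
qed

text \<open>Accumulation at one end makes every block finite; then the infinite part of
  \<open>H'\<close> on either side of \<open>p\<close> can only run off to the end on that
  side.\<close>

lemma axial_of_tail:
  assumes far: "far k p" and H: "H' \<in> \<H>" "splits p H'"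
    and tail: "(\<forall>n. infinite (H' \<inter> P n)) \<or> (\<forall>n. infinite (H' \<inter> (V - P n)))"
  shows "axial H'"
proof -
  have fin: "finite (H' \<inter> A n)" for n
    using accumulates_pos[OF far H(1)] accumulates_neg[OF far H(1)] tail by blast
  have HV: "H' \<subseteq> V" using H H_subset by blast
  have "infinite (H' \<inter> P n)" for n
  proof
    assume "finite (H' \<inter> P n)"
    moreover have "p \<inter> H' \<subseteq> (H' \<inter> P n) \<union> (H' \<inter> (P 0 - P n))"
      using P_0 by blast
    ultimately show False
      using finite_block[OF fin, of 0 n] H(2) unfolding splits_def by (meson finite_Un finite_subset)
  qed
  moreover have "infinite (H' \<inter> (V - P n))" for n
  proof
    assume "finite (H' \<inter> (V - P n))"
    moreover have "(V - p) \<inter> H' \<subseteq> (H' \<inter> (V - P n)) \<union> (H' \<inter> (P n - P 0))"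
      using P_0 by blast
    ultimately show False
      using finite_block[OF fin, of n 0] H(2) unfolding splits_def by (meson finite_Un finite_subset)
  qed
  ultimately show ?thesis
    using fin by (simp add: axial_def)
qed

lemma stable_tails:
  assumes H: "H \<subseteq> V" "splits p H" "act g H = H"
  shows "infinite (H \<inter> P n)" "infinite (H \<inter> (V - P n))"
proof -
  have Hn: "act (g [^] n) H = H"
    using act_pow_fixed g H by blast
  have a: "act (g [^] n) (H \<inter> X) = H \<inter> act (g [^] n) X" if "X \<subseteq> V" for X
    using act_Int g H(1) that Hn by simp
  have i: "infinite (H \<inter> act (g [^] n) X)" if "X \<subseteq> V" "infinite (H \<inter> X)" for X
    using a that finite_act_iff[OF g(2), of "H \<inter> X"] H(1) by (metis le_infI1)
  show "infinite (H \<inter> P n)"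
    using i[OF p(2)] H(2) by (simp add: tr_def splits_def Int_commute)
  show "infinite (H \<inter> (V - P n))"
    using i[of "V - p"] H(2) act_compl[OF g(2) p(2)] by (simp add: tr_def splits_def Int_commute)
qed

lemma stable_axial:
  assumes "far k p" "H \<in> \<H>" "splits p H" "act g H = H"
  shows "axial H"
  using assms stable_tails H_subset by (intro axial_of_tail) auto

text \<open>Accumulation at one end would already make \<open>H'\<close> axial. So the other classes
  split by \<open>p\<close> leave both tails up to finite sets, which is what allows classes to be
  separated.\<close>

lemma share:
  assumes far: "far k p" and H: "H' \<in> \<H>" "splits p H'" "\<not> axial H'"
  shows "\<exists>N \<ge> 0. \<forall>n \<ge> N. finite (H' \<inter> (P n \<union> (V - P (- n))))"
proof -
  obtain m1 m2 where m: "finite (H' \<inter> P m1)" "finite (H' \<inter> (V - P m2))"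
    using axial_of_tail[OF far H(1,2)] H(3) by blast
  have "finite (H' \<inter> (P n \<union> (V - P (- n))))" if "n \<ge> max 0 (max m1 (- m2))" for n
  proof -
    have "P n \<subseteq> P m1" "P m2 \<subseteq> P (- n)"
      using that by (auto intro!: P_mono)
    then have "H' \<inter> (P n \<union> (V - P (- n))) \<subseteq> (H' \<inter> P m1) \<union> (H' \<inter> (V - P m2))"
      by blast
    then show ?thesis
      using m by (meson finite_Un finite_subset)
  qed
  then show ?thesis
    by (intro exI[of _ "max 0 (max m1 (- m2))"]) auto
qed

lemma tail_avoids:
  assumes H: "H \<subseteq> V" "splits p H" "act g H = H" and c: "c \<in> Cuts" "finite (H \<inter> c)"
  shows "\<exists>N \<ge> 0. \<forall>n \<ge> N. (P n \<union> (V - P (- n))) \<inter> c = {}"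
proof -
  obtain N where N: "N \<ge> 0"
    "\<forall>n \<ge> N. (P n \<subseteq> c \<or> P n \<inter> c = {}) \<and> (V - P (- n) \<subseteq> c \<or> (V - P (- n)) \<inter> c = {})"
    using tail_const[OF c(1)] by blast
  have "\<not> X \<subseteq> c" if "infinite (H \<inter> X)" for X
    using c(2) that by (meson Int_mono finite_subset order_refl)
  then have "\<not> P n \<subseteq> c" "\<not> V - P (- n) \<subseteq> c" for n
    using stable_tails[OF H] by blast+
  then have "\<forall>n \<ge> N. (P n \<union> (V - P (- n))) \<inter> c = {}"
    using N(2) by blast
  then show ?thesis using N(1) by blast
qed

text \<open>\<open>q\<close> contains the end of the axis, so cutting it off by \<open>P n\<close>
  leaves a piece \<open>f\<close> that still splits \<open>H\<close>. This is done at the start of a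
  gap of \<open>q\<close> longer than \<open>n0\<close>. If \<open>f\<close> split another class,
  that class would be infinite outside \<open>P n\<close> and inside \<open>P (n + n0)\<close>;
  translating back by \<open>n\<close> would give a class split by \<open>p\<close> and infinite in
  \<open>P n0\<close>, which only the class of \<open>H\<close> can be.\<close>

lemma atom_pos:
  assumes far: "far k p" and H: "H \<in> \<H>" "splits p H" "act g H = H"
    and n0: "\<And>H'. H' \<in> \<H> \<Longrightarrow> splits p H' \<Longrightarrow> \<not> sim H' H \<Longrightarrow> finite (H' \<inter> P (int n0))"
    and b: "b \<in> Ell" and q: "q = sym_diff p b" "card (D q) \<le> k"
    and L: "\<And>n. 0 \<le> n \<Longrightarrow> n \<le> int ((k + 2) * (n0 + 1)) \<Longrightarrow> q \<inter> Q n = {}"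
    and tail: "P N \<subseteq> q"
  shows "\<exists>f \<in> Cuts. \<forall>H' \<in> \<H>. splits f H' \<longleftrightarrow> sim H' H"
proof -
  have qcut: "q \<in> Cuts"
    using cut_sym_diff[OF p(1) elliptic_cut[OF b]] q(1) by simp
  have qD: "finite (D q)" using qcut cuts_iff by blast
  have HV: "H \<subseteq> V" using H H_subset by blast
  \<comment> \<open>The blocks have length \<open>n0 + 1\<close>, to contain the gap, and start at
    depth \<open>n0\<close>. Of these, \<open>k + 1\<close> blocks suffice, and the last ends before
    \<open>(k + 2) * (n0 + 1)\<close>, the depth to which \<open>q\<close> has to avoid the
    frontiers.\<close>
  define s where "s i = int (i * (n0 + 1) + n0)" for i :: nat
  have s_Suc: "s (Suc i) = s i + int n0 + 1" for i
    by (simp add: s_def)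
  have s_mono: "s i \<le> s j" if "i \<le> j" for i j
    using that unfolding s_def by (intro of_nat_mono add_right_mono mult_right_mono) auto
  have "(P (s i) - P (s (Suc i))) \<inter> (P (s j) - P (s (Suc j))) = {}" if "i < j" for i j
    using block_disjoint[of "s (Suc i)" "s j"] s_mono[of "Suc i" j] that by auto
  then have disj: "(P (s i) - P (s (Suc i))) \<inter> (P (s j) - P (s (Suc j))) = {}" if "i \<noteq> j" for i j
    using that by (metis Int_commute linorder_neqE_nat)
  obtain i where i: "i \<in> {..k}" "\<forall>e \<in> D q. \<not> e \<subseteq> P (s i) - P (s (Suc i))"
    using missed_set[OF _ qD, of "{..k}" "\<lambda>i. P (s i) - P (s (Suc i))"] q(2) disj by auto
  have bound: "s (Suc i) \<le> int ((k + 2) * (n0 + 1))"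
  proof -
    have "Suc i * (n0 + 1) + n0 \<le> (k + 2) * (n0 + 1)"
      using i(1) mult_right_mono[of "Suc i + 1" "k + 2" "n0 + 1"] by (simp add: algebra_simps)
    then show ?thesis unfolding s_def by linarith
  qed
  have "s i \<ge> 0" "s (Suc i) \<ge> 0"
    by (simp_all add: s_def)
  then have qQ: "q \<inter> Q (s i) = {}" "q \<inter> Q (s (Suc i)) = {}"
    using L bound s_mono[of i "Suc i"] by auto
  have gap: "(P (s i) - P (s (Suc i))) \<inter> q = {}"
    using block_missed[OF qQ i(2)] .
  define n where "n = s i"
  have n: "n \<ge> int n0" by (simp add: n_def s_def)
  define f where "f = q \<inter> P n"
  have fcut: "f \<in> Cuts"
    using cut_Int qcut cut_P by (simp add: f_def)
  have f_deep: "f \<subseteq> P (n + int n0)"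
  proof -
    have "f \<subseteq> P (s (Suc i))"
      using gap by (auto simp: f_def n_def)
    then show ?thesis
      using P_mono[of "n + int n0" "s (Suc i)"] s_Suc[of i] by (auto simp: n_def)
  qed
  have f_p: "f \<subseteq> P (int n0)" "f \<subseteq> p"
    using P_mono[of "int n0" n] P_mono[of 0 n] P_0 n by (auto simp: f_def)
  have f_splits: "splits f H"
  proof -
    have "P (max N n) \<subseteq> f"
      using tail P_mono[of N "max N n"] P_mono[of n "max N n"] by (auto simp: f_def)
    then have "infinite (f \<inter> H)"
      using stable_tails(1)[OF HV H(2,3), of "max N n"]
      by (metis Int_commute Int_mono finite_subset order_refl)
    moreover have "(V - p) \<inter> H \<subseteq> (V - f) \<inter> H"
      using f_p by blast
    then have "infinite ((V - f) \<inter> H)"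
      using H(2) finite_subset unfolding splits_def by blast
    ultimately show ?thesis by (simp add: splits_def)
  qed
  have "sim H' H" if H': "H' \<in> \<H>" "splits f H'" for H'
  proof (rule ccontr)
    assume ns: "\<not> sim H' H"
    have inf: "infinite (f \<inter> H')" "infinite ((V - f) \<inter> H')"
      using H'(2) by (auto simp: splits_def)
    have H'V: "H' \<subseteq> V" using H' H_subset by blast
    have "\<not> splits p H'"
    proof
      assume "splits p H'"
      then have "finite (H' \<inter> P (int n0))"
        using n0[OF H'(1) _ ns] by simp
      moreover have "f \<inter> H' \<subseteq> H' \<inter> P (int n0)"
        using f_p by blast
      ultimately show False
        using inf(1) finite_subset by blast
    qed
    then have nq: "\<not> splits q H'"
      using not_splits_sym_diff[of p H' b] b H'(1) p(2) elliptic_subset[OF b] q(1)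
      by (simp add: elliptic_iff)
    \<comment> \<open>\<open>q\<close> meets \<open>H'\<close> in an infinite set without splitting
      it, so almost all of \<open>H'\<close> lies in \<open>q\<close>; the infinite part that
      \<open>f\<close> omits is therefore cut away by \<open>P n\<close>.\<close>
    have "f \<inter> H' \<subseteq> q \<inter> H'"
      by (auto simp: f_def)
    then have "finite ((V - q) \<inter> H')"
      using inf(1) nq finite_subset unfolding splits_def by blast
    moreover have "(V - f) \<inter> H' \<subseteq> ((V - q) \<inter> H') \<union> ((V - P n) \<inter> H')"
      by (auto simp: f_def)
    ultimately have i1: "infinite ((V - P n) \<inter> H')"
      using inf(2) by (meson finite_Un finite_subset)
    have "f \<inter> H' \<subseteq> P (n + int n0) \<inter> H'"
      using f_deep by blast
    then have i2: "infinite (P (n + int n0) \<inter> H')"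
      using inf(1) finite_subset by blast
    define h where "h = g [^] (- n)"
    have h: "h \<in> carrier G" using g by (simp add: h_def)
    have hP: "act h (P j) = P (j - n)" for j
      by (simp add: h_def act_tr g p)
    have "act h ((V - P n) \<inter> H') = (V - p) \<inter> act h H'"
      using act_Int[OF h _ H'V] act_compl[OF h P_subset] hP P_0 by simp
    then have j1: "infinite ((V - p) \<inter> act h H')"
      using i1 finite_act_iff[OF h, of "(V - P n) \<inter> H'"] by (metis Diff_subset le_infI1)
    have "act h (P (n + int n0) \<inter> H') = P (int n0) \<inter> act h H'"
      using act_Int[OF h P_subset H'V] hP by simp
    then have j2: "infinite (P (int n0) \<inter> act h H')"
      using i2 finite_act_iff[OF h, of "P (n + int n0) \<inter> H'"] P_subset by (metis le_infI1)
    have "P (int n0) \<inter> act h H' \<subseteq> p \<inter> act h H'"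
      using P_mono[of 0 "int n0"] P_0 by auto
    then have "splits p (act h H')"
      using j1 j2 finite_subset unfolding splits_def by blast
    then have "sim (act h H') H"
      using n0[OF H_act[OF h H'(1)]] j2 by (auto simp: Int_commute)
    then have "sim (act (inv h) (act h H')) (act (inv h) H)"
      using h HV H'V act_subset_V by (intro sim_act) auto
    moreover have "act (inv h) H = H"
      using act_pow_fixed[OF g(1) HV H(3), of n] g by (simp add: h_def int_pow_neg)
    ultimately show False
      using ns h H'V by simp
  qed
  moreover have "splits f H'" if "sim H' H" for H'
    using sim_splits[OF that fcut] f_splits by simp
  ultimately show ?thesis
    using fcut by blast
qed

end

section \<open>Atoms\<close>

context peripheral_graph
begin

section \<open>Finitely many classes split by one cut\<close>

lemma cut_blob:
  assumes p: "p \<in> Cuts" "p \<noteq> {}"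
  shows "\<exists>K. blob K \<and> \<Union>(D p) \<subseteq> K"
proof -
  obtain v where v: "v \<in> V" using p cut_subset by blast
  have fin: "finite (\<Union>(D p))"
    using p cuts_iff by (intro finite_Union_D) blast
  then obtain s where "\<Union>(D p) \<subseteq> ball s v"
    using finite_in_ball[OF fin Union_D_subset v] by (elim exE) (rule that)
  then show ?thesis
    using blob_ball[OF v] by (intro exI[of _ "ball s v"]) simp
qed

text \<open>For inequivalent \<open>H\<close> split by \<open>p\<close> the ends of the axes have disjoint neighbourhoods.
  A cut completing \<open>p\<close> to an elliptic one has an edge in each of them.\<close>

lemma split_classes_card:
  assumes far: "far k p" and p: "p \<in> Cuts"
    and R: "finite R" "\<And>H. H \<in> R \<Longrightarrow> H \<in> \<H> \<and> splits p H"
      "\<And>H H'. H \<in> R \<Longrightarrow> H' \<in> R \<Longrightarrow> sim H H' \<Longrightarrow> H = H'"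
  shows "card R \<le> k"
proof (rule ccontr)
  assume big: "\<not> card R \<le> k"
  have pV: "p \<subseteq> V" using p cut_subset by blast
  have "R \<noteq> {}" using big by auto
  then obtain H0 where "H0 \<in> R" by blast
  then have "p \<noteq> {}" using R(2) by (auto simp: splits_def)
  then obtain K where K: "blob K" "\<Union>(D p) \<subseteq> K"
    using cut_blob[OF p] by blast
  have "\<forall>H \<in> R. \<exists>g. axis p K g \<and> act g H = H"
    using axis_exists[OF _ p _ K] R(2) by simp
  then obtain g where g: "\<And>H. H \<in> R \<Longrightarrow> axis p K (g H) \<and> act (g H) H = H"
    by metis
  have ctx: "axis_ctx \<Gamma> G \<phi> \<H> p K (g H)" if "H \<in> R" for H
    using g[OF that] by unfold_locales blast
  \<comment> \<open>Both tails are taken together: if no edge of the correction lies in them, the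
    completed cut keeps the values of \<open>p\<close> at both ends and still splits
    \<open>H\<close>.\<close>
  define T where "T H n = tr p (g H) n \<union> (V - tr p (g H) (- n))" for H n
  have T_mono: "T H n \<subseteq> T H m" if "H \<in> R" "m \<le> n" for H m n
    using axis_ctx.P_mono[OF ctx[OF that(1)], of m n] axis_ctx.P_mono[OF ctx[OF that(1)], of "- n" "- m"] that(2)
    unfolding T_def by auto
  have T_cut: "T H n \<in> Cuts" if "H \<in> R" for H n
    unfolding T_def using axis_ctx.cut_P[OF ctx[OF that]] by (intro cut_Un cut_compl)
  have "\<exists>N. \<forall>n \<ge> N. T H n \<inter> T H' n = {}" if HH': "H \<in> R" "H' \<in> R" "H \<noteq> H'" for H H'
  proof -
    interpret a: axis_ctx \<Gamma> G \<phi> \<H> p K "g H" using ctx HH' by blast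
    interpret a': axis_ctx \<Gamma> G \<phi> \<H> p K "g H'" using ctx HH' by blast
    have "a.axial H" using a.stable_axial[OF far] R(2) g HH'(1) by blast
    then have "\<not> a.axial H'"
      using a.axial_sim[of H H'] R(2,3) HH' H_subset by blast
    then obtain n where n: "n \<ge> 0" "finite (H' \<inter> T H n)"
      using a.share[OF far, of H'] R(2) HH'(2) unfolding T_def by blast
    \<comment> \<open>The two axes are treated in turn: \<open>T H n\<close> is a cut meeting
      \<open>H'\<close> in a finite set, so it cannot contain a tail of the axis of
      \<open>H'\<close>, and deep tails avoid it.\<close>
    obtain N where N: "\<And>m. m \<ge> N \<Longrightarrow> T H' m \<inter> T H n = {}"
      using a'.tail_avoids[of H' "T H n"] R(2)[OF HH'(2)] g[OF HH'(2)] T_cut[OF HH'(1)] n H_subset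
      unfolding T_def by blast
    have "T H m \<inter> T H' m = {}" if m: "m \<ge> max N n" for m
      using N[of m] T_mono[OF HH'(1), of n m] m by auto
    then show ?thesis by blast
  qed
  then have "\<forall>x \<in> R \<times> R. \<exists>N. fst x \<noteq> snd x \<longrightarrow> (\<forall>n \<ge> N. T (fst x) n \<inter> T (snd x) n = {})"
    by auto
  then obtain N where N: "\<And>x. x \<in> R \<times> R \<Longrightarrow> fst x \<noteq> snd x \<longrightarrow> (\<forall>n \<ge> N x. T (fst x) n \<inter> T (snd x) n = {})"
    by metis
  define n where "n = Max (insert (0::int) (N ` (R \<times> R)))"
  have n: "n \<ge> 0" "\<And>x. x \<in> R \<times> R \<Longrightarrow> N x \<le> n"
    unfolding n_def using R(1) by (auto intro!: Max_ge)
  have disj: "T H n \<inter> T H' n = {}" if "H \<in> R" "H' \<in> R" "H \<noteq> H'" for H H'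
    using N[of "(H, H')"] n(2)[of "(H, H')"] that by auto
  define L where "L = (\<Union>H \<in> R. tr K (g H) n \<union> tr K (g H) (- n))"
  have "finite L" "L \<subseteq> V"
    unfolding L_def using R(1) axis_ctx.Q_finite[OF ctx] axis_ctx.Q_subset[OF ctx]
    by (simp, intro UN_least Un_least)
  then obtain b where b: "b \<in> Ell" "card (D (sym_diff p b)) \<le> k" "sym_diff p b \<inter> L = {}"
    using far unfolding far_def by blast
  define q where "q = sym_diff p b"
  have q: "finite (D q)" "card (D q) \<le> k" "q \<inter> L = {}"
    using b cut_sym_diff[OF p elliptic_cut[OF b(1)]] by (auto simp: q_def cuts_iff)
  obtain H where H: "H \<in> R" "\<forall>e \<in> D q. \<not> e \<subseteq> T H n"
    using missed_set[OF R(1) q(1), of "\<lambda>H. T H n"] q(2) disj big by auto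
  interpret a: axis_ctx \<Gamma> G \<phi> \<H> p K "g H" using ctx H by blast
  have HV: "H \<subseteq> V" using R(2) H(1) H_subset by blast
  have tails: "infinite (H \<inter> a.P n)" "infinite (H \<inter> (V - a.P (- n)))"
    using a.stable_tails[OF HV] R(2)[OF H(1)] g[OF H(1)] by simp_all
  have qQ: "q \<inter> a.Q n = {}" "q \<inter> a.Q (- n) = {}"
    using q(3) H(1) by (auto simp: L_def)
  have "a.P n \<inter> q = {}"
    by (rule const_on'[OF a.P_subset a.D_P])
      (use qQ H(2) a.Q_subset[of n] a.Q_nonempty[of n] in \<open>auto simp: T_def\<close>)
  moreover have "a.P n \<subseteq> p"
    using a.P_mono[of 0 n] a.P_0 n by auto
  ultimately have "a.P n \<subseteq> b"
    by (auto simp: q_def)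
  then have i1: "infinite (b \<inter> H)"
    using tails(1) by (metis Int_commute Int_mono finite_subset order_refl)
  have "(V - a.P (- n)) \<inter> q = {}"
    by (rule const_on'[of _ "a.Q (- n)"])
      (use qQ H(2) a.Q_subset[of "- n"] a.Q_nonempty[of "- n"] a.D_P[of "- n"] in \<open>auto simp: T_def\<close>)
  moreover have "p \<subseteq> a.P (- n)"
    using a.P_mono[of "- n" 0] a.P_0 n by auto
  ultimately have "(V - a.P (- n)) \<inter> b = {}"
    by (auto simp: q_def)
  then have "H \<inter> (V - a.P (- n)) \<subseteq> (V - b) \<inter> H"
    by blast
  then have "infinite ((V - b) \<inter> H)"
    using tails(2) finite_subset by blast
  with i1 have "splits b H" by (simp add: splits_def)
  then show False
    using b(1) R(2) H(1) by (simp add: elliptic_iff)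
qed

lemma split_classes:
  assumes far: "far k p" and p: "p \<in> Cuts"
  shows "\<exists>R. finite R \<and> (\<forall>H \<in> R. H \<in> \<H> \<and> splits p H) \<and>
    (\<forall>H \<in> R. \<forall>H' \<in> R. sim H H' \<longrightarrow> H = H') \<and>
    (\<forall>H \<in> \<H>. splits p H \<longrightarrow> (\<exists>H' \<in> R. sim H H'))"
proof -
  define ok where "ok R \<longleftrightarrow> finite R \<and> (\<forall>H \<in> R. H \<in> \<H> \<and> splits p H) \<and>
    (\<forall>H \<in> R. \<forall>H' \<in> R. sim H H' \<longrightarrow> H = H')" for R
  have bound: "card R \<le> k" if "ok R" for R
    using split_classes_card[OF far p, of R] that unfolding ok_def by blast
  have "ok {}" by (simp add: ok_def)
  then obtain R where R: "ok R" "\<And>S. ok S \<Longrightarrow> card S \<le> card R"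
    using ex_has_greatest_nat[of ok "{}" card "Suc k"] bound by (auto simp: less_Suc_eq_le)
  have "\<exists>H' \<in> R. sim H H'" if H: "H \<in> \<H>" "splits p H" for H
  proof (rule ccontr)
    assume neg: "\<not> ?thesis"
    then have "H \<notin> R" by auto
    have "ok (insert H R)"
      using R(1) H neg sim_sym unfolding ok_def by (metis finite.insertI insert_iff)
    then have "card (insert H R) \<le> card R" by (rule R(2))
    then show False
      using \<open>H \<notin> R\<close> R(1) by (simp add: ok_def)
  qed
  then show ?thesis
    using R(1) by (intro exI[of _ R]) (simp add: ok_def)
qed

text \<open>The elliptic \<open>b\<close> does not split \<open>H\<close>, so
  \<open>q = p + b\<close> does and has different values at the two ends of the axis. It contains
  one of the tails, which \<open>atom_pos\<close>, for the axis or its reverse, turns into an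
  atom.\<close>

lemma atom_exists:
  assumes far: "far k p" and p: "p \<in> Cuts" and H: "H \<in> \<H>" "splits p H"
  shows "two_ended H \<and> (\<exists>f \<in> Cuts. \<forall>H' \<in> \<H>. splits f H' \<longleftrightarrow> sim H' H)"
proof -
  have "p \<noteq> {}" using H by (auto simp: splits_def)
  then obtain K g where Kg: "axis p K g" "act g H = H"
    using cut_blob[OF p] axis_exists[OF H(1) p H(2)] by metis
  interpret a: axis_ctx \<Gamma> G \<phi> \<H> p K g by unfold_locales (rule Kg(1))
  interpret r: axis_ctx \<Gamma> G \<phi> \<H> "V - p" K "inv g" by (rule a.rev)
  have pV: "p \<subseteq> V" and HV: "H \<subseteq> V" using p cut_subset H H_subset by auto
  have axH: "a.axial H" by (rule a.stable_axial[OF far H Kg(2)])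
  obtain R where R: "finite R" "\<forall>H \<in> R. H \<in> \<H> \<and> splits p H"
    "\<forall>H \<in> \<H>. splits p H \<longrightarrow> (\<exists>H' \<in> R. sim H H')"
    using split_classes[OF far p] by blast
  have "\<exists>N. \<forall>n \<ge> N. finite (H' \<inter> (a.P n \<union> (V - a.P (- n))))"
    if "H' \<in> R" "\<not> sim H' H" for H'
    using a.share[OF far, of H'] a.axial_sim[of H' H] axH HV that R(2) H_subset by blast
  then have "\<forall>H' \<in> R. \<exists>N. \<not> sim H' H \<longrightarrow> (\<forall>n \<ge> N. finite (H' \<inter> (a.P n \<union> (V - a.P (- n)))))"
    by blast
  then obtain N where N: "\<And>H'. H' \<in> R \<Longrightarrow> \<not> sim H' H \<longrightarrow> (\<forall>n \<ge> N H'. finite (H' \<inter> (a.P n \<union> (V - a.P (- n)))))"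
    by metis
  define n0 where "n0 = nat (Max (insert 0 (N ` R)))"
  have n0: "N H' \<le> int n0" if "H' \<in> R" for H'
    unfolding n0_def using R(1) that Max_ge[of "insert 0 (N ` R)" "N H'"] by auto
  \<comment> \<open>\<open>sim\<close> only preserves being split. So finiteness for the
    representative is read as not being split by the tail cut and transferred in this form; the side
    of the tail cut that is infinite is known because \<open>p\<close> splits
    \<open>H'\<close>.\<close>
  have deep: "finite (H' \<inter> a.P (int n0))" "finite (H' \<inter> (V - a.P (- int n0)))"
    if H': "H' \<in> \<H>" "splits p H'" "\<not> sim H' H" for H'
  proof -
    obtain S where S: "S \<in> R" "sim H' S"
      using R(3) H' by blast
    have "\<not> sim S H" using S(2) H'(3) sim_trans by blast
    then have fS: "finite (S \<inter> (a.P (int n0) \<union> (V - a.P (- int n0))))"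
      using N[OF S(1)] n0[OF S(1)] by blast
    have "finite (S \<inter> a.P (int n0))"
      by (rule finite_subset[OF _ fS]) blast
    then have "\<not> splits (a.P (int n0)) S"
      by (simp add: splits_def Int_commute)
    then have 1: "\<not> splits (a.P (int n0)) H'"
      using sim_splits[OF S(2) a.cut_P] by simp
    have "(V - p) \<inter> H' \<subseteq> (V - a.P (int n0)) \<inter> H'"
      using a.P_mono[of 0 "int n0"] a.P_0 by auto
    then have "infinite ((V - a.P (int n0)) \<inter> H')"
      using H'(2) finite_subset unfolding splits_def by blast
    then show "finite (H' \<inter> a.P (int n0))"
      using 1 by (simp add: splits_def Int_commute)
    have "finite (S \<inter> (V - a.P (- int n0)))"
      by (rule finite_subset[OF _ fS]) blast
    then have "\<not> splits (a.P (- int n0)) S"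
      by (simp add: splits_def Int_commute)
    then have 2: "\<not> splits (a.P (- int n0)) H'"
      using sim_splits[OF S(2) a.cut_P] by simp
    have "p \<inter> H' \<subseteq> a.P (- int n0) \<inter> H'"
      using a.P_mono[of "- int n0" 0] a.P_0 by auto
    then have "infinite (a.P (- int n0) \<inter> H')"
      using H'(2) finite_subset unfolding splits_def by blast
    then show "finite (H' \<inter> (V - a.P (- int n0)))"
      using 2 by (simp add: splits_def Int_commute)
  qed
  define m where "m = int ((k + 2) * (n0 + 1))"
  define L where "L = (\<Union>n \<in> {- m..m}. a.Q n)"
  have "finite L" "L \<subseteq> V"
    unfolding L_def using a.Q_finite a.Q_subset by auto
  then obtain b where b: "b \<in> Ell" "card (D (sym_diff p b)) \<le> k" "sym_diff p b \<inter> L = {}"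
    using far unfolding far_def by blast
  define q where "q = sym_diff p b"
  have bV: "b \<subseteq> V" using b elliptic_subset by blast
  have qcut: "q \<in> Cuts"
    using cut_sym_diff[OF p elliptic_cut[OF b(1)]] by (simp add: q_def)
  have qQ: "q \<inter> a.Q n = {}" if "- m \<le> n" "n \<le> m" for n
  proof -
    have "a.Q n \<subseteq> L"
      using that by (auto simp: L_def)
    then show ?thesis
      using b(3) unfolding q_def by blast
  qed
  have "splits q H"
    unfolding q_def using splits_cong_sym_diff[of b H p] b(1) H pV bV by (simp add: elliptic_iff)
  moreover obtain M where M: "M \<ge> 0" "a.P M \<subseteq> q \<or> a.P M \<inter> q = {}" "V - a.P (- M) \<subseteq> q \<or> (V - a.P (- M)) \<inter> q = {}"
    using a.tail_const[OF qcut] by blast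
  ultimately have "a.P M \<subseteq> q \<or> V - a.P (- M) \<subseteq> q"
    using a.splits_axial[OF axH HV M] by blast
  then have "\<exists>f \<in> Cuts. \<forall>H' \<in> \<H>. splits f H' \<longleftrightarrow> sim H' H"
  proof
    assume t: "a.P M \<subseteq> q"
    show ?thesis
    proof (rule a.atom_pos[OF far H Kg(2) deep(1) b(1) q_def _ _ t])
      show "card (D q) \<le> k" using b(2) by (simp add: q_def)
    qed (use qQ m_def in auto)
  next
    assume t: "V - a.P (- M) \<subseteq> q"
    have q': "q = sym_diff (V - p) (V - b)"
      unfolding q_def using sym_diff_compl[OF pV bV] by simp
    have g: "g \<in> carrier G" by (rule a.g)
    have "act (inv g) H = H"
      using Kg(2) act_inv(1)[OF g HV] by simp
    moreover have "tr (V - p) (inv g) M \<subseteq> q"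
      using t by (simp add: tr_compl_inv g pV)
    moreover have "finite (H' \<inter> tr (V - p) (inv g) (int n0))"
      if "H' \<in> \<H>" "splits (V - p) H'" "\<not> sim H' H" for H'
      using deep(2) that by (simp add: tr_compl_inv g pV splits_compl)
    moreover have "q \<inter> tr K (inv g) n = {}" if "0 \<le> n" "n \<le> int ((k + 2) * (n0 + 1))" for n
      using qQ[of "- n"] that by (simp add: tr_inv g m_def)
    moreover have "card (D q) \<le> k" using b(2) by (simp add: q_def)
    moreover have "splits (V - p) H" using H pV by (simp add: splits_compl)
    ultimately show ?thesis
      using r.atom_pos[OF far_compl[OF far pV] H(1) _ _ _ elliptic_compl[OF b(1)] q'] by blast
  qed
  then show ?thesis
    using a.axial_two_ended[OF axH HV] by blast
qed

text \<open>Two-endedness of the class is what makes the sum of two of its atoms elliptic.\<close>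

definition atom :: "'v set \<Rightarrow> bool" where
  "atom f \<longleftrightarrow> f \<in> Cuts \<and> (\<exists>H \<in> \<H>. two_ended H \<and> (\<forall>H' \<in> \<H>. splits f H' \<longleftrightarrow> sim H' H))"

text \<open>One atom for each class split by \<open>p\<close> gives a sum splitting exactly the same
  peripheral sets as \<open>p\<close>; these are two-ended, so adding it to \<open>p\<close> leaves
  none split.\<close>

lemma far_atoms:
  assumes far: "far k p" and p: "p \<in> Cuts"
  shows "\<exists>M. (\<forall>f \<in># M. atom f) \<and> sym_diff p (msum M) \<in> Ell"
proof -
  obtain R where R: "finite R" "\<And>H. H \<in> R \<Longrightarrow> H \<in> \<H> \<and> splits p H"
    "\<And>H H'. H \<in> R \<Longrightarrow> H' \<in> R \<Longrightarrow> sim H H' \<Longrightarrow> H = H'"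
    "\<And>H. H \<in> \<H> \<Longrightarrow> splits p H \<Longrightarrow> \<exists>H' \<in> R. sim H H'"
    using split_classes[OF far p] by metis
  have pV: "p \<subseteq> V" using p cut_subset by blast
  have ex: "\<forall>H \<in> R. \<exists>f \<in> Cuts. \<forall>H' \<in> \<H>. splits f H' \<longleftrightarrow> sim H' H"
    using atom_exists[OF far p] R(2) by blast
  then obtain f where f: "\<And>H. H \<in> R \<Longrightarrow> f H \<in> Cuts"
    "\<And>H H'. H \<in> R \<Longrightarrow> H' \<in> \<H> \<Longrightarrow> splits (f H) H' \<longleftrightarrow> sim H' H"
    by metis
  have te: "two_ended H" if "H \<in> \<H>" "splits p H" for H
    using atom_exists[OF far p that] by blast
  define F where "F S = msum (image_mset f (mset_set S))" for S
  have F: "F S \<in> Cuts \<and> (splits (F S) H' \<longleftrightarrow> (\<exists>H \<in> S. sim H' H))"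
    if "finite S" "S \<subseteq> R" "H' \<in> \<H>" for S H'
    using that(1,2)
  proof (induction S)
    case empty
    then show ?case by (simp add: F_def splits_def)
  next
    case (insert H S)
    then have IH: "F S \<in> Cuts" "splits (F S) H' \<longleftrightarrow> (\<exists>H \<in> S. sim H' H)" and HR: "H \<in> R" "S \<subseteq> R"
      by auto
    have FS: "F (insert H S) = sym_diff (f H) (F S)"
      using insert by (simp add: F_def)
    have V: "f H \<subseteq> V" "F S \<subseteq> V"
      using f(1)[OF HR(1)] IH(1) cut_subset by auto
    have "splits (sym_diff (f H) (F S)) H' \<longleftrightarrow> (\<exists>J \<in> insert H S. sim H' J)"
    proof (cases "sim H' H")
      case True
      have "\<not> (\<exists>J \<in> S. sim H' J)"
      proof
        assume "\<exists>J \<in> S. sim H' J"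
        then obtain J where J: "J \<in> S" "sim H' J" by blast
        then have "sim H J" using True sim_sym sim_trans by blast
        then have "H = J" using R(3) HR J(1) by blast
        then show False using J(1) insert.hyps by simp
      qed
      then have "\<not> splits (F S) H'" using IH(2) by simp
      then show ?thesis
        using splits_cong_sym_diff[OF _ V] f(2)[OF HR(1) that(3)] True by simp
    next
      case False
      then have "\<not> splits (f H) H'" using f(2)[OF HR(1) that(3)] by simp
      then have "splits (sym_diff (F S) (f H)) H' \<longleftrightarrow> splits (F S) H'"
        by (rule splits_cong_sym_diff[OF _ V(2,1)])
      then show ?thesis
        using IH(2) False by (simp add: Un_commute)
    qed
    then show ?case
      unfolding FS using cut_sym_diff f(1)[OF HR(1)] IH(1) by blast
  qed
  have FR: "F R \<in> Cuts"
    using F[OF R(1) order_refl] f(1) by (auto simp: F_def intro!: cut_msum) (use R(1) in auto)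
  have "\<not> splits (sym_diff p (F R)) H'" if H': "H' \<in> \<H>" for H'
  proof (cases "splits p H'")
    case True
    then have "splits (F R) H'"
      using F[OF R(1) order_refl H'] R(4)[OF H'] by simp
    then show ?thesis
      using te[OF H' True] True p FR unfolding two_ended_def by blast
  next
    case False
    have "\<not> (\<exists>H \<in> R. sim H' H)"
      using False sim_splits[OF _ p] R(2) by blast
    then have "\<not> splits (F R) H'"
      using F[OF R(1) order_refl H'] by simp
    then show ?thesis
      using not_splits_sym_diff[OF False _ pV cut_subset[OF FR]] by simp
  qed
  then have "sym_diff p (F R) \<in> Ell"
    using cut_sym_diff[OF p FR] by (simp add: elliptic_iff)
  moreover have "atom (f H)" if "H \<in> R" for H
    using f[OF that] te R(2)[OF that] that unfolding atom_def by blast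
  ultimately show ?thesis
    unfolding F_def using R(1) by (intro exI[of _ "image_mset f (mset_set R)"]) auto
qed

end

section \<open>Generation by cuts of bounded diameter\<close>

context peripheral_graph
begin

definition small :: "nat \<Rightarrow> 'v set \<Rightarrow> bool" where
  "small r b \<longleftrightarrow> (\<exists>v \<in> V. \<Union>(D b) \<subseteq> ball r v)"

text \<open>Being defined by diameter, \<open>W n\<close> is invariant under the action, and it
  grows with \<open>n\<close>; finding generators means finding one \<open>n\<close> that serves all
  cuts in question.\<close>

definition W :: "nat \<Rightarrow> 'v set set" where
  "W n = sdspan {b \<in> Ell. small n b}"

lemma small_mono: "small r b \<Longrightarrow> r \<le> s \<Longrightarrow> small s b"
  unfolding small_def using ball_mono by (meson order_trans)

lemma small_act: "g \<in> carrier G \<Longrightarrow> b \<subseteq> V \<Longrightarrow> small r b \<Longrightarrow> small r (act g b)"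
  unfolding small_def by (metis act_ball act_in_V Union_D_act image_mono)

lemma Union_D_sym_diff: "\<Union>(D b) \<subseteq> X \<Longrightarrow> \<Union>(D c) \<subseteq> X \<Longrightarrow> \<Union>(D (sym_diff b c)) \<subseteq> X"
  unfolding D_sym_diff by blast

lemma small_cut:
  assumes "b \<subseteq> V" "small r b"
  shows "b \<in> Cuts"
proof -
  obtain v where v: "v \<in> V" "\<Union>(D b) \<subseteq> ball r v"
    using assms(2) by (auto simp: small_def)
  then have "D b \<subseteq> {e \<in> E. e \<subseteq> ball r v}"
    using D_subset by blast
  then show ?thesis
    using finite_edges_in finite_ball assms(1) finite_subset cuts_iff by metis
qed

lemma cut_in_ball: "b \<in> Cuts \<Longrightarrow> v \<in> V \<Longrightarrow> \<exists>r. \<Union>(D b) \<subseteq> ball r v"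
  using finite_in_ball finite_Union_D Union_D_subset cuts_iff by metis

lemma cut_small: "b \<in> Cuts \<Longrightarrow> V \<noteq> {} \<Longrightarrow> \<exists>r. small r b"
  unfolding small_def using cut_in_ball by blast

lemma cuts_small:
  assumes "finite S" "S \<subseteq> Cuts" "V \<noteq> {}"
  shows "\<exists>r. \<forall>b \<in> S. small r b"
proof -
  have "\<forall>b \<in> S. \<exists>r. small r b"
    using cut_small assms by blast
  then obtain r where r: "\<And>b. b \<in> S \<Longrightarrow> small (r b) b" by metis
  have "small (Max (insert 0 (r ` S))) b" if "b \<in> S" for b
    using r[OF that] assms(1) that by (intro small_mono[OF r[OF that]] Max_ge) auto
  then show ?thesis by blast
qed

text \<open>The centre is kept with the cut because both have to be moved by the same group element.
  Every cut with coboundary in an \<open>r\<close>-ball is a translate from this finite set, which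
  turns separate bounds into a uniform one.\<close>

definition small_at :: "nat \<Rightarrow> ('v set \<times> 'v) set" where
  "small_at r = {(b, v). v \<in> reps \<and> b \<subseteq> V \<and> \<Union>(D b) \<subseteq> ball r v}"

lemma finite_small_at: "finite (small_at r)"
proof -
  have "finite {b. b \<subseteq> V \<and> \<Union>(D b) \<subseteq> ball r v}" for v
  proof (rule finite_subset)
    show "{b. b \<subseteq> V \<and> \<Union>(D b) \<subseteq> ball r v} \<subseteq> {b. b \<subseteq> V \<and> D b \<subseteq> {e \<in> E. e \<subseteq> ball r v}}"
      using D_subset by blast
    show "finite {b. b \<subseteq> V \<and> D b \<subseteq> {e \<in> E. e \<subseteq> ball r v}}"
      by (intro finite_cuts_coboundary_in finite_edges_in finite_ball)
  qed
  moreover have "small_at r = (\<lambda>(v, b). (b, v)) ` (SIGMA v:reps. {b. b \<subseteq> V \<and> \<Union>(D b) \<subseteq> ball r v})"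
    by (auto simp: small_at_def)
  ultimately show ?thesis
    using reps(1) by simp
qed

lemma small_at_cut: "(b, v) \<in> small_at r \<Longrightarrow> b \<in> Cuts \<and> small r b \<and> v \<in> V"
  using small_cut reps(2) unfolding small_at_def small_def by blast

lemma to_small_at:
  assumes b: "b \<subseteq> V" and v: "v \<in> V" "\<Union>(D b) \<subseteq> ball r v"
  shows "\<exists>g \<in> carrier G. \<exists>c u. (c, u) \<in> small_at r \<and> b = act g c \<and> v = \<phi> g u \<and> c = act (inv g) b"
proof -
  obtain g u where g: "g \<in> carrier G" "u \<in> reps" "v = \<phi> g u"
    using reps(3) v(1) by blast
  have uV: "u \<in> V" using g reps(2) by blast
  have "\<phi> (inv g) v = u"
    using action.orbit_sym_aux g uV by simp
  then have "act (inv g) (ball r v) = ball r u"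
    using act_ball v(1) g(1) by simp
  then have "\<Union>(D (act (inv g) b)) \<subseteq> ball r u"
    using Union_D_act[of "inv g" b] b g v(2) by (metis image_mono inv_closed)
  then have "(act (inv g) b, u) \<in> small_at r"
    using g b act_subset_V by (simp add: small_at_def)
  moreover have "b = act g (act (inv g) b)"
    using g b by simp
  ultimately show ?thesis
    using g by blast
qed

lemma W_elliptic: "W n \<subseteq> Ell"
proof
  fix a assume "a \<in> W n"
  then show "a \<in> Ell"
    unfolding W_def by (induction rule: sdspan_induct) (auto simp del: Un_iff intro!: elliptic_sym_diff)
qed

lemma W_mono: "m \<le> n \<Longrightarrow> W m \<subseteq> W n"
  unfolding W_def using small_mono by (intro sdspan_mono) blast

lemma W_add: "a \<in> W n \<Longrightarrow> b \<in> W n \<Longrightarrow> sym_diff a b \<in> W n"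
  unfolding W_def by (rule sdspan_add)

lemma W_small: "b \<in> Ell \<Longrightarrow> small n b \<Longrightarrow> b \<in> W n"
  unfolding W_def by (intro sdspan_base) simp

lemma W_act:
  assumes g: "g \<in> carrier G" and a: "a \<in> W n"
  shows "act g a \<in> W n"
  using a unfolding W_def
proof (induction rule: sdspan_induct)
  case empty
  show ?case by simp
next
  case (add x a)
  have "a \<subseteq> V" "x \<subseteq> V"
    using add W_elliptic elliptic_subset unfolding W_def by blast+
  then have "act g (sym_diff x a) = sym_diff (act g x) (act g a)"
    using act_sym_diff g by blast
  moreover have "act g x \<in> {b \<in> Ell. small n b}"
    using add(1) elliptic_act small_act g elliptic_subset by simp
  ultimately show ?case
    using sdspan_add[OF sdspan_base[of "act g x"] add(3)] by simp
qed

lemma act_sym_diff_inv: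
  assumes "g \<in> carrier G" "a \<subseteq> V" "b \<subseteq> V"
  shows "sym_diff (act g a) b = act g (sym_diff a (act (inv g) b))"
  using act_sym_diff[OF assms(1,2), of "act (inv g) b"] assms act_subset_V by simp

section \<open>Cancellation of atoms of one class\<close>

lemma atom_cut: "atom f \<Longrightarrow> f \<in> Cuts"
  by (simp add: atom_def)

lemma atom_act:
  assumes g: "g \<in> carrier G" and f: "atom f"
  shows "atom (act g f)"
proof -
  obtain H where H: "H \<in> \<H>" "two_ended H" "\<And>H'. H' \<in> \<H> \<Longrightarrow> splits f H' \<longleftrightarrow> sim H' H"
    using f by (auto simp: atom_def)
  have fc: "f \<in> Cuts" and fV: "f \<subseteq> V" and HV: "H \<subseteq> V"
    using f atom_cut cut_subset H H_subset by auto
  have spl: "splits c (act g X) \<longleftrightarrow> splits (act (inv g) c) X" if "X \<subseteq> V" "c \<subseteq> V" for X c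
    using splits_act[of g "act (inv g) c" X] g that act_subset_V[of "inv g" c] by simp
  have "two_ended (act g H)"
    unfolding two_ended_def
  proof (intro ballI impI)
    fix c d assume cd: "c \<in> Cuts" "d \<in> Cuts" "splits c (act g H)" "splits d (act g H)"
    have V: "c \<subseteq> V" "d \<subseteq> V" "sym_diff c d \<subseteq> V"
      using cd cut_subset by blast+
    have "\<not> splits (sym_diff (act (inv g) c) (act (inv g) d)) H"
      using H(2) cd cut_act g spl[OF HV] V unfolding two_ended_def by simp
    then show "\<not> splits (sym_diff c d) (act g H)"
      using spl[OF HV V(3)] act_sym_diff[of "inv g" c d] g V by simp
  qed
  moreover have "splits (act g f) H' \<longleftrightarrow> sim H' (act g H)" if H': "H' \<in> \<H>" for H'
  proof -
    have V: "H' \<subseteq> V" "act (inv g) H' \<subseteq> V" "act g H \<subseteq> V"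
      using H' H_subset act_subset_V g HV by auto
    have "splits (act g f) (act g (act (inv g) H')) \<longleftrightarrow> splits f (act (inv g) H')"
      using splits_act g fV V by blast
    also have "\<dots> \<longleftrightarrow> sim (act (inv g) H') H"
      using H(3) H_act H' g by simp
    also have "\<dots> \<longleftrightarrow> sim H' (act g H)"
      using sim_act[OF g V(2) HV] sim_act[of "inv g", OF _ V(1,3)] g V HV by auto
    finally show ?thesis using g V by simp
  qed
  ultimately show ?thesis
    using cut_act[OF g fc] H_act[OF g H(1)] unfolding atom_def by blast
qed

lemma atoms_elliptic:
  assumes f: "atom f" "atom f'" and H: "H \<in> \<H>" "splits f H" "splits f' H"
  shows "sym_diff f f' \<in> Ell"
proof -
  obtain J where J: "two_ended J" "\<And>H'. H' \<in> \<H> \<Longrightarrow> splits f H' \<longleftrightarrow> sim H' J"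
    using f(1) by (auto simp: atom_def)
  obtain J' where J': "\<And>H'. H' \<in> \<H> \<Longrightarrow> splits f' H' \<longleftrightarrow> sim H' J'"
    using f(2) by (auto simp: atom_def)
  have c: "f \<in> Cuts" "f' \<in> Cuts" using f atom_cut by auto
  have JJ': "sim J J'"
    using J(2)[OF H(1)] J'[OF H(1)] H sim_sym sim_trans by blast
  have "\<not> splits (sym_diff f f') H'" if H': "H' \<in> \<H>" for H'
  proof (cases "sim H' J")
    case True
    then have "two_ended H'" "splits f H'" "splits f' H'"
      using two_ended_sim J J' H' JJ' sim_trans by blast+
    then show ?thesis
      using c unfolding two_ended_def by blast
  next
    case False
    then have "\<not> splits f H'" "\<not> splits f' H'"
      using J(2) J' H' JJ' sim_sym sim_trans by blast+
    then show ?thesis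
      using not_splits_sym_diff c cut_subset by blast
  qed
  then show ?thesis
    using cut_sym_diff[OF c] by (simp add: elliptic_iff)
qed

text \<open>An atom \<open>f'\<close> splitting the same \<open>H\<close> as \<open>f\<close> has an edge near the axis of \<open>f\<close>.
  Moving \<open>f\<close> along the axis costs sums of translates of one elliptic cut.\<close>

lemma atom_pair_at:
  assumes f: "atom f"
  shows "\<exists>n. \<forall>f' H. atom f' \<longrightarrow> small s f' \<longrightarrow> H \<in> \<H> \<longrightarrow> splits f H \<longrightarrow> splits f' H \<longrightarrow>
    sym_diff f f' \<in> W n"
proof -
  obtain H0 where H0: "H0 \<in> \<H>" "two_ended H0" "\<And>H'. H' \<in> \<H> \<Longrightarrow> splits f H' \<longleftrightarrow> sim H' H0"
    using f by (auto simp: atom_def)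
  have fc: "f \<in> Cuts" and fV: "f \<subseteq> V" and HV: "H0 \<subseteq> V"
    using f atom_cut cut_subset H0 H_subset by auto
  have fH0: "splits f H0"
    using H0 by simp
  then have "f \<noteq> {}"
    by (auto simp: splits_def)
  then obtain v where v: "v \<in> V" using fV by blast
  obtain r where r: "\<Union>(D f) \<subseteq> ball r v"
    using cut_in_ball[OF fc v] by (elim exE) (rule that)
  obtain g where g: "axis f (ball r v) g" "act g H0 = H0"
    using axis_exists[OF H0(1) fc fH0 blob_ball[OF v] r] by blast
  interpret a: axis_ctx \<Gamma> G \<phi> \<H> f "ball r v" g by unfold_locales (rule g(1))
  note gc = a.g
  have P_atom: "atom (a.P n)" for n
    using atom_act[OF gc(2) f] by (simp add: tr_def)
  have P_splits: "splits (a.P n) H0" for n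
    using splits_act[OF gc(2) fV HV] act_pow_fixed[OF gc(1) HV g(2)] fH0 by (simp add: tr_def)
  have "finite (H0 \<inter> a.A n)" for n
  proof -
    have "\<not> splits (sym_diff (a.P n) (a.P (n + 1))) H0"
      using H0(2) a.cut_P P_splits unfolding two_ended_def by blast
    moreover have "sym_diff (a.P n) (a.P (n + 1)) = a.A n"
      using a.P_Suc[of n] by blast
    moreover have "infinite ((V - a.A n) \<inter> H0)"
    proof -
      have "(V - a.P n) \<inter> H0 \<subseteq> (V - a.A n) \<inter> H0" by blast
      then show ?thesis
        using P_splits[of n] finite_subset unfolding splits_def by blast
    qed
    ultimately show ?thesis
      by (simp add: splits_def Int_commute)
  qed
  then have axial: "a.axial H0"
    using a.stable_tails[OF HV fH0 g(2)] unfolding a.axial_def by blast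
  have gvV: "\<phi> g v \<in> V" using act_in_V gc(1) v by blast
  obtain c where c: "\<phi> g v \<in> ball c v"
    using vertex_in_ball[OF gvV v] by blast
  define x where "x n = \<phi> (g [^] (n::int)) v" for n
  have xV: "x n \<in> V" for n using act_in_V gc v by (simp add: x_def)
  have x_ball: "act (g [^] n) (ball t v) = ball t (x n)" for n t
    using act_ball[OF gc(2) v] by (simp add: x_def)
  have x_Suc: "x (n + 1) \<in> ball c (x n)" for n
  proof -
    have "x (n + 1) = \<phi> (g [^] n) (\<phi> g v)"
      using gc v action.composition_rule by (simp add: x_def int_pow_mult)
    then show ?thesis
      using c x_ball[of n c] by blast
  qed
  have Q_x: "a.Q n = ball r (x n)" for n
    using x_ball[of n r] by (simp add: tr_def)
  define f1 where "f1 = sym_diff f (act g f)"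
  have "splits (act g f) H0"
    using P_splits[of 1] gc by (simp add: tr_def)
  then have f1: "f1 \<in> Ell"
    unfolding f1_def using atoms_elliptic f atom_act[OF gc(1) f] H0(1) fH0 by blast
  have "V \<noteq> {}" using v by blast
  then obtain m1 where m1: "small m1 f1"
    using cut_small elliptic_cut[OF f1] by blast
  have f1W: "act h f1 \<in> W m1" if "h \<in> carrier G" for h
    using W_act[OF that W_small[OF f1 m1]] .
  have pos: "sym_diff f (a.P (int n)) \<in> W m1" for n
  proof (induction n)
    case 0
    then show ?case
      using a.P_0 by (simp add: W_def)
  next
    case (Suc n)
    have "act (g [^] int n) f1 = sym_diff (a.P (int n)) (a.P (int n + 1))"
      using act_sym_diff[OF gc(2) fV act_subset_V[OF gc(1) fV]] tr_Suc[OF gc(1) fV, of "int n"]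
      unfolding f1_def by (simp add: tr_def)
    moreover have "sym_diff f (a.P (int (Suc n))) =
        sym_diff (sym_diff f (a.P (int n))) (sym_diff (a.P (int n)) (a.P (int n + 1)))"
      by (simp add: add.commute) blast
    ultimately show ?case
      using W_add[OF Suc f1W[OF gc(2), of "int n"]] by simp
  qed
  have all: "sym_diff f (a.P n) \<in> W m1" for n
  proof (cases "n \<ge> 0")
    case True
    then show ?thesis using pos[of "nat n"] by simp
  next
    case False
    then have "sym_diff f (a.P (- n)) \<in> W m1"
      using pos[of "nat (- n)"] by simp
    then have "act (g [^] n) (sym_diff f (a.P (- n))) \<in> W m1"
      by (rule W_act[OF gc(2)])
    moreover have "act (g [^] n) (sym_diff f (a.P (- n))) = sym_diff (a.P n) f"
      using act_sym_diff[OF gc(2) fV a.P_subset, of n "- n"] act_tr[OF gc(1) fV, of n "- n"] a.P_0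
      by (simp add: tr_def)
    ultimately show ?thesis by (simp add: Un_commute)
  qed
  \<comment> \<open>Some edge of \<open>f'\<close> lies within \<open>c\<close> of
    \<open>x n\<close>, the coboundary of \<open>f'\<close> has diameter at most
    \<open>2 * s\<close>, and that of \<open>P n\<close> lies within \<open>r\<close> of
    \<open>x n\<close>.\<close>
  have "sym_diff f f' \<in> W (max m1 (c + 2 * s + r))"
    if f': "atom f'" "small s f'" and H: "H \<in> \<H>" "splits f H" "splits f' H" for f' H
  proof -
    have f'c: "f' \<in> Cuts" using f' atom_cut by blast
    have f'H0: "splits f' H0"
      using H0(3)[OF H(1)] H sim_splits f'c by blast
    \<comment> \<open>Consecutive points \<open>x n\<close> lie in a common ball of radius
      \<open>c\<close>. Without an edge of \<open>f'\<close> in these balls all of them would be on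
      one side of \<open>f'\<close>, which would then have equal values at the two ends and not
      split \<open>H0\<close>.\<close>
    have "\<exists>n. \<exists>e \<in> D f'. e \<subseteq> ball c (x n)"
    proof (rule ccontr)
      assume neg: "\<not> ?thesis"
      have "ball c (x n) \<subseteq> f' \<or> ball c (x n) \<inter> f' = {}" for n
        using neg by (intro blob_const[OF blob_ball[OF xV]]) blast
      then have step: "x (n + 1) \<in> f' \<longleftrightarrow> x n \<in> f'" for n
        using x_Suc[of n] ball_center[of "x n" c] by blast
      have const: "x (n + int m) \<in> f' \<longleftrightarrow> x n \<in> f'" for n m
      proof (induction m)
        case (Suc m)
        then show ?case
          using step[of "n + int m"] by (simp add: ac_simps)
      qed simp
      obtain N where N: "N \<ge> 0" "a.P N \<subseteq> f' \<or> a.P N \<inter> f' = {}"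
        "V - a.P (- N) \<subseteq> f' \<or> (V - a.P (- N)) \<inter> f' = {}"
        using a.tail_const[OF f'c] by blast
      have 1: "x (N + 1) \<in> a.P N"
        using a.Q_in[of N "N + 1"] Q_x ball_center by auto
      have 2: "x (- N - 1) \<in> V - a.P (- N)"
        using a.Q_out[of "- N - 1" "- N"] Q_x ball_center[of "x (- N - 1)" r] xV by auto
      have "x (N + 1) \<in> f' \<longleftrightarrow> x (- N - 1) \<in> f'"
        using const[of "- N - 1" "nat (2 * N + 2)"] N(1) by (simp add: algebra_simps)
      then have "a.P N \<subseteq> f' \<longleftrightarrow> V - a.P (- N) \<subseteq> f'"
        using 1 2 N(2,3) by blast
      then show False
        using a.splits_axial[OF axial HV N] f'H0 by simp
    qed
    then obtain n e where e: "e \<in> D f'" "e \<subseteq> ball c (x n)" by blast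
    obtain w where w: "w \<in> V" "\<Union>(D f') \<subseteq> ball s w"
      using f'(2) by (auto simp: small_def)
    obtain y where y: "y \<in> e" using D_edge_nonempty[OF e(1)] by blast
    have "z \<in> ball (c + 2 * s + r) (x n)" if "z \<in> \<Union>(D f')" for z
    proof -
      have "y \<in> ball s w" "y \<in> ball c (x n)" "z \<in> ball s w"
        using y e w(2) that by blast+
      then show ?thesis
        using ball_trans'[of y c "x n" w s "c + s"] ball_trans'[of w "c + s" "x n" z s] ball_sym
        by simp
    qed
    moreover have "\<Union>(D (a.P n)) \<subseteq> ball (c + 2 * s + r) (x n)"
      using a.D_P[of n] Q_x[of n] ball_mono[of r "c + 2 * s + r" "x n"] by auto
    ultimately have "small (c + 2 * s + r) (sym_diff (a.P n) f')"
      unfolding small_def using Union_D_sym_diff xV by (metis subsetI)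
    moreover have "sym_diff (a.P n) f' \<in> Ell"
      using atoms_elliptic[OF P_atom f'(1) H0(1) P_splits f'H0] .
    ultimately have "sym_diff (a.P n) f' \<in> W (c + 2 * s + r)"
      by (intro W_small)
    then have "sym_diff (a.P n) f' \<in> W (max m1 (c + 2 * s + r))"
      using W_mono[of "c + 2 * s + r" "max m1 (c + 2 * s + r)"] by auto
    moreover have "sym_diff f (a.P n) \<in> W (max m1 (c + 2 * s + r))"
      using all[of n] W_mono[of m1 "max m1 (c + 2 * s + r)"] by auto
    moreover have "sym_diff f f' = sym_diff (sym_diff f (a.P n)) (sym_diff (a.P n) f')"
      by blast
    ultimately show ?thesis
      using W_add by metis
  qed
  then show ?thesis by blast
qed

lemma atom_pair:
  "\<exists>n. \<forall>f f' H. atom f \<longrightarrow> small s f \<longrightarrow> atom f' \<longrightarrow> small s f' \<longrightarrow> H \<in> \<H> \<longrightarrow> splits f H \<longrightarrow>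
    splits f' H \<longrightarrow> sym_diff f f' \<in> W n"
proof -
  define F where "F = {f. atom f \<and> f \<in> fst ` small_at s}"
  have "finite F"
    using finite_small_at by (simp add: F_def)
  have "\<forall>f \<in> F. \<exists>n. \<forall>f' H. atom f' \<longrightarrow> small s f' \<longrightarrow> H \<in> \<H> \<longrightarrow> splits f H \<longrightarrow> splits f' H \<longrightarrow>
    sym_diff f f' \<in> W n"
    using atom_pair_at by (simp add: F_def)
  then obtain n where n: "\<And>f f' H. f \<in> F \<Longrightarrow> atom f' \<Longrightarrow> small s f' \<Longrightarrow> H \<in> \<H> \<Longrightarrow> splits f H \<Longrightarrow>
    splits f' H \<Longrightarrow> sym_diff f f' \<in> W (n f)"
    by metis
  define N where "N = Max (insert 0 (n ` F))"
  have "sym_diff f f' \<in> W N"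
    if f: "atom f" "small s f" "atom f'" "small s f'" and H: "H \<in> \<H>" "splits f H" "splits f' H" for f f' H
  proof -
    have V: "f \<subseteq> V" "f' \<subseteq> V" "H \<subseteq> V"
      using f H atom_cut cut_subset H_subset by auto
    obtain v where v: "v \<in> V" "\<Union>(D f) \<subseteq> ball s v"
      using f(2) by (auto simp: small_def)
    obtain g c u where g: "g \<in> carrier G" "(c, u) \<in> small_at s" "f = act g c" "c = act (inv g) f"
      using to_small_at[OF V(1) v] by blast
    have gi: "inv g \<in> carrier G" using g(1) by simp
    have "atom c"
      using atom_act[OF gi f(1)] g(4) by simp
    then have "c \<in> F"
      using g(2) by (force simp: F_def)
    moreover have "splits c (act (inv g) H)" "splits (act (inv g) f') (act (inv g) H)"
      using splits_act[OF gi] V H g(4) by simp_all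
    ultimately have "sym_diff c (act (inv g) f') \<in> W (n c)"
      using n[OF _ atom_act[OF gi f(3)] small_act[OF gi V(2) f(4)] H_act[OF gi H(1)]] by blast
    moreover have "n c \<le> N"
      unfolding N_def using \<open>finite F\<close> \<open>c \<in> F\<close> by (intro Max_ge) auto
    ultimately have "act g (sym_diff c (act (inv g) f')) \<in> W N"
      using W_act[OF g(1)] W_mono by blast
    moreover have "c \<subseteq> V" using small_at_cut[OF g(2)] cut_subset by blast
    ultimately show ?thesis
      using act_sym_diff_inv[OF g(1) _ V(2), of c] g(3) by simp
  qed
  then show ?thesis by blast
qed

lemma not_splits_msum:
  "(\<And>f. f \<in># M \<Longrightarrow> f \<subseteq> V \<and> \<not> splits f H) \<Longrightarrow> msum M \<subseteq> V \<and> \<not> splits (msum M) H"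
proof (induction M)
  case empty
  then show ?case by (simp add: splits_def)
next
  case (add f M)
  then have "msum M \<subseteq> V" "\<not> splits (msum M) H" "f \<subseteq> V" "\<not> splits f H" by auto
  then show ?case
    using not_splits_sym_diff[of f H "msum M"] by auto
qed

text \<open>If no other member of \<open>M\<close> split the class of \<open>f\<close>, neither
  would their sum, and \<open>msum M\<close> would split it. Removing \<open>f\<close> with a
  partner keeps the sum elliptic because the pair is elliptic. The bound \<open>n\<close> comes from
  single pairs and is independent of the number of atoms.\<close>

lemma atoms_sum:
  "\<exists>n. \<forall>M. (\<forall>f \<in># M. atom f \<and> small s f) \<longrightarrow> msum M \<in> Ell \<longrightarrow> msum M \<in> W n"
proof -
  obtain n where n: "\<And>f f' H. atom f \<Longrightarrow> small s f \<Longrightarrow> atom f' \<Longrightarrow> small s f' \<Longrightarrow> H \<in> \<H> \<Longrightarrow>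
    splits f H \<Longrightarrow> splits f' H \<Longrightarrow> sym_diff f f' \<in> W n"
    using atom_pair[of s] by metis
  have "msum M \<in> W n" if "\<forall>f \<in># M. atom f \<and> small s f" "msum M \<in> Ell" for M
    using that
  proof (induction "size M" arbitrary: M rule: less_induct)
    case less
    show ?case
    proof (cases M)
      case empty
      then show ?thesis by (simp add: W_def)
    next
      case (add f M')
      have f: "atom f" "small s f" using less.prems add by auto
      then obtain H where H: "H \<in> \<H>" "splits f H"
        unfolding atom_def using sim_refl by blast
      have "\<exists>f' \<in># M'. splits f' H"
      proof (rule ccontr)
        assume "\<not> ?thesis"
        then have M': "msum M' \<subseteq> V" "\<not> splits (msum M') H"
          using not_splits_msum[of M' H] less.prems(1) add atom_cut cut_subset by auto
        have "splits (sym_diff f (msum M')) H"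
          using splits_cong_sym_diff[OF M'(2) _ M'(1)] H f atom_cut cut_subset by blast
        then show False
          using less.prems(2) add H(1) by (simp add: elliptic_iff)
      qed
      then obtain f' where f': "f' \<in># M'" "splits f' H" by blast
      then obtain M'' where M'': "M' = add_mset f' M''"
        using multi_member_split by metis
      have w: "sym_diff f f' \<in> W n"
        using n[OF f _ _ H f'(2)] less.prems(1) add f'(1) by auto
      have eq: "msum M = sym_diff (sym_diff f f') (msum M'')"
        using add M'' by auto
      have "msum M'' = sym_diff (sym_diff f f') (msum M)"
        unfolding eq by blast
      then have "msum M'' \<in> Ell"
        using elliptic_sym_diff[of "sym_diff f f'" "msum M"] w W_elliptic less.prems(2) by auto
      moreover have "\<forall>f \<in># M''. atom f \<and> small s f"
        using less.prems(1) add M'' by simp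
      ultimately have "msum M'' \<in> W n"
        using less.hyps[of M''] add M'' by simp
      then show ?thesis
        unfolding eq by (rule W_add[OF w])
    qed
  qed
  then show ?thesis by blast
qed

section \<open>Merging close pieces and resolving isolated ones\<close>

lemma small_card: "\<exists>c. \<forall>p \<subseteq> V. small r p \<longrightarrow> card (D p) \<le> c"
proof -
  define c where "c = Max (insert 0 ((\<lambda>x. card (D (fst x))) ` small_at r))"
  have "card (D p) \<le> c" if p: "p \<subseteq> V" "small r p" for p
  proof -
    obtain v where v: "v \<in> V" "\<Union>(D p) \<subseteq> ball r v"
      using p(2) by (auto simp: small_def)
    obtain g d u where g: "g \<in> carrier G" "(d, u) \<in> small_at r" "p = act g d"
      using to_small_at[OF p(1) v] by blast
    then have "card (D p) = card (D (fst (d, u)))"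
      using card_D_act small_at_cut cut_subset by simp
    also have "\<dots> \<le> c"
      unfolding c_def using finite_small_at g(2) by (intro Max_ge finite.insertI finite_imageI insertI2 imageI)
    finally show ?thesis .
  qed
  then show ?thesis by blast
qed

lemma D_msum: "e \<in> D (msum M) \<Longrightarrow> \<exists>p \<in># M. e \<in> D p"
proof (induction M)
  case (add p M)
  then show ?case
    using D_sym_diff[of p "msum M"] by auto
qed simp

lemma card_D_msum:
  "(\<And>p. p \<in># M \<Longrightarrow> p \<in> Cuts \<and> card (D p) \<le> c) \<Longrightarrow> card (D (msum M)) \<le> size M * c"
proof (induction M)
  case (add p M)
  have fin: "finite (D p)" "finite (D (msum M))"
    using add.prems cut_msum[of M] by (auto simp: cuts_iff)
  have "card (D (msum (add_mset p M))) \<le> card (D p \<union> D (msum M))"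
    using fin D_sym_diff[of p "msum M"] by (intro card_mono) auto
  also have "\<dots> \<le> card (D p) + card (D (msum M))"
    by (rule card_Un_le)
  also have "\<dots> \<le> c + size M * c"
    using add by (intro add_mono) auto
  finally show ?case by simp
qed simp

definition resolved :: "nat \<Rightarrow> 'v set \<Rightarrow> bool" where
  "resolved t p \<longleftrightarrow> (\<exists>M. (\<forall>f \<in># M. atom f \<and> small t f) \<and> sym_diff p (msum M) \<in> W t)"

lemma resolved_mono: "resolved s p \<Longrightarrow> s \<le> t \<Longrightarrow> resolved t p"
  unfolding resolved_def using W_mono small_mono by (meson subsetD)

lemma resolved_act:
  assumes g: "g \<in> carrier G" and p: "p \<subseteq> V" "resolved t p"
  shows "resolved t (act g p)"
proof -
  obtain M where M: "\<forall>f \<in># M. atom f \<and> small t f" "sym_diff p (msum M) \<in> W t"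
    using p(2) by (auto simp: resolved_def)
  have MV: "f \<subseteq> V" if "f \<in># M" for f
    using M(1) that atom_cut cut_subset by blast
  have m: "msum (image_mset ((`) (\<phi> g)) M) = act g (msum M)" "msum M \<subseteq> V"
    using msum_image[OF act_inj[OF g] MV] by auto
  have "act g (sym_diff p (msum M)) = sym_diff (act g p) (msum (image_mset ((`) (\<phi> g)) M))"
    unfolding m(1) by (rule act_sym_diff[OF g p(1) m(2)])
  then have "sym_diff (act g p) (msum (image_mset ((`) (\<phi> g)) M)) \<in> W t"
    using W_act[OF g M(2)] by simp
  moreover have "\<forall>f \<in># image_mset ((`) (\<phi> g)) M. atom f \<and> small t f"
    using M(1) MV atom_act[OF g] small_act[OF g] by auto
  ultimately show ?thesis
    unfolding resolved_def by blast
qed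

text \<open>If \<open>far k p\<close> holds, \<open>t\<close> bounds the atoms of this one cut and
  \<open>b\<close> is irrelevant. If it fails, \<open>t\<close> is chosen to cover the finite set
  witnessing the failure, and then no \<open>b\<close> satisfies the hypotheses.\<close>

lemma isolated_at:
  assumes p: "p \<in> Cuts" and v: "v \<in> V"
  shows "\<exists>t. \<forall>b \<in> Ell. card (D (sym_diff p b)) \<le> k \<longrightarrow>
    (\<forall>e \<in> D (sym_diff p b). \<not> e \<subseteq> ball t v) \<longrightarrow> resolved t p"
proof (cases "far k p")
  case True
  then obtain M where M: "\<forall>f \<in># M. atom f" "sym_diff p (msum M) \<in> Ell"
    using far_atoms[OF True p] by blast
  have "V \<noteq> {}" using v by blast
  then obtain t where t: "\<forall>b \<in> insert (sym_diff p (msum M)) (set_mset M). small t b"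
    using cuts_small[of "insert (sym_diff p (msum M)) (set_mset M)"] M elliptic_cut atom_cut
    by (metis finite_insert finite_set_mset insert_subset subsetI)
  then have "resolved t p"
    unfolding resolved_def using M W_small by (intro exI[of _ M]) simp
  then show ?thesis by blast
next
  case False
  then obtain L where L: "finite L" "L \<subseteq> V"
    "\<And>b. b \<in> Ell \<Longrightarrow> card (D (sym_diff p b)) \<le> k \<Longrightarrow> sym_diff p b \<inter> L \<noteq> {}"
    unfolding far_def by blast
  obtain t where t: "L \<subseteq> ball t v"
    using finite_in_ball[OF L(1,2) v] by blast
  have False if b: "b \<in> Ell" "card (D (sym_diff p b)) \<le> k"
    "\<forall>e \<in> D (sym_diff p b). \<not> e \<subseteq> ball t v" for b
  proof -
    have V: "p \<subseteq> V" "b \<subseteq> V" using p cut_subset b elliptic_subset by auto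
    have "ball t v \<subseteq> sym_diff p b \<or> ball t v \<inter> sym_diff p b = {}"
      using b(3) by (intro blob_const[OF blob_ball[OF v]]) blast
    then show False
    proof
      assume "ball t v \<inter> sym_diff p b = {}"
      then show False using L(3)[OF b(1,2)] t by blast
    next
      \<comment> \<open>The complement of \<open>b\<close> is elliptic too, and with it the sum
        moves off the ball.\<close>
      assume a: "ball t v \<subseteq> sym_diff p b"
      have eq: "sym_diff p (V - b) = V - sym_diff p b" using V by blast
      have "card (D (sym_diff p (V - b))) \<le> k"
        unfolding eq using b(2) by simp
      then have "sym_diff p (V - b) \<inter> L \<noteq> {}"
        by (rule L(3)[OF elliptic_compl[OF b(1)]])
      then show False
        unfolding eq using a t by blast
    qed
  qed
  then show ?thesis by blast
qed

lemma isolated: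
  "\<exists>t. \<forall>p v b. p \<subseteq> V \<longrightarrow> v \<in> V \<longrightarrow> \<Union>(D p) \<subseteq> ball r v \<longrightarrow> b \<in> Ell \<longrightarrow>
    card (D (sym_diff p b)) \<le> k \<longrightarrow> (\<forall>e \<in> D (sym_diff p b). \<not> e \<subseteq> ball t v) \<longrightarrow> resolved t p"
proof -
  have "\<forall>x \<in> small_at r. \<exists>t. \<forall>b \<in> Ell. card (D (sym_diff (fst x) b)) \<le> k \<longrightarrow>
    (\<forall>e \<in> D (sym_diff (fst x) b). \<not> e \<subseteq> ball t (snd x)) \<longrightarrow> resolved t (fst x)"
  proof
    fix x assume "x \<in> small_at r"
    then have "fst x \<in> Cuts" "snd x \<in> V"
      using small_at_cut[of "fst x" "snd x" r] by auto
    then show "\<exists>t. \<forall>b \<in> Ell. card (D (sym_diff (fst x) b)) \<le> k \<longrightarrow>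
    (\<forall>e \<in> D (sym_diff (fst x) b). \<not> e \<subseteq> ball t (snd x)) \<longrightarrow> resolved t (fst x)"
      by (rule isolated_at)
  qed
  then obtain t where t: "\<And>x b. x \<in> small_at r \<Longrightarrow> b \<in> Ell \<Longrightarrow>
    card (D (sym_diff (fst x) b)) \<le> k \<Longrightarrow>
    (\<forall>e \<in> D (sym_diff (fst x) b). \<not> e \<subseteq> ball (t x) (snd x)) \<Longrightarrow> resolved (t x) (fst x)"
    by metis
  define T where "T = Max (insert 0 (t ` small_at r))"
  have "resolved T p"
    if p: "p \<subseteq> V" and v: "v \<in> V" "\<Union>(D p) \<subseteq> ball r v" and b: "b \<in> Ell"
      "card (D (sym_diff p b)) \<le> k" "\<forall>e \<in> D (sym_diff p b). \<not> e \<subseteq> ball T v" for p v b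
  proof -
    obtain g c u where g: "g \<in> carrier G" "(c, u) \<in> small_at r" "p = act g c" "v = \<phi> g u"
      using to_small_at[OF p v] by blast
    have V: "c \<subseteq> V" "u \<in> V" "b \<subseteq> V" using small_at_cut[OF g(2)] cut_subset b elliptic_subset by auto
    define d where "d = act (inv g) b"
    have d: "d \<in> Ell" "d \<subseteq> V"
      using elliptic_act g b elliptic_subset by (auto simp: d_def)
    have dV: "sym_diff c d \<subseteq> V" using V d by blast
    have eq: "sym_diff p b = act g (sym_diff c d)"
      using act_sym_diff_inv[OF g(1) V(1,3)] g(3) by (simp add: d_def)
    have tT: "t (c, u) \<le> T"
      unfolding T_def using finite_small_at g(2) by (intro Max_ge) auto
    have "card (D (sym_diff c d)) \<le> k"
      using b(2) card_D_act[OF g(1) dV] eq by simp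
    moreover have "\<not> e \<subseteq> ball (t (c, u)) u" if e: "e \<in> D (sym_diff c d)" for e
    proof
      assume "e \<subseteq> ball (t (c, u)) u"
      then have "act g e \<subseteq> ball T v"
        using ball_mono[OF tT, of u] act_ball[OF g(1) V(2), of T] g(4) by blast
      moreover have "act g e \<in> D (sym_diff p b)"
        using e D_act[OF g(1) dV] eq by simp
      ultimately show False using b(3) by blast
    qed
    ultimately have "resolved (t (c, u)) c"
      using t[OF g(2) d(1)] by simp
    then show ?thesis
      using resolved_act[OF g(1) V(1)] resolved_mono[OF _ tT] g(3) by blast
  qed
  then show ?thesis by blast
qed

text \<open>Induction on the number of pieces, for all radii at once because merging two pieces
  enlarges the radius. If no two pieces are close, each is isolated from the rest of the sum and
  hence resolved, and \<open>atoms_sum\<close> applies to all the atoms together.\<close>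

lemma elliptic_sum_bounded:
  "\<exists>n. \<forall>M. size M \<le> m \<longrightarrow> (\<forall>p \<in># M. p \<subseteq> V \<and> small r p) \<longrightarrow> msum M \<in> Ell \<longrightarrow>
    msum M \<in> W n"
proof (induction m arbitrary: r)
  case 0
  then show ?case by (simp add: W_def)
next
  case (Suc m)
  obtain c where c: "\<And>p. p \<subseteq> V \<Longrightarrow> small r p \<Longrightarrow> card (D p) \<le> c"
    using small_card by blast
  obtain t where t: "\<And>p v b. p \<subseteq> V \<Longrightarrow> v \<in> V \<Longrightarrow> \<Union>(D p) \<subseteq> ball r v \<Longrightarrow> b \<in> Ell \<Longrightarrow>
    card (D (sym_diff p b)) \<le> m * c \<Longrightarrow> (\<forall>e \<in> D (sym_diff p b). \<not> e \<subseteq> ball t v) \<Longrightarrow> resolved t p"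
    using isolated[of r "m * c"] by metis
  \<comment> \<open>The merged piece keeps the centre of the first: the second has an edge within
    \<open>t\<close> of it and a coboundary of diameter at most \<open>2 * r\<close>.\<close>
  define R where "R = t + 2 * r"
  obtain n1 where n1: "\<And>M. size M \<le> m \<Longrightarrow> (\<forall>p \<in># M. p \<subseteq> V \<and> small R p) \<Longrightarrow>
    msum M \<in> Ell \<Longrightarrow> msum M \<in> W n1"
    using Suc.IH[of R] by metis
  obtain n2 where n2: "\<And>M. (\<forall>f \<in># M. atom f \<and> small t f) \<Longrightarrow> msum M \<in> Ell \<Longrightarrow> msum M \<in> W n2"
    using atoms_sum[of t] by metis
  define n where "n = max t (max n1 n2)"
  have n: "W n1 \<subseteq> W n" "W n2 \<subseteq> W n" "W t \<subseteq> W n"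
    by (auto simp: n_def intro!: W_mono)
  have rR: "small R p" if "small r p" for p
    using small_mono[OF that] by (simp add: R_def)
  have "msum M \<in> W n"
    if M: "size M \<le> Suc m" "\<forall>p \<in># M. p \<subseteq> V \<and> small r p" "msum M \<in> Ell" for M
  proof (cases "\<exists>p p' N v e. M = add_mset p (add_mset p' N) \<and> v \<in> V \<and> \<Union>(D p) \<subseteq> ball r v \<and>
      e \<in> D p' \<and> e \<subseteq> ball t v")
    case True
    then obtain p p' N v e where near: "M = add_mset p (add_mset p' N)" "v \<in> V" "\<Union>(D p) \<subseteq> ball r v"
      "e \<in> D p'" "e \<subseteq> ball t v"
      by (elim exE conjE) (rule that)
    have pp': "p \<subseteq> V" "p' \<subseteq> V" "small r p'" using M(2) near(1) by auto
    obtain w where w: "w \<in> V" "\<Union>(D p') \<subseteq> ball r w"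
      using pp'(3) by (auto simp: small_def)
    obtain y where y: "y \<in> e" using D_edge_nonempty[OF near(4)] by blast
    have "\<Union>(D p') \<subseteq> ball R v"
    proof
      fix z assume z: "z \<in> \<Union>(D p')"
      have "y \<in> ball r w" "y \<in> ball t v" "z \<in> ball r w"
        using y near(4,5) w(2) z by blast+
      then show "z \<in> ball R v"
        using ball_trans'[of y t v w r "t + r"] ball_trans'[of w "t + r" v z r R] ball_sym
        by (simp add: R_def)
    qed
    moreover have "\<Union>(D p) \<subseteq> ball R v"
      using near(3) ball_mono[of r R v] by (auto simp: R_def)
    ultimately have "small R (sym_diff p p')"
      unfolding small_def using Union_D_sym_diff near(2) by blast
    moreover have "sym_diff p p' \<subseteq> V" using pp' by blast
    ultimately have "\<forall>x \<in># add_mset (sym_diff p p') N. x \<subseteq> V \<and> small R x"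
      using M(2) near(1) rR by auto
    moreover have eq: "msum (add_mset (sym_diff p p') N) = msum M"
      using near(1) by auto
    moreover have "size (add_mset (sym_diff p p') N) \<le> m"
      using M(1) near(1) by simp
    ultimately have "msum (add_mset (sym_diff p p') N) \<in> W n1"
      using n1 M(3) by metis
    then show ?thesis using eq n(1) by auto
  next
    case False
    have "resolved t p" if p: "p \<in># M" for p
    proof -
      obtain N where N: "M = add_mset p N" using p multi_member_split by metis
      have pV: "p \<subseteq> V" "small r p" using M(2) p by auto
      obtain v where v: "v \<in> V" "\<Union>(D p) \<subseteq> ball r v" using pV(2) by (auto simp: small_def)
      \<comment> \<open>The elliptic cut completing \<open>p\<close> is the whole sum; the
        correction consists of the other \<open>m\<close> pieces at most, each with at most
        \<open>c\<close> edges.\<close>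
      have eq: "sym_diff p (msum M) = msum N" using N by auto
      have "\<not> e \<subseteq> ball t v" if e: "e \<in> D (msum N)" for e
      proof
        assume sub: "e \<subseteq> ball t v"
        obtain p' where p': "p' \<in># N" "e \<in> D p'"
          using D_msum[OF e] by blast
        then obtain N' where "N = add_mset p' N'" using multi_member_split by metis
        then have "M = add_mset p (add_mset p' N')" using N by simp
        then show False
          using False v p'(2) sub by blast
      qed
      moreover have "card (D (msum N)) \<le> m * c"
      proof -
        have "card (D (msum N)) \<le> size N * c"
          using M(2) N c small_cut by (intro card_D_msum) auto
        also have "\<dots> \<le> m * c"
          using M(1) N by (intro mult_right_mono) auto
        finally show ?thesis .
      qed
      ultimately show ?thesis
        using t[OF pV(1) v M(3)] unfolding eq by blast
    qed
    then have "\<forall>p \<in> set_mset M. \<exists>X. (\<forall>f \<in># X. atom f \<and> small t f) \<and> sym_diff p (msum X) \<in> W t"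
      by (simp add: resolved_def)
    then obtain h where h: "\<And>p. p \<in># M \<Longrightarrow> (\<forall>f \<in># h p. atom f \<and> small t f) \<and> sym_diff p (msum (h p)) \<in> W t"
      by metis
    define T where "T N = sum_mset (image_mset h N)" for N
    have T: "(\<forall>f \<in># T N. atom f \<and> small t f) \<and> sym_diff (msum N) (msum (T N)) \<in> W t"
      if "set_mset N \<subseteq> set_mset M" for N
      using that
    proof (induction N)
      case empty
      then show ?case by (simp add: T_def W_def)
    next
      case (add p N)
      then have IH: "\<forall>f \<in># T N. atom f \<and> small t f" "sym_diff (msum N) (msum (T N)) \<in> W t" and p: "p \<in># M"
        by auto
      have T: "T (add_mset p N) = h p + T N" by (simp add: T_def)
      have "sym_diff (msum (add_mset p N)) (msum (T (add_mset p N))) =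
          sym_diff (sym_diff p (msum (h p))) (sym_diff (msum N) (msum (T N)))"
        unfolding T by auto
      moreover have "sym_diff (sym_diff p (msum (h p))) (sym_diff (msum N) (msum (T N))) \<in> W t"
        using h[OF p] IH(2) W_add by blast
      ultimately show ?case
        using h[OF p] IH(1) unfolding T by auto
    qed
    have TM: "\<forall>f \<in># T M. atom f \<and> small t f" "sym_diff (msum M) (msum (T M)) \<in> W t"
      using T[of M] by auto
    have "msum (T M) = sym_diff (msum M) (sym_diff (msum M) (msum (T M)))" by blast
    then have "msum (T M) \<in> Ell"
      using elliptic_sym_diff[OF M(3), of "sym_diff (msum M) (msum (T M))"] TM(2) W_elliptic by auto
    then have "msum (T M) \<in> W n"
      using n2[OF TM(1)] n(2) by blast
    then have "sym_diff (sym_diff (msum M) (msum (T M))) (msum (T M)) \<in> W n"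
      using TM(2) n(3) W_add by blast
    moreover have "sym_diff (sym_diff (msum M) (msum (T M))) (msum (T M)) = msum M" by blast
    ultimately show ?thesis by simp
  qed
  then show ?case by blast
qed

section \<open>Diameter of bonds with few edges\<close>

lemma bond_act:
  assumes g: "g \<in> carrier G" and b: "bond b"
  shows "bond (act g b)"
proof -
  have bc: "b \<in> Cuts" "b \<subseteq> V" "D b \<noteq> {}"
    using b cut_subset by (auto simp: bond_def)
  have "D c = D (act g b)" if c: "c \<subseteq> V" "D c \<subseteq> D (act g b)" "D c \<noteq> {}" for c
  proof -
    have "D (act (inv g) c) \<subseteq> D (act (inv g) (act g b))"
      using c D_act[of "inv g"] g act_subset_V[OF g bc(2)] by (simp only: inv_closed image_mono)
    then have "D (act (inv g) c) \<subseteq> D b"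
      using g bc by simp
    moreover have "D (act (inv g) c) \<noteq> {}"
      using D_act[of "inv g" c] g c by simp
    ultimately have eq: "D (act (inv g) c) = D b"
      using b act_subset_V[of "inv g" c] g c(1) unfolding bond_def by simp
    have "D (act g (act (inv g) c)) = D (act g b)"
      using eq D_act[OF g, of "act (inv g) c"] D_act[OF g bc(2)] act_subset_V[of "inv g" c] g c(1)
      by (simp only: inv_closed)
    then show ?thesis using g c(1) by simp
  qed
  then show ?thesis
    using cut_act[OF g bc(1)] D_act[OF g bc(2)] bc(3) unfolding bond_def by simp
qed

text \<open>Some edge of the bond can be moved to a representative vertex. Local finiteness leaves
  finitely many edges there, and \<open>finite_bonds_through\<close> finitely many bonds.\<close>

lemma bonds_small: "\<exists>r. \<forall>b. bond b \<longrightarrow> card (D b) \<le> k \<longrightarrow> small r b"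
proof (cases "V = {}")
  case True
  then have "\<not> bond b" for b
    using D_subset[of b] edge_obtain by (metis bond_def all_not_in_conv subsetD)
  then show ?thesis by blast
next
  case False
  define B where "B = (\<Union>u \<in> reps. \<Union>e \<in> {e \<in> E. u \<in> e}. {b. bond b \<and> e \<in> D b \<and> card (D b) \<le> k})"
  have "finite {e \<in> E. u \<in> e}" if "u \<in> reps" for u
    using loc_fin reps(2) that unfolding locally_finite_graph_def by blast
  then have "finite B"
    unfolding B_def using reps(1) finite_bonds_through by blast
  moreover have "B \<subseteq> Cuts"
    by (auto simp: B_def bond_def)
  ultimately obtain r where r: "\<forall>b \<in> B. small r b"
    using cuts_small False by blast
  have "small r b" if b: "bond b" "card (D b) \<le> k" for b
  proof -
    have bV: "b \<subseteq> V" using b cut_subset by (auto simp: bond_def)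
    obtain e where e: "e \<in> D b" using b by (auto simp: bond_def)
    then obtain u w where uw: "e = {u, w}" "{u, w} \<in> E" "u \<in> V" "w \<in> V"
      by (elim D_obtain) auto
    obtain g x where g: "g \<in> carrier G" "x \<in> reps" "u = \<phi> g x"
      using reps(3) uw(3) by blast
    have gi: "inv g \<in> carrier G" using g by simp
    have "\<phi> (inv g) u = x"
      using action.orbit_sym_aux[OF g(1)] g reps(2) by blast
    then have "x \<in> act (inv g) e" using uw(1) by blast
    moreover have eD: "act (inv g) e \<in> D (act (inv g) b)"
      using D_act[OF gi bV] e by blast
    moreover have "act (inv g) e \<in> E" using eD D_subset by blast
    moreover have "bond (act (inv g) b)" "card (D (act (inv g) b)) \<le> k"
      using bond_act[OF gi b(1)] card_D_act[OF gi bV] b(2) by auto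
    ultimately have "act (inv g) b \<in> B"
      unfolding B_def using g(2) by blast
    then have "small r (act (inv g) b)" using r by blast
    then have "small r (act g (act (inv g) b))"
      using small_act[OF g(1)] act_subset_V[OF gi bV] by blast
    then show ?thesis using g bV by simp
  qed
  then show ?thesis by blast
qed

theorem elliptic_bounded: "\<exists>n. \<forall>b \<in> Ell. card (D b) \<le> k \<longrightarrow> b \<in> W n"
proof (cases "V = {}")
  case True
  then have "b = {}" if "b \<in> Ell" for b
    using elliptic_subset[OF that] by simp
  then show ?thesis by (metis W_def sdspan_empty)
next
  case False
  obtain r where r: "\<And>b. bond b \<Longrightarrow> card (D b) \<le> k \<Longrightarrow> small r b"
    using bonds_small by blast
  obtain n where n: "\<And>M. size M \<le> k + 1 \<Longrightarrow> (\<forall>p \<in># M. p \<subseteq> V \<and> small r p) \<Longrightarrow>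
    msum M \<in> Ell \<Longrightarrow> msum M \<in> W n"
    using elliptic_sum_bounded[of "k + 1" r] by metis
  have "b \<in> W n" if b: "b \<in> Ell" "card (D b) \<le> k" for b
  proof -
    have bc: "b \<in> Cuts" "finite (D b)" using b elliptic_cut cuts_iff by auto
    obtain M where M: "size M \<le> card (D b) + 1" "msum M = b" "\<forall>p \<in># M. p = V \<or> bond p \<and> D p \<subseteq> D b"
      using bond_decomposition[OF bc(1)] by blast
    have "p \<subseteq> V \<and> small r p" if p: "p \<in># M" for p
    proof (cases "p = V")
      case True
      then show ?thesis using False by (auto simp: small_def)
    next
      case F: False
      then have p': "bond p" "D p \<subseteq> D b" using M(3) p by auto
      then have "card (D p) \<le> k"
        using card_mono[OF bc(2) p'(2)] b(2) by simp
      then show ?thesis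
        using r p'(1) cut_subset by (auto simp: bond_def)
    qed
    then show ?thesis
      using n[of M] M(1,2) b by auto
  qed
  then show ?thesis by blast
qed

end

section \<open>Ends and ultrafilters\<close>

context graph
begin

section \<open>Components outside a finite set\<close>

abbreviation "comps K \<equiv> graph_components (delete_verts \<Gamma> K)"

lemma comp_obtain:
  assumes "C \<in> comps K"
  obtains v where "v \<in> V" "v \<notin> K" "C = (adjacency (delete_verts \<Gamma> K))\<^sup>* `` {v}"
  using assms by (auto simp: graph_components_def delete_verts_def)

lemma adjacency_delete:
  "(u, v) \<in> adjacency (delete_verts \<Gamma> K) \<longleftrightarrow> {u, v} \<in> E \<and> u \<notin> K \<and> v \<notin> K"
  by (auto simp: adjacency_def delete_verts_def)

lemma reach_sym: "sym ((adjacency (delete_verts \<Gamma> K))\<^sup>*)"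
  by (intro sym_rtrancl symI) (auto simp: adjacency_delete insert_commute)

lemma comp_subset:
  assumes "C \<in> comps K"
  shows "C \<subseteq> V - K"
proof
  fix w assume w: "w \<in> C"
  obtain v where v: "v \<in> V" "v \<notin> K" "C = (adjacency (delete_verts \<Gamma> K))\<^sup>* `` {v}"
    using assms by (rule comp_obtain)
  then have "(v, w) \<in> (adjacency (delete_verts \<Gamma> K))\<^sup>*"
    using w by simp
  then show "w \<in> V - K"
    using v(1,2) by induction (use edge_verts in \<open>auto simp: adjacency_delete\<close>)
qed

lemma comp_eq:
  assumes C: "C \<in> comps K" and w: "w \<in> C"
  shows "C = (adjacency (delete_verts \<Gamma> K))\<^sup>* `` {w}"
proof -
  obtain v where v: "C = (adjacency (delete_verts \<Gamma> K))\<^sup>* `` {v}"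
    using C by (rule comp_obtain)
  then have vw: "(v, w) \<in> (adjacency (delete_verts \<Gamma> K))\<^sup>*"
    using w by simp
  then have wv: "(w, v) \<in> (adjacency (delete_verts \<Gamma> K))\<^sup>*"
    using reach_sym[of K] by (auto dest: symD)
  show ?thesis
    unfolding v using vw wv by (auto intro: rtrancl_trans)
qed

lemma comp_nonempty: "C \<in> comps K \<Longrightarrow> C \<noteq> {}"
  by (elim comp_obtain) auto

lemma comps_cover: "V - K \<subseteq> \<Union>(comps K)"
  by (auto simp: graph_components_def delete_verts_def)

lemma comp_const:
  assumes C: "C \<in> comps K" and c: "\<And>e. e \<in> D c \<Longrightarrow> e \<inter> K \<noteq> {}"
  shows "C \<subseteq> c \<or> C \<inter> c = {}"
proof -
  obtain v where v: "C = (adjacency (delete_verts \<Gamma> K))\<^sup>* `` {v}"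
    using C by (rule comp_obtain)
  have "w \<in> c \<longleftrightarrow> v \<in> c" if "w \<in> C" for w
  proof -
    have "(v, w) \<in> (adjacency (delete_verts \<Gamma> K))\<^sup>*"
      using that v by simp
    then show ?thesis
    proof induction
      case (step y z)
      have e: "{y, z} \<in> E" "{y, z} \<inter> K = {}"
        using step(2) by (auto simp: adjacency_delete)
      then have "{y, z} \<notin> D c" using c by blast
      then show ?case using D_iff[OF e(1), of c] step(3) by blast
    qed simp
  qed
  then show ?thesis by blast
qed

lemma comp_D:
  assumes C: "C \<in> comps K" and e: "e \<in> D C"
  shows "\<exists>u w. u \<in> C \<and> w \<in> K \<and> {w, u} \<in> E"
proof -
  obtain u w where uw: "e = {u, w}" "{u, w} \<in> E" "u \<in> C" "w \<notin> C"
    using e by (elim D_obtain) auto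
  have "u \<notin> K" using comp_subset[OF C] uw(3) by blast
  have "w \<in> K"
  proof (rule ccontr)
    assume "w \<notin> K"
    then have "(u, w) \<in> adjacency (delete_verts \<Gamma> K)"
      using uw \<open>u \<notin> K\<close> by (simp add: adjacency_delete)
    then have "w \<in> C"
      using comp_eq[OF C uw(3)] by blast
    then show False using uw by simp
  qed
  then show ?thesis
    using uw by (intro exI[of _ u] exI[of _ w]) (simp add: insert_commute)
qed

text \<open>A component other than \<open>V\<close> has a nonempty coboundary, so it contains one of
  the finitely many neighbours of \<open>K\<close>.\<close>

lemma finite_comps:
  assumes "finite K"
  shows "finite (comps K)"
proof -
  define N where "N = (\<Union>w \<in> K. {u. {w, u} \<in> E})"
  have "finite N"
    unfolding N_def using assms finite_nbrs by simp
  moreover have "comps K \<subseteq> insert V ((\<lambda>u. (adjacency (delete_verts \<Gamma> K))\<^sup>* `` {u}) ` N)"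
  proof
    fix C assume C: "C \<in> comps K"
    show "C \<in> insert V ((\<lambda>u. (adjacency (delete_verts \<Gamma> K))\<^sup>* `` {u}) ` N)"
    proof (cases "D C = {}")
      case True
      then have "C = {} \<or> C = V"
        using comp_subset[OF C] by (intro D_empty_cases) auto
      then show ?thesis
        using comp_nonempty[OF C] by blast
    next
      case False
      then obtain u where u: "u \<in> C" "u \<in> N"
        using comp_D[OF C] unfolding N_def by blast
      then show ?thesis
        using comp_eq[OF C u(1)] by blast
    qed
  qed
  ultimately show ?thesis
    using finite_subset by blast
qed

text \<open>Families are not confined to subsets of \<open>V\<close>, so intersections are taken
  inside \<open>V\<close>; the empty subfamily then says that \<open>V\<close> is nonempty.\<close>

definition fip :: "'v set set \<Rightarrow> bool" where
  "fip F \<longleftrightarrow> (\<forall>S. finite S \<longrightarrow> S \<subseteq> F \<longrightarrow> V \<inter> \<Inter>S \<noteq> {})"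

definition ultra :: "'v set set \<Rightarrow> bool" where
  "ultra U \<longleftrightarrow> fip U \<and> (\<forall>X \<subseteq> V. X \<in> U \<or> V - X \<in> U)"

lemma fipD: "fip F \<Longrightarrow> finite S \<Longrightarrow> S \<subseteq> F \<Longrightarrow> V \<inter> \<Inter>S \<noteq> {}"
  unfolding fip_def by blast

lemma ultra_exists:
  assumes "fip F"
  shows "\<exists>U. F \<subseteq> U \<and> ultra U"
proof -
  let ?A = "{U. F \<subseteq> U \<and> fip U}"
  have "\<exists>U \<in> ?A. \<forall>X \<in> ?A. U \<subseteq> X \<longrightarrow> X = U"
  proof (rule subset_Zorn_nonempty)
    show "?A \<noteq> {}" using assms by blast
  next
    fix \<C> assume \<C>: "\<C> \<noteq> {}" "subset.chain ?A \<C>"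
    have "V \<inter> \<Inter>S \<noteq> {}" if S: "finite S" "S \<subseteq> \<Union>\<C>" for S
    proof -
      obtain U where "U \<in> \<C>" "S \<subseteq> U"
        using finite_subset_Union_chain[OF S \<C>(1,2)] by blast
      moreover from this have "fip U"
        using \<C>(2) unfolding subset.chain_def by blast
      ultimately show ?thesis
        using S(1) by (intro fipD)
    qed
    then have "fip (\<Union>\<C>)" unfolding fip_def by blast
    moreover have "F \<subseteq> \<Union>\<C>"
      using \<C> unfolding subset.chain_def by blast
    ultimately show "\<Union>\<C> \<in> ?A" by blast
  qed
  then obtain U where "U \<in> ?A" "\<forall>X \<in> ?A. U \<subseteq> X \<longrightarrow> X = U"
    by (elim bexE) (rule that)
  then have U: "F \<subseteq> U" "fip U" "\<And>X. F \<subseteq> X \<Longrightarrow> fip X \<Longrightarrow> U \<subseteq> X \<Longrightarrow> X = U"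
    by simp_all
  have bad: "\<exists>S. finite S \<and> S \<subseteq> U \<and> V \<inter> \<Inter>S \<inter> X = {}" if X: "X \<notin> U" for X
  proof -
    have "insert X U \<noteq> U" using X by blast
    then have "\<not> fip (insert X U)"
      using U(1) U(3)[of "insert X U"] by blast
    then obtain S where S: "finite S" "S \<subseteq> insert X U" "V \<inter> \<Inter>S = {}"
      unfolding fip_def by blast
    have "V \<inter> \<Inter>(S - {X}) \<inter> X \<subseteq> V \<inter> \<Inter>S" by blast
    then have "V \<inter> \<Inter>(S - {X}) \<inter> X = {}" using S(3) by simp
    then show ?thesis
      using S(1,2) by (intro exI[of _ "S - {X}"]) auto
  qed
  have "X \<in> U \<or> V - X \<in> U" for X
  proof (rule ccontr)
    assume "\<not> ?thesis"
    then obtain S S' where S: "finite S" "S \<subseteq> U" "V \<inter> \<Inter>S \<inter> X = {}"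
      "finite S'" "S' \<subseteq> U" "V \<inter> \<Inter>S' \<inter> (V - X) = {}"
      using bad by metis
    have "V \<inter> \<Inter>(S \<union> S') = {}" using S(3,6) by blast
    moreover have "V \<inter> \<Inter>(S \<union> S') \<noteq> {}"
      using S by (intro fipD[OF U(2)]) auto
    ultimately show False by simp
  qed
  then show ?thesis
    using U(1,2) unfolding ultra_def by blast
qed

section \<open>Free ultrafilters and the ends they choose\<close>

context
  fixes U assumes U: "ultra U"
begin

lemma ultra_meet: "finite S \<Longrightarrow> S \<subseteq> U \<Longrightarrow> V \<inter> \<Inter>S \<noteq> {}"
  using U fipD unfolding ultra_def by blast

lemma ultra_compl: "X \<subseteq> V \<Longrightarrow> V - X \<in> U \<longleftrightarrow> X \<notin> U"
  using ultra_meet[of "{X, V - X}"] U unfolding ultra_def by auto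

lemma ultra_up: "X \<in> U \<Longrightarrow> X \<inter> V \<subseteq> Y \<Longrightarrow> Y \<subseteq> V \<Longrightarrow> Y \<in> U"
  using ultra_meet[of "{X, V - Y}"] ultra_compl[of Y] by auto

lemma ultra_Int: "X \<in> U \<Longrightarrow> Y \<in> U \<Longrightarrow> X \<subseteq> V \<Longrightarrow> X \<inter> Y \<in> U"
  using ultra_meet[of "{X, Y, V - (X \<inter> Y)}"] ultra_compl[of "X \<inter> Y"] by auto

lemma ultra_V: "V \<in> U"
  using ultra_meet[of "{{}}"] ultra_compl[of "{}"] by auto

lemma ultra_disjoint: "X \<in> U \<Longrightarrow> Y \<in> U \<Longrightarrow> X \<inter> Y \<noteq> {}"
  using ultra_meet[of "{X, Y}"] by auto

lemma ultra_Union: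
  assumes "finite \<C>" "\<Union>\<C> \<in> U" "\<Union>\<C> \<subseteq> V"
  shows "\<exists>C \<in> \<C>. C \<in> U"
proof (rule ccontr)
  assume "\<not> ?thesis"
  then have "(\<lambda>C. V - C) ` \<C> \<subseteq> U"
    using ultra_compl assms(3) by blast
  then have "V \<inter> \<Inter>(insert (\<Union>\<C>) ((\<lambda>C. V - C) ` \<C>)) \<noteq> {}"
    using assms by (intro ultra_meet) auto
  then show False by blast
qed

context
  assumes free: "\<And>v. v \<in> V \<Longrightarrow> V - {v} \<in> U"
begin

lemma ultra_cofinite:
  assumes "finite K" "K \<subseteq> V"
  shows "V - K \<in> U"
proof (rule ccontr)
  assume "V - K \<notin> U"
  then have "\<Union>((\<lambda>v. {v}) ` K) \<in> U"
    using ultra_compl[OF assms(2)] by simp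
  then obtain v where "v \<in> K" "{v} \<in> U"
    using ultra_Union[of "(\<lambda>v. {v}) ` K"] assms by auto
  then show False
    using ultra_compl[of "{v}"] free assms(2) by auto
qed

text \<open>Outside a finite \<open>K\<close> there are finitely many disjoint components, so a free
  ultrafilter contains exactly one of them and the choice is forced. The choices are compatible
  because members of \<open>U\<close> meet.\<close>

definition ultra_end :: "'v set \<Rightarrow> 'v set" where
  "ultra_end = (\<lambda>K \<in> finite_vsets \<Gamma>. SOME C. C \<in> comps K \<and> C \<in> U)"

lemma ultra_end:
  assumes "K \<in> finite_vsets \<Gamma>"
  shows "ultra_end K \<in> comps K \<and> ultra_end K \<in> U"
proof -
  have K: "finite K" "K \<subseteq> V"
    using assms by (auto simp: finite_vsets_def)
  have "\<Union>(comps K) = V - K"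
    using comps_cover comp_subset by blast
  then have "\<exists>C. C \<in> comps K \<and> C \<in> U"
    using ultra_Union[OF finite_comps[OF K(1)]] ultra_cofinite[OF K] by auto
  then have "(SOME C. C \<in> comps K \<and> C \<in> U) \<in> comps K \<and> (SOME C. C \<in> comps K \<and> C \<in> U) \<in> U"
    by (rule someI_ex)
  then show ?thesis
    using assms by (simp add: ultra_end_def)
qed

lemma comp_antimono:
  assumes "K \<subseteq> L" "C \<in> comps K" "C' \<in> comps L" "C \<inter> C' \<noteq> {}"
  shows "C' \<subseteq> C"
proof -
  have "C' \<subseteq> C \<or> C' \<inter> C = {}"
  proof (rule comp_const[OF assms(3)])
    fix e assume e: "e \<in> D C"
    then obtain u w where uw: "e = {u, w}" "{u, w} \<in> E" "u \<in> C" "w \<notin> C"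
      by (elim D_obtain) auto
    have "w \<in> K"
    proof (rule ccontr)
      assume "w \<notin> K"
      then have "(u, w) \<in> adjacency (delete_verts \<Gamma> K)"
        using uw comp_subset[OF assms(2)] by (auto simp: adjacency_delete)
      then have "w \<in> C"
        using comp_eq[OF assms(2) uw(3)] by blast
      then show False using uw by simp
    qed
    then show "e \<inter> L \<noteq> {}" using uw(1) assms(1) by blast
  qed
  then show ?thesis using assms(4) by blast
qed

lemma ultra_end_in_ends: "ultra_end \<in> ends \<Gamma>"
proof -
  have "ultra_end L \<subseteq> ultra_end K"
    if "K \<in> finite_vsets \<Gamma>" "L \<in> finite_vsets \<Gamma>" "K \<subseteq> L" for K L
    by (rule comp_antimono[OF that(3)])
      (simp_all add: ultra_end[OF that(1)] ultra_end[OF that(2)] ultra_disjoint)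
  then show ?thesis
    unfolding ends_def using ultra_end by (auto simp: ultra_end_def)
qed

end

end

section \<open>Evaluating cuts at ends\<close>

lemma end_comp: "\<omega> \<in> ends \<Gamma> \<Longrightarrow> K \<in> finite_vsets \<Gamma> \<Longrightarrow> \<omega> K \<in> comps K"
  by (auto simp: ends_def)

lemma end_mono: "\<omega> \<in> ends \<Gamma> \<Longrightarrow> K \<in> finite_vsets \<Gamma> \<Longrightarrow> L \<in> finite_vsets \<Gamma> \<Longrightarrow> K \<subseteq> L \<Longrightarrow> \<omega> L \<subseteq> \<omega> K"
  unfolding ends_def by blast

text \<open>The basic open sets around \<open>\<omega>\<close> are given by its components, and
  those of \<open>K\<close> and \<open>L\<close> contain that of \<open>K \<union> L\<close>. So
  every neighbourhood of \<open>\<omega>\<close> contains the vertices of some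
  \<open>\<omega> K\<close>, and these suffice to test closures of vertex sets.\<close>

lemma limit_ends_iff:
  assumes \<omega>: "\<omega> \<in> ends \<Gamma>"
  shows "\<omega> \<in> \<Lambda> b \<longleftrightarrow> (\<forall>K \<in> finite_vsets \<Gamma>. \<omega> K \<inter> b \<noteq> {})"
proof -
  define nb where "nb K C = Inl ` C \<union> Inr ` {\<omega> \<in> ends \<Gamma>. \<omega> K = C}" for K C
  define B where "B = (\<lambda>v. {Inl v}) ` V \<union>
      {nb K C | K C. K \<in> finite_vsets \<Gamma> \<and> C \<in> comps K}"
  have fB: "freudenthal \<Gamma> = topology_generated_by B"
    unfolding freudenthal_def B_def nb_def by simp
  have nb_open: "openin (freudenthal \<Gamma>) (nb K (\<omega> K))" if "K \<in> finite_vsets \<Gamma>" for K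
    unfolding fB using end_comp[OF \<omega> that] that
    by (intro topology_generated_by_Basis) (auto simp: B_def)
  have nb_mem: "Inr \<omega> \<in> nb K (\<omega> K)" for K
    using \<omega> by (auto simp: nb_def)
  have nbhd: "\<exists>K \<in> finite_vsets \<Gamma>. Inl ` \<omega> K \<subseteq> T" if "generate_topology_on B T" "Inr \<omega> \<in> T" for T
    using that
  proof (induction rule: generate_topology_on.induct)
    case (Int S T)
    then obtain K L where KL: "K \<in> finite_vsets \<Gamma>" "L \<in> finite_vsets \<Gamma>" "Inl ` \<omega> K \<subseteq> S" "Inl ` \<omega> L \<subseteq> T"
      by blast
    have u: "K \<union> L \<in> finite_vsets \<Gamma>"
      using KL by (auto simp: finite_vsets_def)
    have "\<omega> (K \<union> L) \<subseteq> \<omega> K" "\<omega> (K \<union> L) \<subseteq> \<omega> L"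
      using end_mono[OF \<omega> _ u] KL by auto
    then have "Inl ` \<omega> (K \<union> L) \<subseteq> S \<inter> T"
      using KL(3,4) by blast
    then show ?case using u by blast
  next
    case (UN \<K>)
    then obtain T where T: "T \<in> \<K>" "Inr \<omega> \<in> T" by blast
    then obtain K where "K \<in> finite_vsets \<Gamma>" "Inl ` \<omega> K \<subseteq> T"
      using UN.IH by blast
    then show ?case using T(1) by blast
  next
    case (Basis T)
    then obtain K C where K: "K \<in> finite_vsets \<Gamma>" "T = nb K C"
      unfolding B_def by blast
    then have "\<omega> K = C"
      using Basis.prems by (auto simp: nb_def)
    then show ?case
      using K by (auto simp: nb_def)
  qed simp
  have "{} \<in> finite_vsets \<Gamma>" by (simp add: finite_vsets_def)
  then have top: "Inr \<omega> \<in> topspace (freudenthal \<Gamma>)"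
    using nb_open nb_mem openin_subset by blast
  show ?thesis
  proof
    assume "\<omega> \<in> \<Lambda> b"
    then have cl: "Inr \<omega> \<in> freudenthal \<Gamma> closure_of (Inl ` b)"
      by (simp add: limit_ends_def)
    show "\<forall>K \<in> finite_vsets \<Gamma>. \<omega> K \<inter> b \<noteq> {}"
    proof
      fix K assume K: "K \<in> finite_vsets \<Gamma>"
      then obtain y where "y \<in> Inl ` b" "y \<in> nb K (\<omega> K)"
        using cl nb_open[OF K] nb_mem unfolding in_closure_of by blast
      then show "\<omega> K \<inter> b \<noteq> {}"
        by (auto simp: nb_def)
    qed
  next
    assume meets: "\<forall>K \<in> finite_vsets \<Gamma>. \<omega> K \<inter> b \<noteq> {}"
    have "\<exists>y. y \<in> Inl ` b \<and> y \<in> T" if T: "Inr \<omega> \<in> T" "openin (freudenthal \<Gamma>) T" for T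
    proof -
      have "generate_topology_on B T"
        using T(2) unfolding fB openin_topology_generated_by_iff .
      then obtain K where "K \<in> finite_vsets \<Gamma>" "Inl ` \<omega> K \<subseteq> T"
        using nbhd T(1) by blast
      then show ?thesis using meets by blast
    qed
    then have "Inr \<omega> \<in> freudenthal \<Gamma> closure_of (Inl ` b)"
      unfolding in_closure_of using top by blast
    then show "\<omega> \<in> \<Lambda> b"
      using \<omega> by (simp add: limit_ends_def)
  qed
qed

text \<open>Once \<open>K\<close> contains the coboundary of \<open>c\<close>, the component
  \<open>\<omega> K\<close> lies on one side of \<open>c\<close>, and the components of larger
  finite sets inherit this side.\<close>

lemma limit_ends_at:
  assumes \<omega>: "\<omega> \<in> ends \<Gamma>" and K: "K \<in> finite_vsets \<Gamma>" "\<Union>(D c) \<subseteq> K"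
  shows "\<omega> \<in> \<Lambda> c \<longleftrightarrow> \<omega> K \<subseteq> c" "\<omega> K \<subseteq> c \<or> \<omega> K \<inter> c = {}"
proof -
  have "e \<inter> K \<noteq> {}" if "e \<in> D c" for e
    using D_edge_nonempty[OF that] K(2) that by blast
  then show const: "\<omega> K \<subseteq> c \<or> \<omega> K \<inter> c = {}"
    using comp_const end_comp[OF \<omega> K(1)] by blast
  show "\<omega> \<in> \<Lambda> c \<longleftrightarrow> \<omega> K \<subseteq> c"
    unfolding limit_ends_iff[OF \<omega>]
  proof
    assume "\<forall>K \<in> finite_vsets \<Gamma>. \<omega> K \<inter> c \<noteq> {}"
    then show "\<omega> K \<subseteq> c" using const K(1) by blast
  next
    assume sub: "\<omega> K \<subseteq> c"
    show "\<forall>L \<in> finite_vsets \<Gamma>. \<omega> L \<inter> c \<noteq> {}"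
    proof
      fix L assume L: "L \<in> finite_vsets \<Gamma>"
      have u: "K \<union> L \<in> finite_vsets \<Gamma>"
        using K L by (auto simp: finite_vsets_def)
      have "\<omega> (K \<union> L) \<subseteq> \<omega> K" "\<omega> (K \<union> L) \<subseteq> \<omega> L"
        using end_mono[OF \<omega> _ u] K L by auto
      moreover have "\<omega> (K \<union> L) \<noteq> {}"
        using comp_nonempty end_comp[OF \<omega> u] by blast
      ultimately show "\<omega> L \<inter> c \<noteq> {}" using sub by blast
    qed
  qed
qed

lemma cut_finite_vsets: "c \<in> Cuts \<Longrightarrow> \<Union>(D c) \<in> finite_vsets \<Gamma>"
proof -
  assume "c \<in> Cuts"
  then have "finite (D c)" by (simp add: cuts_iff)
  moreover have "finite e" "e \<subseteq> V" if "e \<in> D c" for e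
    using that D_subset[of c] edge_obtain[of e] by (metis finite.simps subsetD, metis empty_subsetI insert_subset subsetD)
  ultimately show ?thesis
    unfolding finite_vsets_def by blast
qed

lemma limit_ends_sym_diff:
  assumes \<omega>: "\<omega> \<in> ends \<Gamma>" and b: "b \<in> Cuts" and c: "c \<in> Cuts"
  shows "\<omega> \<in> \<Lambda> (sym_diff b c) \<longleftrightarrow> (\<omega> \<in> \<Lambda> b) \<noteq> (\<omega> \<in> \<Lambda> c)"
proof -
  define K where "K = \<Union>(D b) \<union> \<Union>(D c)"
  have K: "K \<in> finite_vsets \<Gamma>"
    using cut_finite_vsets[OF b] cut_finite_vsets[OF c] by (auto simp: K_def finite_vsets_def)
  have sub: "\<Union>(D b) \<subseteq> K" "\<Union>(D c) \<subseteq> K" "\<Union>(D (sym_diff b c)) \<subseteq> K"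
    unfolding D_sym_diff K_def by blast+
  have "\<omega> K \<noteq> {}"
    using comp_nonempty end_comp[OF \<omega> K] by blast
  then have "\<omega> K \<subseteq> sym_diff b c \<longleftrightarrow> (\<omega> K \<subseteq> b) \<noteq> (\<omega> K \<subseteq> c)"
    using limit_ends_at(2)[OF \<omega> K sub(1)] limit_ends_at(2)[OF \<omega> K sub(2)] by blast
  then show ?thesis
    using limit_ends_at(1)[OF \<omega> K sub(1)] limit_ends_at(1)[OF \<omega> K sub(2)]
      limit_ends_at(1)[OF \<omega> K sub(3)] by simp
qed

lemma limit_ends_V: "\<omega> \<in> ends \<Gamma> \<Longrightarrow> \<omega> \<in> \<Lambda> V"
  using limit_ends_at(1)[of \<omega> "{}" V] end_comp[of \<omega> "{}"] comp_subset[of "\<omega> {}" "{}"]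
  by (auto simp: finite_vsets_def)

lemma limit_ends_empty: "\<omega> \<in> ends \<Gamma> \<Longrightarrow> \<omega> \<notin> \<Lambda> {}"
  by (simp add: limit_ends_iff) (auto simp: finite_vsets_def)

lemma limit_ends_compl:
  assumes "\<omega> \<in> ends \<Gamma>" "c \<in> Cuts"
  shows "\<omega> \<in> \<Lambda> (V - c) \<longleftrightarrow> \<omega> \<notin> \<Lambda> c"
proof -
  have "V - c = sym_diff V c" using cut_subset[OF assms(2)] by blast
  then show ?thesis
    using limit_ends_sym_diff[OF assms(1) cut_V assms(2)] limit_ends_V[OF assms(1)] by simp
qed

lemma separates_iff:
  assumes "\<omega>\<^sub>1 \<in> ends \<Gamma>" "\<omega>\<^sub>2 \<in> ends \<Gamma>" "c \<in> Cuts"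
  shows "separates \<Gamma> c \<omega>\<^sub>1 \<omega>\<^sub>2 \<longleftrightarrow> (\<omega>\<^sub>1 \<in> \<Lambda> c) \<noteq> (\<omega>\<^sub>2 \<in> \<Lambda> c)"
  unfolding separates_def using limit_ends_compl assms by blast

text \<open>The component chosen outside the coboundary of \<open>c\<close> is a member of
  \<open>U\<close> lying on one side of \<open>c\<close>, so the end and the ultrafilter decide
  \<open>c\<close> alike.\<close>

lemma limit_ends_ultra:
  assumes U: "ultra U" and free: "\<And>v. v \<in> V \<Longrightarrow> V - {v} \<in> U" and c: "c \<in> Cuts"
  shows "ultra_end U \<in> \<Lambda> c \<longleftrightarrow> c \<in> U"
proof -
  define K where "K = \<Union>(D c)"
  have K: "K \<in> finite_vsets \<Gamma>" "\<Union>(D c) \<subseteq> K"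
    using cut_finite_vsets[OF c] by (auto simp: K_def)
  have e: "ultra_end U \<in> ends \<Gamma>" by (rule ultra_end_in_ends[OF U free])
  have "ultra_end U K \<in> U" using ultra_end[OF U free K(1)] by blast
  then have "ultra_end U K \<subseteq> c \<longleftrightarrow> c \<in> U"
    using limit_ends_at(2)[OF e K] ultra_up[OF U, of "ultra_end U K" c] cut_subset[OF c]
      ultra_disjoint[OF U, of "ultra_end U K" c] by blast
  then show ?thesis
    using limit_ends_at(1)[OF e K] by simp
qed

end

section \<open>Accessibility and finite generation\<close>

context peripheral_graph
begin

definition small_cuts :: "nat \<Rightarrow> 'v set set" where
  "small_cuts k = {b \<in> Ell. card (D b) \<le> k}"

text \<open>By submodularity one of \<open>x \<inter> y\<close>, \<open>x \<union> y\<close> has a small coboundary, and they differ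
  by \<open>x + y\<close>. So the span of the small cuts is a ring.\<close>

lemma small_cuts_Int:
  assumes "x \<in> sdspan (small_cuts k)" "y \<in> sdspan (small_cuts k)"
  shows "x \<inter> y \<in> sdspan (small_cuts k)"
proof (rule sdspan_Int[OF _ assms])
  fix x y assume x: "x \<in> small_cuts k" and y: "y \<in> small_cuts k"
  then have xy: "x \<in> Ell" "card (D x) \<le> k" "y \<in> Ell" "card (D y) \<le> k"
    by (auto simp: small_cuts_def)
  then have "finite (D x)" "finite (D y)"
    using elliptic_cut cuts_iff by auto
  then have sub: "card (D (x \<inter> y)) + card (D (x \<union> y)) \<le> k + k"
    using D_submodular[of x y] xy by linarith
  show "x \<inter> y \<in> sdspan (small_cuts k)"
  proof (cases "card (D (x \<inter> y)) \<le> k")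
    case True
    then show ?thesis
      using elliptic_Int xy by (intro sdspan_base) (simp add: small_cuts_def)
  next
    case False
    have "x \<union> y = sym_diff (sym_diff x y) (x \<inter> y)" by blast
    then have "x \<union> y \<in> Ell"
      using elliptic_sym_diff[OF elliptic_sym_diff[OF xy(1,3)] elliptic_Int[OF xy(1,3)]] by simp
    then have "x \<union> y \<in> sdspan (small_cuts k)"
      using False sub by (intro sdspan_base) (simp add: small_cuts_def)
    then have "sym_diff (sym_diff x y) (x \<union> y) \<in> sdspan (small_cuts k)"
      using sdspan_add[OF sdspan_add[OF sdspan_base[OF x] sdspan_base[OF y]]] by blast
    moreover have "sym_diff (sym_diff x y) (x \<union> y) = x \<inter> y" by blast
    ultimately show ?thesis by simp
  qed
qed

lemma small_cuts_elliptic: "sdspan (small_cuts k) \<subseteq> Ell"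
proof
  fix a assume "a \<in> sdspan (small_cuts k)"
  then show "a \<in> Ell"
    by (induction rule: sdspan_induct) (auto simp: small_cuts_def simp del: Un_iff intro!: elliptic_sym_diff)
qed

lemma small_cuts_compl: "x \<in> sdspan (small_cuts k) \<Longrightarrow> V - x \<in> sdspan (small_cuts k)"
proof -
  assume x: "x \<in> sdspan (small_cuts k)"
  have "V \<in> sdspan (small_cuts k)"
    by (intro sdspan_base) (simp add: small_cuts_def)
  then have "sym_diff V x \<in> sdspan (small_cuts k)"
    using x by (rule sdspan_add)
  moreover have "sym_diff V x = V - x"
    using x small_cuts_elliptic elliptic_subset by blast
  ultimately show ?thesis by simp
qed

lemma small_cuts_Un:
  assumes "x \<in> sdspan (small_cuts k)" "y \<in> sdspan (small_cuts k)"
  shows "x \<union> y \<in> sdspan (small_cuts k)"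
proof -
  have "x \<union> y = sym_diff (sym_diff x y) (x \<inter> y)" by blast
  then show ?thesis
    using sdspan_add[OF sdspan_add[OF assms] small_cuts_Int[OF assms]] by simp
qed

text \<open>With the singletons in the ring, the ultrafilters of \<open>span_small_cuts\<close> are
  free and so define ends. Finitely many orbits bound the degrees.\<close>

lemma singletons_small: "\<exists>k. \<forall>v \<in> V. {v} \<in> small_cuts k"
proof -
  obtain c where c: "\<And>p. p \<subseteq> V \<Longrightarrow> small 1 p \<Longrightarrow> card (D p) \<le> c"
    using small_card[of 1] by blast
  have "{v} \<in> small_cuts c" if v: "v \<in> V" for v
  proof -
    have "\<Union>(D {v}) \<subseteq> ball 1 v"
    proof
      fix x assume "x \<in> \<Union>(D {v})"
      then obtain e where e: "x \<in> e" "e \<in> D {v}" by blast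
      from e(2) obtain u w where "e = {u, w}" "{u, w} \<in> E" "u \<in> {v}"
        by (rule D_obtain)
      then show "x \<in> ball 1 v" using e(1) by auto
    qed
    then have s: "small 1 {v}" unfolding small_def using v by blast
    then have "{v} \<in> Cuts" using v by (intro small_cut) auto
    then have "{v} \<in> Ell"
      by (simp add: elliptic_iff splits_def)
    then show ?thesis
      using c[of "{v}"] s v by (simp add: small_cuts_def)
  qed
  then show ?thesis by blast
qed

text \<open>If \<open>b\<close> is not in the ring \<open>M\<close> spanned by the small cuts, then the members of \<open>M\<close>
  inside \<open>b\<close> and those disjoint from \<open>b\<close> generate a proper ideal. An ultrafilter of \<open>M\<close>
  avoiding it extends to two ultrafilters of sets that differ on \<open>b\<close>.\<close>

lemma span_small_cuts:
  assumes sing: "\<And>v. v \<in> V \<Longrightarrow> {v} \<in> small_cuts k"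
    and sep: "\<And>\<omega>\<^sub>1 \<omega>\<^sub>2 b. \<omega>\<^sub>1 \<in> ends \<Gamma> \<Longrightarrow> \<omega>\<^sub>2 \<in> ends \<Gamma> \<Longrightarrow> \<omega>\<^sub>1 \<noteq> \<omega>\<^sub>2 \<Longrightarrow> b \<in> Ell \<Longrightarrow>
      separates \<Gamma> b \<omega>\<^sub>1 \<omega>\<^sub>2 \<Longrightarrow> \<exists>b' \<in> small_cuts k. separates \<Gamma> b' \<omega>\<^sub>1 \<omega>\<^sub>2"
    and b: "b \<in> Ell"
  shows "b \<in> sdspan (small_cuts k)"
proof (rule ccontr)
  define M where "M = sdspan (small_cuts k)"
  assume "b \<notin> sdspan (small_cuts k)"
  then have bM: "b \<notin> M" by (simp add: M_def)
  have MV: "x \<subseteq> V" if "x \<in> M" for x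
    using that small_cuts_elliptic elliptic_subset unfolding M_def by blast
  have Mops: "{} \<in> M" "\<And>x y. x \<in> M \<Longrightarrow> y \<in> M \<Longrightarrow> x \<inter> y \<in> M" "\<And>x y. x \<in> M \<Longrightarrow> y \<in> M \<Longrightarrow> x \<union> y \<in> M"
    "\<And>x. x \<in> M \<Longrightarrow> V - x \<in> M"
    unfolding M_def using small_cuts_Int small_cuts_Un small_cuts_compl by simp_all
  have bV: "b \<subseteq> V" using b elliptic_subset by blast
  define F where "F = {V - (i \<union> j) | i j. i \<in> M \<and> j \<in> M \<and> i \<subseteq> b \<and> j \<inter> b = {}}"
  have FI: "V - (i \<union> j) \<in> F" if "i \<in> M" "j \<in> M" "i \<subseteq> b" "j \<inter> b = {}" for i j
    using that unfolding F_def by blast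
  have F_Int: "X \<inter> Y \<in> F" if XY: "X \<in> F" "Y \<in> F" for X Y
  proof -
    obtain i j where i: "X = V - (i \<union> j)" "i \<in> M" "j \<in> M" "i \<subseteq> b" "j \<inter> b = {}"
      using XY(1) unfolding F_def by blast
    obtain i' j' where i': "Y = V - (i' \<union> j')" "i' \<in> M" "j' \<in> M" "i' \<subseteq> b" "j' \<inter> b = {}"
      using XY(2) unfolding F_def by blast
    have "X \<inter> Y = V - ((i \<union> i') \<union> (j \<union> j'))"
      using i(1) i'(1) by blast
    then show ?thesis
      using FI[of "i \<union> i'" "j \<union> j'"] i i' Mops(3) by (simp add: Int_Un_distrib2)
  qed
  \<comment> \<open>Properness of the ideal: if \<open>i\<close> inside \<open>b\<close> and
    \<open>j\<close> outside \<open>b\<close> covered \<open>V\<close>, then \<open>b = i\<close>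
    would lie in \<open>M\<close>.\<close>
  have F_ne: "X \<noteq> {}" if X: "X \<in> F" for X
  proof
    assume "X = {}"
    obtain i j where i: "X = V - (i \<union> j)" "i \<in> M" "j \<in> M" "i \<subseteq> b" "j \<inter> b = {}"
      using X unfolding F_def by blast
    then have "V \<subseteq> i \<union> j" using \<open>X = {}\<close> by blast
    then have "b = i" using i(4,5) bV by blast
    then show False using bM i(2) by simp
  qed
  have F_meet: "V \<inter> \<Inter>S \<in> F" if "finite S" "S \<subseteq> F" for S
    using that
  proof (induction S)
    case empty
    then show ?case using FI[of "{}" "{}"] Mops(1) by simp
  next
    case (insert X S)
    then have "V \<inter> \<Inter>S \<in> F" "X \<in> F" by auto
    then have "X \<inter> (V \<inter> \<Inter>S) \<in> F" by (rule F_Int[rotated])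
    moreover have "X \<inter> (V \<inter> \<Inter>S) = V \<inter> \<Inter>(insert X S)" by blast
    ultimately show ?case by simp
  qed
  have "fip F" unfolding fip_def using F_meet F_ne by blast
  then obtain U where U: "F \<subseteq> U" "ultra U" using ultra_exists by blast
  \<comment> \<open>This is the side of \<open>b\<close> that \<open>U\<close> rejects. It meets
    each member of \<open>M \<inter> U\<close>, because a member of \<open>M\<close> disjoint from
    it lies in the ideal and is avoided by \<open>U\<close>; so a second ultrafilter can agree with
    \<open>U\<close> on \<open>M\<close> and accept \<open>d\<close>.\<close>
  define d where "d = (if b \<in> U then V - b else b)"
  define F' where "F' = insert d (M \<inter> U)"
  have M_meet: "V \<inter> \<Inter>S \<in> M \<inter> U" if "finite S" "S \<subseteq> M \<inter> U" for S
    using that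
  proof (induction S)
    case empty
    then show ?case using Mops(4)[OF Mops(1)] ultra_V[OF U(2)] by simp
  next
    case (insert X S)
    then have S: "V \<inter> \<Inter>S \<in> M \<inter> U" "X \<in> M \<inter> U" by auto
    then have "X \<inter> (V \<inter> \<Inter>S) \<in> M \<inter> U"
      using Mops(2) ultra_Int[OF U(2)] MV by blast
    moreover have "X \<inter> (V \<inter> \<Inter>S) = V \<inter> \<Inter>(insert X S)" by blast
    ultimately show ?case by simp
  qed
  have d_meet: "X \<inter> d \<noteq> {}" if X: "X \<in> M \<inter> U" for X
  proof
    assume e: "X \<inter> d = {}"
    have XV: "X \<subseteq> V" using X MV by blast
    have "V - X \<in> F"
    proof (cases "b \<in> U")
      case True
      then have "X \<subseteq> b" using e XV by (auto simp: d_def)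
      then show ?thesis using FI[of X "{}"] X Mops(1) by auto
    next
      case False
      then have "X \<inter> b = {}" using e by (simp add: d_def)
      then show ?thesis using FI[of "{}" X] X Mops(1) by auto
    qed
    then show False
      using U ultra_compl[OF U(2) XV] X by blast
  qed
  have "V \<inter> \<Inter>S \<noteq> {}" if S: "finite S" "S \<subseteq> F'" for S
  proof -
    have "V \<inter> \<Inter>(S - {d}) \<in> M \<inter> U"
      using S by (intro M_meet) (auto simp: F'_def)
    then have "V \<inter> \<Inter>(S - {d}) \<inter> d \<noteq> {}" by (rule d_meet)
    then show ?thesis by blast
  qed
  then have "fip F'" unfolding fip_def by blast
  then obtain U' where U': "F' \<subseteq> U'" "ultra U'" using ultra_exists by blast
  have sM: "{v} \<in> M" if "v \<in> V" for v
    using sing[OF that] unfolding M_def by (rule sdspan_base)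
  \<comment> \<open>A singleton lies inside \<open>b\<close> or is disjoint from it, so it belongs
    to the ideal.\<close>
  have free: "V - {v} \<in> U" if v: "v \<in> V" for v
  proof (cases "v \<in> b")
    case True
    then show ?thesis using FI[of "{v}" "{}"] sM[OF v] Mops(1) U(1) by auto
  next
    case False
    then show ?thesis using FI[of "{}" "{v}"] sM[OF v] Mops(1) U(1) by auto
  qed
  have free': "V - {v} \<in> U'" if v: "v \<in> V" for v
    using free[OF v] Mops(4)[OF sM[OF v]] U'(1) by (auto simp: F'_def)
  have same: "x \<in> U \<longleftrightarrow> x \<in> U'" if x: "x \<in> M" for x
    using Mops(4)[OF x] x U'(1) ultra_compl[OF U(2) MV[OF x]] ultra_compl[OF U'(2) MV[OF x]]
    unfolding F'_def by blast
  have diff: "b \<in> U \<longleftrightarrow> b \<notin> U'"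
    using U'(1) ultra_compl[OF U'(2) bV] by (auto simp: F'_def d_def split: if_splits)
  define \<omega> where "\<omega> = ultra_end U"
  define \<omega>' where "\<omega>' = ultra_end U'"
  have e: "\<omega> \<in> ends \<Gamma>" "\<omega>' \<in> ends \<Gamma>"
    unfolding \<omega>_def \<omega>'_def using ultra_end_in_ends[OF U(2) free] ultra_end_in_ends[OF U'(2) free'] by auto
  have lim: "\<omega> \<in> \<Lambda> c \<longleftrightarrow> c \<in> U" "\<omega>' \<in> \<Lambda> c \<longleftrightarrow> c \<in> U'" if "c \<in> Cuts" for c
    unfolding \<omega>_def \<omega>'_def using limit_ends_ultra[OF U(2) free that] limit_ends_ultra[OF U'(2) free' that] by auto
  have bc: "b \<in> Cuts" using b elliptic_cut by blast
  have "separates \<Gamma> b \<omega> \<omega>'"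
    using separates_iff[OF e bc] lim[OF bc] diff by blast
  moreover have "\<omega> \<noteq> \<omega>'"
    using lim[OF bc] diff by auto
  ultimately obtain b' where b': "b' \<in> small_cuts k" "separates \<Gamma> b' \<omega> \<omega>'"
    using sep[OF e _ b] by blast
  have "b' \<in> M"
    unfolding M_def using b'(1) by (rule sdspan_base)
  moreover have "b' \<in> Cuts"
    using b'(1) elliptic_cut by (simp add: small_cuts_def)
  ultimately show False
    using b'(2) separates_iff[OF e] lim same by simp
qed

section \<open>The elliptic cuts as a module\<close>

abbreviation "mod_B \<equiv> add_monoid (elliptic_ring \<Gamma> \<H>)"

lemma mod_B_simps [simp]:
  "carrier mod_B = Ell" "x \<otimes>\<^bsub>mod_B\<^esub> y = sym_diff x y" "\<one>\<^bsub>mod_B\<^esub> = {}"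
  by (simp_all add: elliptic_ring_def cut_ring_def)

lemma group_mod_B: "Group.group mod_B"
proof (rule groupI)
  fix x y z assume "x \<in> carrier mod_B" "y \<in> carrier mod_B" "z \<in> carrier mod_B"
  show "x \<otimes>\<^bsub>mod_B\<^esub> y \<otimes>\<^bsub>mod_B\<^esub> z = x \<otimes>\<^bsub>mod_B\<^esub> (y \<otimes>\<^bsub>mod_B\<^esub> z)"
    unfolding mod_B_simps by blast
next
  fix x assume "x \<in> carrier mod_B"
  then show "\<exists>y \<in> carrier mod_B. y \<otimes>\<^bsub>mod_B\<^esub> x = \<one>\<^bsub>mod_B\<^esub>"
    unfolding mod_B_simps by blast
qed (simp_all only: mod_B_simps elliptic_empty elliptic_sym_diff, simp)

lemma inv_mod_B: "x \<in> Ell \<Longrightarrow> inv\<^bsub>mod_B\<^esub> x = x"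
  by (rule Group.group.inv_equality[OF group_mod_B]) (simp_all only: mod_B_simps, simp)

lemma G_submodule_iff:
  "G_submodule G mod_B (\<lambda>g b. act g b) N \<longleftrightarrow> N \<subseteq> Ell \<and> {} \<in> N \<and>
    (\<forall>x \<in> N. \<forall>y \<in> N. sym_diff x y \<in> N) \<and> (\<forall>g \<in> carrier G. \<forall>x \<in> N. act g x \<in> N)"
proof -
  have "subgroup N mod_B \<longleftrightarrow> N \<subseteq> Ell \<and> {} \<in> N \<and> (\<forall>x \<in> N. \<forall>y \<in> N. sym_diff x y \<in> N)"
  proof
    assume "subgroup N mod_B"
    then show "N \<subseteq> Ell \<and> {} \<in> N \<and> (\<forall>x \<in> N. \<forall>y \<in> N. sym_diff x y \<in> N)"
      unfolding subgroup_def mod_B_simps by blast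
  next
    assume "N \<subseteq> Ell \<and> {} \<in> N \<and> (\<forall>x \<in> N. \<forall>y \<in> N. sym_diff x y \<in> N)"
    then show "subgroup N mod_B"
      unfolding subgroup_def mod_B_simps using inv_mod_B by (simp add: subset_iff)
  qed
  then show ?thesis
    unfolding G_submodule_def by blast
qed

theorem accessible_imp_fin_gen:
  assumes "accessible_relative \<Gamma> \<H>"
  shows "fin_gen_G_module G mod_B (\<lambda>g b. act g b)"
proof -
  obtain k0 where k0: "\<And>\<omega>\<^sub>1 \<omega>\<^sub>2 b. \<omega>\<^sub>1 \<in> ends \<Gamma> \<Longrightarrow> \<omega>\<^sub>2 \<in> ends \<Gamma> \<Longrightarrow> \<omega>\<^sub>1 \<noteq> \<omega>\<^sub>2 \<Longrightarrow> b \<in> Ell \<Longrightarrow>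
      separates \<Gamma> b \<omega>\<^sub>1 \<omega>\<^sub>2 \<Longrightarrow> \<exists>b' \<in> small_cuts k0. separates \<Gamma> b' \<omega>\<^sub>1 \<omega>\<^sub>2"
    using assms unfolding accessible_relative_def small_cuts_def by blast
  obtain k1 where k1: "\<And>v. v \<in> V \<Longrightarrow> {v} \<in> small_cuts k1"
    using singletons_small by blast
  \<comment> \<open>Raising \<open>k0\<close> preserves the separation property and lets the span
    contain the singletons.\<close>
  define k where "k = max k0 k1"
  have mono: "small_cuts k0 \<subseteq> small_cuts k" "small_cuts k1 \<subseteq> small_cuts k"
    by (auto simp: small_cuts_def k_def)
  obtain n where n: "\<And>b. b \<in> small_cuts k \<Longrightarrow> b \<in> W n"
    using elliptic_bounded[of k] unfolding small_cuts_def by blast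
  have all: "b \<in> W n" if b: "b \<in> Ell" for b
  proof -
    have "b \<in> sdspan (small_cuts k)"
      using k0 k1 mono by (intro span_small_cuts[OF _ _ b]) blast+
    moreover have "small_cuts k \<subseteq> sdspan {b \<in> Ell. small n b}"
      using n unfolding W_def by blast
    ultimately show ?thesis
      using sdspan_subset_sdspan unfolding W_def by blast
  qed
  define S where "S = {b \<in> Ell. b \<in> fst ` small_at n}"
  have "finite S" unfolding S_def using finite_small_at by simp
  moreover have SB: "S \<subseteq> Ell" by (auto simp: S_def)
  moreover have "G_span G mod_B (\<lambda>g b. act g b) S = Ell"
  proof
    have "G_submodule G mod_B (\<lambda>g b. act g b) (Ell)"
      unfolding G_submodule_iff using elliptic_sym_diff elliptic_act by simp
    then show "G_span G mod_B (\<lambda>g b. act g b) S \<subseteq> Ell"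
      unfolding G_span_def using SB by blast
  next
    have "Ell \<subseteq> N" if N: "G_submodule G mod_B (\<lambda>g b. act g b) N" "S \<subseteq> N" for N
    proof
      fix b assume "b \<in> Ell"
      then have "b \<in> W n" by (rule all)
      then show "b \<in> N"
        unfolding W_def
      proof (induction rule: sdspan_induct)
        case empty
        then show ?case using N(1) unfolding G_submodule_iff by blast
      next
        case (add x a)
        then have x: "x \<in> Ell" "small n x" by auto
        have xV: "x \<subseteq> V" using x elliptic_subset by blast
        obtain v where v: "v \<in> V" "\<Union>(D x) \<subseteq> ball n v"
          using x(2) by (auto simp: small_def)
        obtain g c u where g: "g \<in> carrier G" "(c, u) \<in> small_at n" "x = act g c" "c = act (inv g) x"
          using to_small_at[OF xV v] by blast
        have "c \<in> Ell"
          using elliptic_act[of "inv g" x] g(1,4) x(1) by simp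
        then have "c \<in> S"
          using g(2) by (force simp: S_def)
        then have "act g c \<in> N"
          using N g(1) unfolding G_submodule_iff by blast
        then show ?case
          using N(1) add(3) g(3) unfolding G_submodule_iff by simp
      qed
    qed
    then show "Ell \<subseteq> G_span G mod_B (\<lambda>g b. act g b) S"
      unfolding G_span_def by blast
  qed
  ultimately show ?thesis
    unfolding fin_gen_G_module_def mod_B_simps by blast
qed

theorem fin_gen_imp_accessible:
  assumes "fin_gen_G_module G mod_B (\<lambda>g b. act g b)"
  shows "accessible_relative \<Gamma> \<H>"
proof -
  obtain S where S: "finite S" "S \<subseteq> Ell"
    "G_span G mod_B (\<lambda>g b. act g b) S = Ell"
    using assms unfolding fin_gen_G_module_def mod_B_simps by blast
  \<comment> \<open>The inserted 1 yields \<open>k \<ge> 1\<close> and covers an empty set of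
    generators.\<close>
  define k where "k = Max (insert 1 ((\<lambda>b. card (D b)) ` S))"
  have k: "k \<ge> 1" "\<And>s. s \<in> S \<Longrightarrow> card (D s) \<le> k"
    unfolding k_def using S(1) by (auto intro!: Max_ge)
  define good where "good b \<longleftrightarrow> (\<forall>\<omega>\<^sub>1 \<in> ends \<Gamma>. \<forall>\<omega>\<^sub>2 \<in> ends \<Gamma>. separates \<Gamma> b \<omega>\<^sub>1 \<omega>\<^sub>2 \<longrightarrow>
    (\<exists>b' \<in> Ell. card (D b') \<le> k \<and> separates \<Gamma> b' \<omega>\<^sub>1 \<omega>\<^sub>2))" for b
  have good_add: "good (sym_diff b c)" if "good b" "good c" "b \<in> Cuts" "c \<in> Cuts" for b c
    unfolding good_def
  proof (intro ballI impI)
    fix \<omega>\<^sub>1 \<omega>\<^sub>2 assume w: "\<omega>\<^sub>1 \<in> ends \<Gamma>" "\<omega>\<^sub>2 \<in> ends \<Gamma>" "separates \<Gamma> (sym_diff b c) \<omega>\<^sub>1 \<omega>\<^sub>2"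
    then have "separates \<Gamma> b \<omega>\<^sub>1 \<omega>\<^sub>2 \<or> separates \<Gamma> c \<omega>\<^sub>1 \<omega>\<^sub>2"
      using separates_iff[OF w(1,2)] limit_ends_sym_diff[OF w(1) that(3,4)]
        limit_ends_sym_diff[OF w(2) that(3,4)] cut_sym_diff[OF that(3,4)] that(3,4) by auto
    then show "\<exists>b' \<in> Ell. card (D b') \<le> k \<and> separates \<Gamma> b' \<omega>\<^sub>1 \<omega>\<^sub>2"
      using that(1,2) w(1,2) unfolding good_def by blast
  qed
  \<comment> \<open>All translates are required to be good, which makes \<open>N\<close> invariant;
    it is closed under sums because ends separated by a sum are separated by a summand.\<close>
  define N where "N = {b \<in> Ell. \<forall>g \<in> carrier G. good (act g b)}"
  have "G_submodule G mod_B (\<lambda>g b. act g b) N"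
    unfolding G_submodule_iff
  proof (intro conjI ballI)
    show "N \<subseteq> Ell" by (auto simp: N_def)
    show "{} \<in> N"
      using limit_ends_empty separates_iff cut_empty by (simp add: N_def good_def)
  next
    fix x y assume xy: "x \<in> N" "y \<in> N"
    have el: "x \<in> Ell" "y \<in> Ell" using xy by (auto simp: N_def)
    have "good (act g (sym_diff x y))" if g: "g \<in> carrier G" for g
    proof -
      have "act g (sym_diff x y) = sym_diff (act g x) (act g y)"
        using act_sym_diff[OF g] el elliptic_subset by blast
      moreover have "good (sym_diff (act g x) (act g y))"
        using xy g cut_act elliptic_cut el by (intro good_add) (auto simp: N_def)
      ultimately show ?thesis by simp
    qed
    then show "sym_diff x y \<in> N"
      using elliptic_sym_diff[OF el] unfolding N_def by blast
  next
    fix g x assume g: "g \<in> carrier G" and x: "x \<in> N"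
    then have el: "x \<in> Ell" by (simp add: N_def)
    have "good (act h (act g x))" if h: "h \<in> carrier G" for h
    proof -
      have "act h (act g x) = act (h \<otimes> g) x"
        using act_mult[OF h g elliptic_subset[OF el]] by simp
      then show ?thesis using x g h by (simp add: N_def)
    qed
    then show "act g x \<in> N"
      using elliptic_act[OF g el] by (simp add: N_def)
  qed
  moreover have "S \<subseteq> N"
  proof
    fix s assume s: "s \<in> S"
    then have el: "s \<in> Ell" using S(2) by blast
    have "good (act g s)" if g: "g \<in> carrier G" for g
      unfolding good_def
    proof (intro ballI impI bexI conjI)
      show "card (D (act g s)) \<le> k"
        using card_D_act[OF g elliptic_subset[OF el]] k(2)[OF s] by simp
    qed (use elliptic_act[OF g el] in simp_all)
    then show "s \<in> N" using el by (simp add: N_def)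
  qed
  ultimately have "Ell \<subseteq> N"
    using S(3) unfolding G_span_def by blast
  have "good b" if b: "b \<in> Ell" for b
  proof -
    have "good (act \<one> b)"
      using b \<open>Ell \<subseteq> N\<close> by (auto simp: N_def)
    then show ?thesis using act_one elliptic_subset[OF b] by simp
  qed
  then show ?thesis
    unfolding accessible_relative_def good_def using k(1) by blast
qed

end

theorem theoremA:
  fixes G :: "('g, 'm) monoid_scheme"
    and \<Gamma> :: "'v ugraph"
    and \<phi> :: "'g \<Rightarrow> 'v \<Rightarrow> 'v"
    and \<H> :: "'v set set"
  assumes "group G"
    and "G_graph G \<Gamma> \<phi>"
    and "connected_graph \<Gamma>"
    and "locally_finite_graph \<Gamma>"
    and "quasi_transitive G \<Gamma> \<phi>"
    and "peripheral_system \<Gamma> \<H>"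
    and "thin \<Gamma> \<H>"
    and "G_invariant G \<phi> \<H>"
  shows "accessible_relative \<Gamma> \<H> \<longleftrightarrow>
         fin_gen_G_module G (add_monoid (elliptic_ring \<Gamma> \<H>)) (\<lambda>g b. \<phi> g ` b)"
proof -
  interpret group G by (rule assms)
  interpret peripheral_graph \<Gamma> G \<phi> \<H>
    using assms by unfold_locales (auto simp: G_graph_def)
  show ?thesis
    using accessible_imp_fin_gen fin_gen_imp_accessible by blast
qed

end
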